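(* Let $K$ be a connected semisimple Lie group and $H\subset K$ a compact subgroup with $\operatorname{rank}K=\operatorname{rank}H$, such that $K/H$ is a reductive homogeneous space with decomposition $\mathfrak{k}=\mathfrak{h}\oplus\mathfrak{m}$, $\operatorname{Ad}_H(\mathfrak{m})\subset\mathfrak{m}$, and with faithful linear isotropy representation. Assume that the restriction $B_{\mathfrak{h}}$ of the Killing form $B_{\mathfrak{k}}$ of $\mathfrak{k}$ to $\mathfrak{h}$ is non-degenerate. Let $G\to P\to K/H$ be a $K$-invariant $G$-structure with linear isotropy representation $\lambda:\mathfrak{h}\to\mathfrak{g}$, let $v\in\mathfrak{g}^*$, and let $X_v^{\lambda}\in\mathfrak{h}$ be determined by $B_{\mathfrak{h}}(X_v^{\lambda},Y)=\langle v,\lambda(Y)\rangle$ for all $Y\in\mathfrak{h}$. If $$X_v^{\lambda}\notin \operatorname{Ad}_H\Big(\bigcup_{\alpha\in\Delta\setminus\Delta(\mathfrak{h})}C_{\alpha}\Big),$$ then $v$ is fat with respect to the canonical connection in $P$.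
   Context: Roots: $\mathfrak{t}\subset\mathfrak{h}$ is a maximal abelian subalgebra of $\mathfrak{h}$; since the ranks are equal, $\mathfrak{t}^{\mathbb{C}}$ is a Cartan subalgebra of $\mathfrak{k}^{\mathbb{C}}$. $\Delta$ is the root system of $\mathfrak{k}^{\mathbb{C}}$ with respect to $\mathfrak{t}^{\mathbb{C}}$, $\Delta(\mathfrak{h})\subset\Delta$ is the root system of $\mathfrak{h}^{\mathbb{C}}$, and for $\alpha\in\Delta$, $C_{\alpha}=\ker\alpha\subset\mathfrak{t}$ is the hyperplane in $\mathfrak{t}$ defined by $\alpha$. A $G$-structure on a manifold $M$ of dimension $n$ is a reduction $G\to P\to M$ of the frame bundle $L(M)$ to a Lie group $G$ (with Lie algebra $\mathfrak{g}$). For $M=K/H$ it is $K$-invariant if every left translation $\tau(k):aH\mapsto kaH$, $k\in K$, lifts (via its differential acting on frames) to an automorphism of the $G$-structure. Fix a frame $u_o:\mathbb{R}^n\to T_o(K/H)$ in $P$ over $o=H$. The linear isotropy representation is $\lambda:H\to G$, $\lambda(h)=u_o^{-1}\,d\tau(h)_o\,u_o$; the induced Lie algebra homomorphism $\mathfrak{h}\to\mathfrak{g}$ is also denoted $\lambda$. Under $T_o(K/H)\cong\mathfrak{m}$ it is identified with the restriction of the adjoint representation to $\mathfrak{m}$. $K$-invariant connections in $P$ correspond bijectively to $\operatorname{Ad}_H$-equivariant linear maps $\Lambda_{\mathfrak{m}}:\mathfrak{m}\to\mathfrak{g}$; the canonical connection corresponds to $\Lambda_{\mathfrak{m}}=0$,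 and its curvature form (at $u_o$) is $\Theta(X,Y)=-\lambda([X,Y]_{\mathfrak{h}})$, $X,Y\in\mathfrak{m}$. A vector $v\in\mathfrak{g}^*$ is fat with respect to a connection with curvature form $\Theta$ if the two-form $(X,Y)\mapsto\langle v,\Theta(X,Y)\rangle$ is non-degenerate on horizontal vectors.
   Formalization: Fatness of v is asserted at the fixed frame u_o (hence at its K-translates), not at all frames of P: for K/H=SO(3)/SO(2), G=GL(2,R), v=tr(B·), B=[[1,3],[0,-1]], the form vanishes at some other frame. *)

theory Defs
  imports "HOL-Analysis.Analysis" "HOL-Algebra.Left_Coset"
begin

section \<open>Smooth maps and manifolds\<close>

text \<open>Class \<open>C\<^sup>k\<close> by iterated directional derivatives; meant for open \<open>S\<close>.\<close>

primrec Ck_on :: "nat \<Rightarrow> ('a::euclidean_space \<Rightarrow> 'b::real_normed_vector) \<Rightarrow> 'a set \<Rightarrow> bool" where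
  "Ck_on 0 = (\<lambda>f S. continuous_on S f)"
| "Ck_on (Suc k) = (\<lambda>f S. (\<forall>x\<in>S. f differentiable (at x)) \<and>
     (\<forall>w. Ck_on k (\<lambda>x. frechet_derivative f (at x) w) S))"

definition smooth_on :: "'a set \<Rightarrow> ('a::euclidean_space \<Rightarrow> 'b::real_normed_vector) \<Rightarrow> bool" where
  "smooth_on S f \<longleftrightarrow> (\<forall>k. Ck_on k f S)"

type_synonym ('m, 'e) chart = "'m set \<times> ('m \<Rightarrow> 'e)"

abbreviation (input) chart_inv :: "('m, 'e) chart \<Rightarrow> 'e \<Rightarrow> 'm" where
  "chart_inv c \<equiv> inv_into (fst c) (snd c)"

text \<open>The coordinate expression of \<open>f\<close> between a chart of the source and a chart of the target.\<close>

definition local_rep :: "('m, 'd) chart \<Rightarrow> ('n, 'e) chart \<Rightarrow> ('m \<Rightarrow> 'n) \<Rightarrow> 'd \<Rightarrow> 'e" where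
  "local_rep c d f = snd d \<circ> f \<circ> chart_inv c"

definition smooth_atlas :: "'m topology \<Rightarrow> ('m, 'e::euclidean_space) chart set \<Rightarrow> bool" where
  "smooth_atlas X A \<longleftrightarrow>
     Hausdorff_space X \<and> second_countable X \<and> (\<Union>c\<in>A. fst c) = topspace X \<and>
     (\<forall>c\<in>A. openin X (fst c) \<and> open (snd c ` fst c) \<and>
        homeomorphic_map (subtopology X (fst c)) (top_of_set (snd c ` fst c)) (snd c)) \<and>
     (\<forall>c\<in>A. \<forall>d\<in>A. smooth_on (snd c ` (fst c \<inter> fst d)) (local_rep c d (\<lambda>p. p)))"

text \<open>The openness clause says that \<open>f\<close> is continuous.\<close>

definition smooth_map ::
  "('m, 'd::euclidean_space) chart set \<Rightarrow> ('n, 'e::euclidean_space) chart set \<Rightarrow> ('m \<Rightarrow> 'n) \<Rightarrow> bool" where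
  "smooth_map A B f \<longleftrightarrow> (\<forall>c\<in>A. \<forall>d\<in>B.
     open (snd c ` {p \<in> fst c. f p \<in> fst d}) \<and>
     smooth_on (snd c ` {p \<in> fst c. f p \<in> fst d}) (local_rep c d f))"

definition prod_atlas ::
  "('m, 'd) chart set \<Rightarrow> ('n, 'e) chart set \<Rightarrow> ('m \<times> 'n, 'd \<times> 'e) chart set" where
  "prod_atlas A B = {(fst c \<times> fst d, map_prod (snd c) (snd d)) | c d. c \<in> A \<and> d \<in> B}"

definition real_line_atlas :: "(real, real) chart set" where
  "real_line_atlas = {(UNIV, \<lambda>s. s)}"

text \<open>A tangent vector at \<open>p\<close> is the family of its coordinate vectors in all charts around \<open>p\<close>,
  transforming by the Jacobians of the coordinate changes (and \<open>0\<close> at charts not containing \<open>p\<close>).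
  Vector space operations are pointwise.\<close>

definition tangent_space :: "('m, 'e::euclidean_space) chart set \<Rightarrow> 'm \<Rightarrow> (('m, 'e) chart \<Rightarrow> 'e) set" where
  "tangent_space A p = {\<xi>.
     (\<forall>c\<in>A. \<forall>d\<in>A. p \<in> fst c \<longrightarrow> p \<in> fst d \<longrightarrow>
        \<xi> d = frechet_derivative (local_rep c d (\<lambda>q. q)) (at (snd c p)) (\<xi> c)) \<and>
     (\<forall>c. \<not> (c \<in> A \<and> p \<in> fst c) \<longrightarrow> \<xi> c = 0)}"

text \<open>Differential at \<open>p\<close>; it does not depend on the chosen chart of the source.\<close>

definition differential ::
  "('m, 'd::euclidean_space) chart set \<Rightarrow> ('n, 'e::euclidean_space) chart set \<Rightarrow> ('m \<Rightarrow> 'n) \<Rightarrow> 'm \<Rightarrow>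
     (('m, 'd) chart \<Rightarrow> 'd) \<Rightarrow> (('n, 'e) chart \<Rightarrow> 'e)" where
  "differential A B f p \<xi> = (\<lambda>d.
     if d \<in> B \<and> f p \<in> fst d
     then let c = (SOME c. c \<in> A \<and> p \<in> fst c)
          in frechet_derivative (local_rep c d f) (at (snd c p)) (\<xi> c)
     else 0)"


section \<open>Lie groups and their Lie algebras\<close>

locale lie_group = group K for K :: "'k monoid" (structure) +
  fixes X :: "'k topology" and A :: "('k, 'e::euclidean_space) chart set"
  assumes topspace_eq: "topspace X = carrier K"
    and atlas: "smooth_atlas X A"
    and smooth_mult: "smooth_map (prod_atlas A A) A (\<lambda>(x, y). x \<otimes> y)"
    and smooth_inv: "smooth_map A A (\<lambda>x. inv x)"

text \<open>The Lie algebra of \<open>K\<close>, i.e. the tangent space at the identity, is identified with the model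
  space \<open>'e\<close> through a chart \<open>c\<close> around the identity.  \<open>Ad K c g\<close> is the derivative at the identity of
  the conjugation by \<open>g\<close>, and the bracket is given by \<open>ad\<close>, the derivative of \<open>Ad\<close> at the
  identity.\<close>

definition Ad :: "'k monoid \<Rightarrow> ('k, 'e::euclidean_space) chart \<Rightarrow> 'k \<Rightarrow> 'e \<Rightarrow> 'e" where
  "Ad K c g = frechet_derivative
     (local_rep c c (\<lambda>x. g \<otimes>\<^bsub>K\<^esub> x \<otimes>\<^bsub>K\<^esub> inv\<^bsub>K\<^esub> g)) (at (snd c \<one>\<^bsub>K\<^esub>))"

definition lie_bracket :: "'k monoid \<Rightarrow> ('k, 'e::euclidean_space) chart \<Rightarrow> 'e \<Rightarrow> 'e \<Rightarrow> 'e" where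
  "lie_bracket K c U V =
     frechet_derivative (\<lambda>x. Ad K c (chart_inv c x) V) (at (snd c \<one>\<^bsub>K\<^esub>)) U"

text \<open>The Lie algebra of a closed subgroup \<open>H\<close>, as a subspace of that of \<open>K\<close>: velocities at the
  identity of the smooth curves of \<open>K\<close> that run in \<open>H\<close>.\<close>

definition curve_at_one ::
  "'k monoid \<Rightarrow> ('k, 'e::euclidean_space) chart set \<Rightarrow> ('k, 'e) chart \<Rightarrow> 'k set \<Rightarrow> 'e \<Rightarrow> (real \<Rightarrow> 'k) \<Rightarrow> bool" where
  "curve_at_one K A c H U \<gamma> \<longleftrightarrow>
     smooth_map real_line_atlas A \<gamma> \<and> range \<gamma> \<subseteq> H \<and> \<gamma> 0 = \<one>\<^bsub>K\<^esub> \<and>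
     ((snd c \<circ> \<gamma>) has_vector_derivative U) (at 0)"

definition subgroup_lie_algebra ::
  "'k monoid \<Rightarrow> ('k, 'e::euclidean_space) chart set \<Rightarrow> ('k, 'e) chart \<Rightarrow> 'k set \<Rightarrow> 'e set" where
  "subgroup_lie_algebra K A c H = {U. \<exists>\<gamma>. curve_at_one K A c H U \<gamma>}"


section \<open>Lie algebras\<close>

text \<open>The Killing form: trace of \<open>ad U \<circ> ad V\<close>.\<close>

definition killing :: "('e::euclidean_space \<Rightarrow> 'e \<Rightarrow> 'e) \<Rightarrow> 'e \<Rightarrow> 'e \<Rightarrow> real" where
  "killing br U V = (\<Sum>b\<in>Basis. br U (br V b) \<bullet> b)"

definition nondegenerate_on :: "'e::real_vector set \<Rightarrow> ('e \<Rightarrow> 'e \<Rightarrow> real) \<Rightarrow> bool" where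
  "nondegenerate_on L b \<longleftrightarrow> (\<forall>U\<in>L. (\<forall>V\<in>L. b U V = 0) \<longrightarrow> U = 0)"

text \<open>Semisimplicity in the sense of Helgason: the Killing form is nondegenerate.\<close>

definition semisimple :: "('e::euclidean_space \<Rightarrow> 'e \<Rightarrow> 'e) \<Rightarrow> bool" where
  "semisimple br \<longleftrightarrow> nondegenerate_on UNIV (killing br)"

definition lie_subalgebra :: "('e::real_vector \<Rightarrow> 'e \<Rightarrow> 'e) \<Rightarrow> 'e set \<Rightarrow> bool" where
  "lie_subalgebra br L \<longleftrightarrow> subspace L \<and> (\<forall>U\<in>L. \<forall>V\<in>L. br U V \<in> L)"

definition maximal_abelian :: "('e::real_vector \<Rightarrow> 'e \<Rightarrow> 'e) \<Rightarrow> 'e set \<Rightarrow> 'e set \<Rightarrow> bool" where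
  "maximal_abelian br L t \<longleftrightarrow>
     lie_subalgebra br t \<and> t \<subseteq> L \<and> (\<forall>U\<in>t. \<forall>V\<in>t. br U V = 0) \<and>
     (\<forall>s. lie_subalgebra br s \<and> s \<subseteq> L \<and> (\<forall>U\<in>s. \<forall>V\<in>s. br U V = 0) \<and> t \<subseteq> s \<longrightarrow> s = t)"

primrec lower_central :: "('e::real_vector \<Rightarrow> 'e \<Rightarrow> 'e) \<Rightarrow> 'e set \<Rightarrow> nat \<Rightarrow> 'e set" where
  "lower_central br L 0 = L"
| "lower_central br L (Suc k) = span {br U V | U V. U \<in> L \<and> V \<in> lower_central br L k}"

definition cartan_subalgebra :: "('e::real_vector \<Rightarrow> 'e \<Rightarrow> 'e) \<Rightarrow> 'e set \<Rightarrow> 'e set \<Rightarrow> bool" where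
  "cartan_subalgebra br L a \<longleftrightarrow>
     lie_subalgebra br a \<and> a \<subseteq> L \<and> (\<exists>k. lower_central br a k \<subseteq> {0}) \<and>
     {U\<in>L. \<forall>V\<in>a. br U V \<in> a} = a"

text \<open>All Cartan subalgebras of a Lie algebra have the same dimension; \<open>Max\<close> only serves to pick
  this common value.\<close>

definition lie_rank :: "('e::euclidean_space \<Rightarrow> 'e \<Rightarrow> 'e) \<Rightarrow> 'e set \<Rightarrow> nat" where
  "lie_rank br L = Max (dim ` {a. cartan_subalgebra br L a})"

text \<open>The complexification of a subspace \<open>L\<close> is \<open>L \<times> L\<close>, with \<open>(U, V)\<close> standing for \<open>U + iV\<close>.\<close>

definition scaleC_pair :: "complex \<Rightarrow> 'e::real_vector \<times> 'e \<Rightarrow> 'e \<times> 'e" where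
  "scaleC_pair z Z = (Re z *\<^sub>R fst Z - Im z *\<^sub>R snd Z, Re z *\<^sub>R snd Z + Im z *\<^sub>R fst Z)"

definition bracket_pair :: "('e::real_vector \<Rightarrow> 'e \<Rightarrow> 'e) \<Rightarrow> 'e \<times> 'e \<Rightarrow> 'e \<times> 'e \<Rightarrow> 'e \<times> 'e" where
  "bracket_pair br Z W =
     (br (fst Z) (fst W) - br (snd Z) (snd W), br (fst Z) (snd W) + br (snd Z) (fst W))"

text \<open>Roots of the complexification of \<open>L\<close> with respect to that of \<open>t\<close>, as functions on the latter
  (\<open>undefined\<close> elsewhere, so that roots of different \<open>L\<close> can be compared).  Complex linearity of
  \<open>\<alpha>\<close> is a consequence of the eigenvector equation.\<close>

definition roots :: "('e::real_vector \<Rightarrow> 'e \<Rightarrow> 'e) \<Rightarrow> 'e set \<Rightarrow> 'e set \<Rightarrow> ('e \<times> 'e \<Rightarrow> complex) set" where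
  "roots br t L = {\<alpha> \<in> extensional (t \<times> t).
     (\<exists>T\<in>t \<times> t. \<alpha> T \<noteq> 0) \<and>
     (\<exists>Z\<in>L \<times> L. Z \<noteq> 0 \<and> (\<forall>T\<in>t \<times> t. bracket_pair br T Z = scaleC_pair (\<alpha> T) Z))}"

definition root_hyperplane :: "'e::real_vector set \<Rightarrow> ('e \<times> 'e \<Rightarrow> complex) \<Rightarrow> 'e set" where
  "root_hyperplane t \<alpha> = {T\<in>t. \<alpha> (T, 0) = 0}"

definition linear_on_subspace :: "'a::real_vector set \<Rightarrow> ('a \<Rightarrow> 'b::real_vector) \<Rightarrow> bool" where
  "linear_on_subspace S f \<longleftrightarrow>
     (\<forall>x\<in>S. \<forall>y\<in>S. f (x + y) = f x + f y) \<and> (\<forall>r. \<forall>x\<in>S. f (r *\<^sub>R x) = r *\<^sub>R f x)"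

text \<open>Component of \<open>U\<close> in the first summand of a direct sum decomposition.\<close>

definition proj_along :: "'e::real_vector set \<Rightarrow> 'e set \<Rightarrow> 'e \<Rightarrow> 'e" where
  "proj_along h m U = (THE V. V \<in> h \<and> U - V \<in> m)"

definition reductive_decomposition ::
  "'k monoid \<Rightarrow> ('k, 'e::euclidean_space) chart \<Rightarrow> 'k set \<Rightarrow> 'e set \<Rightarrow> 'e set \<Rightarrow> bool" where
  "reductive_decomposition K c H h m \<longleftrightarrow>
     subspace m \<and> h \<inter> m = {0} \<and> {U + V | U V. U \<in> h \<and> V \<in> m} = UNIV \<and>
     (\<forall>g\<in>H. Ad K c g ` m \<subseteq> m)"


section \<open>The homogeneous space\<close>

text \<open>The maximal smooth atlas of \<open>K/H\<close>, \<open>H\<close> closed: its charts are the injective maps \<open>\<psi>\<close> on open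
  sets of cosets whose composition with the projection \<open>k \<mapsto> kH\<close> is a smooth submersion.
  The set is empty if \<open>'n\<close> does not match the dimension of \<open>K/H\<close>.\<close>

definition homogeneous_atlas ::
  "'k monoid \<Rightarrow> 'k topology \<Rightarrow> ('k, 'e::euclidean_space) chart set \<Rightarrow> 'k set \<Rightarrow>
     ('k set, real^'n) chart set" where
  "homogeneous_atlas K X A H = {d.
     fst d \<subseteq> lcosets\<^bsub>K\<^esub> H \<and> inj_on (snd d) (fst d) \<and> open (snd d ` fst d) \<and>
     openin X {k \<in> carrier K. k <#\<^bsub>K\<^esub> H \<in> fst d} \<and>
     (\<forall>c\<in>A. let S = snd c ` {k \<in> fst c. k <#\<^bsub>K\<^esub> H \<in> fst d};
                 f = local_rep c d (\<lambda>k. k <#\<^bsub>K\<^esub> H)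
             in smooth_on S f \<and> (\<forall>x\<in>S. surj (frechet_derivative f (at x))))}"

definition left_translation :: "'k monoid \<Rightarrow> 'k \<Rightarrow> 'k set \<Rightarrow> 'k set" where
  "left_translation K k p = k <#\<^bsub>K\<^esub> p"


section \<open>Frames and G-structures\<close>

type_synonym ('m, 'n) frame = "real^'n \<Rightarrow> ('m, real^'n) chart \<Rightarrow> real^'n"

text \<open>Linear isomorphisms from \<open>real^'n\<close> onto the tangent space at \<open>p\<close>.\<close>

definition frames_at :: "('m, real^'n) chart set \<Rightarrow> 'm \<Rightarrow> ('m, 'n) frame set" where
  "frames_at B p = {u.
     (\<forall>x y. u (x + y) = (\<lambda>d. u x d + u y d)) \<and> (\<forall>r x. u (r *\<^sub>R x) = (\<lambda>d. r *\<^sub>R u x d)) \<and>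
     bij_betw u UNIV (tangent_space B p)}"

definition frame_bundle :: "'m set \<Rightarrow> ('m, real^'n) chart set \<Rightarrow> ('m \<times> ('m, 'n) frame) set" where
  "frame_bundle M B = {(p, u). p \<in> M \<and> u \<in> frames_at B p}"

text \<open>\<open>G\<close> is a, not necessarily closed, Lie subgroup of the general linear group: it carries a
  Lie group structure of its own, for which the inclusion is a smooth immersion.\<close>

definition linear_lie_group ::
  "(real^'n^'n) set \<Rightarrow> (real^'n^'n) topology \<Rightarrow> (real^'n^'n, 'g::euclidean_space) chart set \<Rightarrow> bool" where
  "linear_lie_group G Y AG \<longleftrightarrow>
     lie_group \<lparr>carrier = G, mult = (**), one = mat 1\<rparr> Y AG \<and> (\<forall>g\<in>G. invertible g) \<and>
     (\<forall>c\<in>AG. smooth_on (snd c ` fst c) (chart_inv c) \<and>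
        (\<forall>x\<in>snd c ` fst c. inj (frechet_derivative (chart_inv c) (at x))))"

definition linear_lie_algebra :: "(real^'n^'n, 'g::euclidean_space) chart set \<Rightarrow> (real^'n^'n) set" where
  "linear_lie_algebra AG =
     {V. \<exists>\<gamma>. smooth_map real_line_atlas AG \<gamma> \<and> \<gamma> 0 = mat 1 \<and> (\<gamma> has_vector_derivative V) (at 0)}"

text \<open>A reduction of the frame bundle to \<open>G\<close>: a set of frames, stable under \<open>G\<close> with \<open>G\<close> transitive
  on its fibres, that admits smooth local sections around every point.\<close>

definition G_structure ::
  "'m set \<Rightarrow> ('m, real^'n) chart set \<Rightarrow> (real^'n^'n) set \<Rightarrow> ('m \<times> ('m, 'n) frame) set \<Rightarrow> bool" where
  "G_structure M B G P \<longleftrightarrow>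
     P \<subseteq> frame_bundle M B \<and>
     (\<forall>(p, u)\<in>P. \<forall>g\<in>G. (p, u \<circ> (*v) g) \<in> P) \<and>
     (\<forall>p u u'. (p, u) \<in> P \<longrightarrow> (p, u') \<in> P \<longrightarrow> (\<exists>g\<in>G. u' = u \<circ> (*v) g)) \<and>
     (\<forall>p\<in>M. \<exists>d\<in>B. \<exists>V s. p \<in> V \<and> V \<subseteq> fst d \<and> open (snd d ` V) \<and> (\<forall>q\<in>V. (q, s q) \<in> P) \<and>
        (\<forall>x. smooth_on (snd d ` V) (\<lambda>y. s (chart_inv d y) x d)))"

definition invariant_G_structure ::
  "'k monoid \<Rightarrow> 'k topology \<Rightarrow> ('k, 'e::euclidean_space) chart set \<Rightarrow> 'k set \<Rightarrow> (real^'n^'n) set \<Rightarrow>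
     ('k set \<times> ('k set, 'n) frame) set \<Rightarrow> bool" where
  "invariant_G_structure K X A H G P \<longleftrightarrow>
     (let B = homogeneous_atlas K X A H in
      G_structure (lcosets\<^bsub>K\<^esub> H) B G P \<and>
      (\<forall>k\<in>carrier K. \<forall>(p, u)\<in>P.
         (left_translation K k p, differential B B (left_translation K k) p \<circ> u) \<in> P))"

text \<open>The linear isotropy representation \<open>h \<mapsto> u\<^sup>-\<^sup>1 \<circ> d\<tau>(h) \<circ> u\<close> at the base point \<open>H\<close>, as a
  matrix, and the Lie algebra homomorphism it induces.\<close>

definition isotropy_rep ::
  "'k monoid \<Rightarrow> 'k topology \<Rightarrow> ('k, 'e::euclidean_space) chart set \<Rightarrow> 'k set \<Rightarrow> ('k set, 'n) frame \<Rightarrow>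
     'k \<Rightarrow> real^'n^'n" where
  "isotropy_rep K X A H u g =
     (let B = homogeneous_atlas K X A H
      in matrix (inv_into UNIV u \<circ> differential B B (left_translation K g) H \<circ> u))"

definition isotropy_lie_rep ::
  "'k monoid \<Rightarrow> 'k topology \<Rightarrow> ('k, 'e::euclidean_space) chart set \<Rightarrow> ('k, 'e) chart \<Rightarrow> 'k set \<Rightarrow>
     ('k set, 'n) frame \<Rightarrow> 'e \<Rightarrow> real^'n^'n" where
  "isotropy_lie_rep K X A c H u U =
     (THE L. \<forall>\<gamma>. curve_at_one K A c H U \<gamma> \<longrightarrow>
        ((\<lambda>s. isotropy_rep K X A H u (\<gamma> s)) has_vector_derivative L) (at 0))"


section \<open>Invariant connections and fatness\<close>

text \<open>A \<open>K\<close>-invariant connection in \<open>P\<close> is given by an \<open>Ad H\<close>-equivariant linear map from \<open>m\<close> to the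
  Lie algebra of \<open>G\<close>, which acts through \<open>\<lambda>\<close>; the canonical connection is the zero map.
  \<open>rho\<close> is the isotropy representation of the group.\<close>

definition invariant_connection ::
  "'k monoid \<Rightarrow> ('k, 'e::euclidean_space) chart \<Rightarrow> 'k set \<Rightarrow> 'e set \<Rightarrow> (real^'n^'n) set \<Rightarrow>
     ('k \<Rightarrow> real^'n^'n) \<Rightarrow> ('e \<Rightarrow> real^'n^'n) \<Rightarrow> bool" where
  "invariant_connection K c H m \<gg> rho \<Lambda> \<longleftrightarrow>
     linear_on_subspace m \<Lambda> \<and> \<Lambda> ` m \<subseteq> \<gg> \<and>
     (\<forall>g\<in>H. \<forall>U\<in>m. \<Lambda> (Ad K c g U) = rho g ** \<Lambda> U ** matrix_inv (rho g))"

definition canonical_connection :: "'e \<Rightarrow> real^'n^'n" where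
  "canonical_connection = (\<lambda>U. 0)"

text \<open>Nomizu's formula for the curvature form at \<open>u\<^sub>o\<close> of the invariant connection \<open>\<Lambda>\<close>, on \<open>m\<close>
  (the horizontal vectors being identified with \<open>m\<close> by the projection to \<open>K/H\<close>):
  \<open>[\<Lambda> U, \<Lambda> V] - \<Lambda> [U, V]\<^sub>m - \<lambda> [U, V]\<^sub>h\<close>.
  For the canonical connection only the last term is left.\<close>

definition curvature ::
  "('e::real_vector \<Rightarrow> 'e \<Rightarrow> 'e) \<Rightarrow> 'e set \<Rightarrow> 'e set \<Rightarrow> ('e \<Rightarrow> real^'n^'n) \<Rightarrow> ('e \<Rightarrow> real^'n^'n) \<Rightarrow>
     'e \<Rightarrow> 'e \<Rightarrow> real^'n^'n" where
  "curvature br h m lam \<Lambda> U V =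
     (\<Lambda> U ** \<Lambda> V - \<Lambda> V ** \<Lambda> U) - \<Lambda> (proj_along m h (br U V)) - lam (proj_along h m (br U V))"

text \<open>Fatness of \<open>v\<close> for the curvature form at the fixed frame \<open>u\<^sub>o\<close>; by invariance the same form is
  obtained at all the frames \<open>d\<tau>(k) \<circ> u\<^sub>o\<close>.  At \<open>u\<^sub>o \<circ> g\<close>, \<open>g\<close> in \<open>G\<close>, it is the form for \<open>v\<close>
  transformed by the coadjoint action of \<open>g\<close>.\<close>

definition fat :: "'e::real_vector set \<Rightarrow> ('e \<Rightarrow> 'e \<Rightarrow> 'w) \<Rightarrow> ('w \<Rightarrow> real) \<Rightarrow> bool" where
  "fat m \<Theta> v \<longleftrightarrow> nondegenerate_on m (\<lambda>U V. v (\<Theta> U V))"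

lemma invariant_connection_canonical:
  "0 \<in> \<gg> \<Longrightarrow> invariant_connection K c H m \<gg> rho canonical_connection"
  by (auto simp: invariant_connection_def canonical_connection_def linear_on_subspace_def)

lemma curvature_canonical:
  "curvature br h m lam canonical_connection U V = - lam (proj_along h m (br U V))"
  by (simp add: curvature_def canonical_connection_def)

end

theory Submission
  imports Defs
begin

text \<open>
  The algebra takes place for the compact group \<open>Ad H\<close> acting on \<open>k\<close>. It has an invariant inner product, so
  \<open>ad U\<close> is skew for \<open>U \<in> h\<close>. The centraliser of \<open>t\<close> contains a Cartan subalgebra of \<open>k\<close> containing \<open>t\<close>,
  and since the ranks agree this forces the centraliser to be \<open>t\<close> itself; hence \<open>t\<close> has no zero weight in \<open>m\<close>.
  If \<open>\<alpha>\<close> were a weight of \<open>t\<close> both in \<open>h\<close> (with root vector \<open>Z\<close>) and in \<open>m\<close> (with root vector \<open>W\<close>),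
  then \<open>[conj Z, W]\<close> would have weight zero and vanish, and the norm of \<open>[Z, W]\<close> would be negative: this
  \<open>sl\<^sub>2\<close> argument replaces the one-dimensionality of root spaces.
  It follows that \<open>h\<close> and \<open>m\<close> are orthogonal for the Killing form \<open>B\<close>, so that the curvature paired with \<open>v\<close> is
  \<open>- B(X\<^sub>v, [U, V]) = - B([X\<^sub>v, U], V)\<close>, and a \<open>U\<close> in its kernel commutes with \<open>X\<^sub>v\<close>. Conjugating \<open>X\<^sub>v\<close> into \<open>t\<close>, the
  kernel of \<open>ad X\<^sub>v\<close> on \<open>m\<close>, if nonzero, contains a root vector of a root \<open>\<alpha> \<notin> \<Delta>(h)\<close> with \<open>\<alpha>(X\<^sub>v) = 0\<close>.
\<close>

section \<open>Invariant inner products of compact linear groups\<close>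

text \<open>Two forms share the work. \<open>K\<close> need not be compact, so the Killing form has
  no definite sign on m, and only the operators \<open>ad U\<close> with U in h are skew for
  \<open>q\<close>. On h the Killing form is negative definite and fixes the sign of a weight on its
  dual direction in t; the norm estimates on m are made with \<open>q\<close>. The complement m is
  merely Ad H-invariant, so its orthogonality to h has to be proved. A nonzero pairing would give a
  t-equivariant map from m to h that is injective on a complement of its kernel; it would carry a
  weight vector of m to one of h with the same weight, which the disjointness of weights forbids.
  Equal rank is a statement about dimensions of Cartan subalgebras. It becomes a statement about t
  by constructing a Cartan subalgebra inside the centraliser of t, from an element with smallest
  Fitting null component and Engel's theorem. The bracket is by definition a derivative of Ad in one
  chart. Its antisymmetry and the Jacobi identity are therefore theorems, obtained by
  differentiating identities of the group.\<close>

definition form_norm :: "('e::euclidean_space \<Rightarrow>\<^sub>L 'e) \<Rightarrow> ('e \<Rightarrow>\<^sub>L 'e) \<Rightarrow> real" where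
  "form_norm Q g = (\<Sum>b\<in>Basis. \<Sum>b'\<in>Basis. (Q (g b) \<bullet> g b')\<^sup>2)"

lemma norm_blinfun_le_entries:
  fixes Q :: "'e::euclidean_space \<Rightarrow>\<^sub>L 'e"
  shows "norm Q \<le> (\<Sum>b\<in>Basis. \<Sum>b'\<in>Basis. \<bar>Q b \<bullet> b'\<bar>)"
proof (rule norm_blinfun_bound)
  show "0 \<le> (\<Sum>b\<in>Basis. \<Sum>b'\<in>Basis. \<bar>Q b \<bullet> b'\<bar>)" by (intro sum_nonneg) auto
  fix x
  have "Q x = Q (\<Sum>b\<in>Basis. (x \<bullet> b) *\<^sub>R b)" by (simp add: euclidean_representation)
  also have "\<dots> = (\<Sum>b\<in>Basis. (x \<bullet> b) *\<^sub>R Q b)" by (simp add: blinfun.sum_right blinfun.scaleR_right)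
  finally have "norm (Q x) \<le> (\<Sum>b\<in>Basis. norm ((x \<bullet> b) *\<^sub>R Q b))" by (metis norm_sum)
  also have "\<dots> \<le> (\<Sum>b\<in>Basis. norm x * (\<Sum>b'\<in>Basis. \<bar>Q b \<bullet> b'\<bar>))"
  proof (rule sum_mono)
    fix b :: 'e assume "b \<in> Basis"
    then have "\<bar>x \<bullet> b\<bar> \<le> norm x" by (rule Basis_le_norm)
    then show "norm ((x \<bullet> b) *\<^sub>R Q b) \<le> norm x * (\<Sum>b'\<in>Basis. \<bar>Q b \<bullet> b'\<bar>)"
      using norm_le_l1[of "Q b"] by (auto intro!: mult_mono)
  qed
  finally show "norm (Q x) \<le> (\<Sum>b\<in>Basis. \<Sum>b'\<in>Basis. \<bar>Q b \<bullet> b'\<bar>) * norm x"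
    by (simp add: mult.commute flip: sum_distrib_left)
qed

text \<open>The invariant inner product is the unique minimiser of the strictly convex invariant
  function \<open>Q \<mapsto> sup {form_norm Q g | g \<in> S}\<close> on an invariant closed convex set of forms.\<close>

lemma compact_group_invariant_inner:
  fixes S :: "('e::euclidean_space \<Rightarrow>\<^sub>L 'e) set"
  assumes S: "compact S" "id_blinfun \<in> S"
    and comp: "\<And>g g'. g \<in> S \<Longrightarrow> g' \<in> S \<Longrightarrow> g o\<^sub>L g' \<in> S"
    and inv: "\<And>g. g \<in> S \<Longrightarrow> \<exists>g'\<in>S. g' o\<^sub>L g = id_blinfun"
  shows "\<exists>q::'e \<Rightarrow> 'e \<Rightarrow> real. bilinear q \<and> (\<forall>x y. q x y = q y x) \<and> (\<forall>x. x \<noteq> 0 \<longrightarrow> 0 < q x x) \<and>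
    (\<forall>g\<in>S. \<forall>x y. q (g x) (g y) = q x y)"
proof -
  have surj: "\<exists>y. x = g y" if g: "g \<in> S" for g x
  proof -
    obtain g' where g': "g' o\<^sub>L g = id_blinfun" using inv[OF g] by blast
    have "g' (g x) = x" for x using arg_cong[OF g', of "\<lambda>f. blinfun_apply f x"] by simp
    then have "inj (blinfun_apply g)" by (rule inj_on_inverseI)
    then have "surj (blinfun_apply g)"
      using linear_inj_imp_surj[OF bounded_linear.linear[OF blinfun.bounded_linear_right]] by blast
    then show ?thesis by (rule surjD)
  qed
  \<comment> \<open>A closed lower bound in place of strict positivity makes this set closed.
    Imposing it for all g makes the set stable under pulling forms back by elements of S, and g = id
    gives definiteness.\<close>
  define \<Q> where "\<Q> = {Q :: 'e \<Rightarrow>\<^sub>L 'e. (\<forall>x y. Q x \<bullet> y = x \<bullet> Q y) \<and> (\<forall>g\<in>S. \<forall>x. x \<bullet> x \<le> Q (g x) \<bullet> g x)}"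
  \<comment> \<open>\<open>form_norm Q g\<close> is the squared Frobenius norm of the form Q pulled
    back by g, so \<open>K r\<close> is a sublevel set of its supremum over the group.\<close>
  define K where "K r = {Q \<in> \<Q>. \<forall>g\<in>S. form_norm Q g \<le> r}" for r
  have "closed \<Q>"
  proof -
    have "\<Q> = {Q :: 'e \<Rightarrow>\<^sub>L 'e. \<forall>x y. Q x \<bullet> y = x \<bullet> Q y} \<inter> (\<Inter>g\<in>S. {Q :: 'e \<Rightarrow>\<^sub>L 'e. \<forall>x. x \<bullet> x \<le> Q (blinfun_apply g x) \<bullet> g x})"
      by (auto simp: \<Q>_def)
    moreover have "closed {Q :: 'e \<Rightarrow>\<^sub>L 'e. \<forall>x y. Q x \<bullet> y = x \<bullet> Q y}"
      by (intro closed_Collect_all closed_Collect_eq continuous_intros)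
    moreover have "closed {Q :: 'e \<Rightarrow>\<^sub>L 'e. \<forall>x. x \<bullet> x \<le> Q (g x) \<bullet> g x}" for g :: "'e \<Rightarrow>\<^sub>L 'e"
      by (intro closed_Collect_all closed_Collect_le continuous_intros)
    ultimately show ?thesis by auto
  qed
  have closedK: "closed (K r)" for r
  proof -
    have "K r = \<Q> \<inter> (\<Inter>g\<in>S. {Q. form_norm Q g \<le> r})" by (auto simp: K_def)
    moreover have "closed {Q. form_norm Q g \<le> r}" for g
      unfolding form_norm_def by (intro closed_Collect_le continuous_intros)
    ultimately show ?thesis using \<open>closed \<Q>\<close> by (simp only:) (intro closed_Int closed_INT ballI)
  qed
  have compactK: "compact (K r)" for r
  proof -
    have "norm Q \<le> (\<Sum>b\<in>(Basis::'e set). \<Sum>b'\<in>(Basis::'e set). sqrt r)" if Q: "Q \<in> K r" for Q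
    proof (rule order_trans[OF norm_blinfun_le_entries], intro sum_mono)
      fix b b' :: 'e assume b: "b \<in> Basis" "b' \<in> Basis"
      have "(Q b \<bullet> b')\<^sup>2 \<le> (\<Sum>b'\<in>Basis. (Q b \<bullet> b')\<^sup>2)"
        using b by (intro member_le_sum) auto
      also have "\<dots> \<le> form_norm Q id_blinfun"
        using member_le_sum[of b Basis "\<lambda>b. \<Sum>b'\<in>Basis. (Q b \<bullet> b')\<^sup>2"] b(1)
        by (simp add: form_norm_def sum_nonneg)
      also have "\<dots> \<le> r" using Q S(2) by (auto simp: K_def)
      finally show "\<bar>Q b \<bullet> b'\<bar> \<le> sqrt r" using real_le_rsqrt[of "\<bar>Q b \<bullet> b'\<bar>" r] by simp
    qed
    then have "bounded (K r)" by (auto simp: bounded_iff)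
    then show ?thesis using closedK by (simp add: compact_eq_bounded_closed)
  qed
  have contg: "continuous_on S (form_norm Q)" for Q
    unfolding form_norm_def by (intro continuous_intros)
  obtain c where c: "\<And>g. g \<in> S \<Longrightarrow> norm g \<le> c"
    using compact_imp_bounded[OF S(1)] by (auto simp: bounded_iff)
  \<comment> \<open>The bound \<open>c\<close> also holds for inverses, since they lie in S. Hence
    norm x \<le> c * norm (g x), which is the required lower bound.\<close>
  have "c\<^sup>2 *\<^sub>R id_blinfun \<in> \<Q>"
  proof -
    have "x \<bullet> x \<le> c\<^sup>2 * (g x \<bullet> g x)" if g: "g \<in> S" for g x
    proof -
      obtain g' where g': "g' \<in> S" "g' o\<^sub>L g = id_blinfun" using inv[OF g] by blast
      have "x = g' (g x)" using arg_cong[OF g'(2), of "\<lambda>f. blinfun_apply f x"] by simp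
      then have "norm x \<le> norm g' * norm (g x)" using norm_blinfun[of g' "g x"] by simp
      also have "\<dots> \<le> c * norm (g x)" using c[OF g'(1)] by (intro mult_right_mono) auto
      finally have "(norm x)\<^sup>2 \<le> (c * norm (g x))\<^sup>2" by (intro power_mono) auto
      then show ?thesis by (simp add: dot_square_norm power_mult_distrib)
    qed
    then show ?thesis by (auto simp: \<Q>_def scaleR_blinfun.rep_eq inner_commute)
  qed
  moreover have "\<exists>g0\<in>S. \<forall>g\<in>S. form_norm Q g \<le> form_norm Q g0" for Q
    using continuous_attains_sup[OF S(1) _ contg] S(2) by blast
  ultimately have "\<exists>r. K r \<noteq> {}"
    unfolding K_def by blast
  define I where "I = {r. K r \<noteq> {}}"
  have pos: "0 \<le> r" if r: "r \<in> I" for r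
  proof -
    obtain Q where "Q \<in> K r" using r by (auto simp: I_def)
    then have "form_norm Q id_blinfun \<le> r" using S(2) by (auto simp: K_def)
    moreover have "0 \<le> form_norm Q id_blinfun" unfolding form_norm_def by (intro sum_nonneg) auto
    ultimately show ?thesis by simp
  qed
  have "I \<noteq> {}" using \<open>\<exists>r. K r \<noteq> {}\<close> by (auto simp: I_def)
  have bdd: "bdd_below I" using pos by (rule bdd_belowI)
  define r0 where "r0 = Inf I"
  have mono: "K r \<subseteq> K r'" if "r \<le> r'" for r r'
    using that by (force simp: K_def)
  have ne: "K r \<noteq> {}" if r: "r0 < r" for r
  proof -
    obtain r' where "r' \<in> I" "r' < r" using cInf_lessD[OF \<open>I \<noteq> {}\<close>] r unfolding r0_def by blast
    then show ?thesis using mono[of r' r] by (auto simp: I_def)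
  qed
  \<comment> \<open>The infimum \<open>r0\<close> is attained because nonempty nested compact
    sublevel sets have a common point.\<close>
  have "(\<Inter>n. K (r0 + 1 / real (Suc n))) \<noteq> {}"
  proof (rule compact_nest)
    show "K (r0 + 1 / real (Suc n)) \<noteq> {}" for n by (rule ne) simp
    show "K (r0 + 1 / real (Suc n)) \<subseteq> K (r0 + 1 / real (Suc m))" if "m \<le> n" for m n
      using that by (intro mono add_left_mono divide_left_mono) auto
  qed (rule compactK)
  then obtain Q where Q: "\<And>n. Q \<in> K (r0 + 1 / real (Suc n))" by blast
  have "Q \<in> K r0"
  proof -
    have "form_norm Q g \<le> r0" if g: "g \<in> S" for g
    proof (rule field_le_epsilon)
      fix e :: real assume "e > 0"
      then obtain n where "1 / real (Suc n) < e" by (rule nat_approx_posE)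
      then show "form_norm Q g \<le> r0 + e" using Q[of n] g by (force simp: K_def)
    qed
    then show ?thesis using Q[of 0] by (auto simp: K_def)
  qed
  \<comment> \<open>Strict convexity: by the parallelogram law the midpoint falls below the average
    by a quarter of the \<open>form_norm\<close> of the difference. Compactness of S and
    surjectivity of its elements give this drop a positive minimum over S, so the midpoint would
    reach a level below \<open>r0\<close>.\<close>
  have unique: "Q1 = Q2" if Q12: "Q1 \<in> K r0" "Q2 \<in> K r0" for Q1 Q2
  proof (rule ccontr)
    assume "Q1 \<noteq> Q2"
    define R where "R = Q1 - Q2"
    obtain g0 where g0: "g0 \<in> S" "\<And>g. g \<in> S \<Longrightarrow> form_norm R g0 \<le> form_norm R g"
      using continuous_attains_inf[OF S(1) _ contg, of R] S(2) by blast
    have "form_norm R g0 \<noteq> 0"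
    proof
      assume "form_norm R g0 = 0"
      then have ent: "R (g0 b) \<bullet> g0 b' = 0" if "b \<in> Basis" "b' \<in> Basis" for b b'
        using that by (auto simp: form_norm_def sum_nonneg_eq_0_iff sum_nonneg)
      have "R (g0 x) \<bullet> g0 y = 0" for x y
      proof -
        have e1: "R (g0 b) \<bullet> g0 y = 0" if "b \<in> Basis" for b
        proof -
          have "R (g0 b) \<bullet> g0 (\<Sum>b'\<in>Basis. (y \<bullet> b') *\<^sub>R b') = 0"
            using ent that by (simp add: blinfun.sum_right blinfun.scaleR_right inner_sum_right)
          then show ?thesis by (simp add: euclidean_representation)
        qed
        have "R (g0 (\<Sum>b\<in>Basis. (x \<bullet> b) *\<^sub>R b)) \<bullet> g0 y = 0"
          using e1 by (simp add: blinfun.sum_right blinfun.scaleR_right inner_sum_left)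
        then show ?thesis by (simp add: euclidean_representation)
      qed
      then have "R x \<bullet> R x = 0" for x using surj[OF g0(1)] by metis
      then have "R = 0" by (intro blinfun_eqI) simp
      then show False using \<open>Q1 \<noteq> Q2\<close> by (simp add: R_def)
    qed
    moreover have "form_norm R g0 \<ge> 0" unfolding form_norm_def by (intro sum_nonneg) auto
    ultimately have d: "form_norm R g0 > 0" by simp
    define Q where "Q = (1/2) *\<^sub>R (Q1 + Q2)"
    have par: "form_norm Q g = form_norm Q1 g / 2 + form_norm Q2 g / 2 - form_norm R g / 4" for g
      unfolding form_norm_def sum_divide_distrib sum.distrib[symmetric] sum_subtractf[symmetric]
      by (intro sum.cong refl)
        (simp add: Q_def R_def scaleR_blinfun.rep_eq plus_blinfun.rep_eq minus_blinfun.rep_eq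
          inner_add_left inner_diff_left power2_eq_square field_simps)
    have "Q \<in> \<Q>"
    proof -
      have "x \<bullet> x \<le> Q (g x) \<bullet> g x" if "g \<in> S" for g x
      proof -
        have "x \<bullet> x \<le> Q1 (g x) \<bullet> g x" "x \<bullet> x \<le> Q2 (g x) \<bullet> g x"
          using Q12 that by (auto simp: K_def \<Q>_def)
        then show ?thesis
          by (simp add: Q_def scaleR_blinfun.rep_eq plus_blinfun.rep_eq inner_add_left)
      qed
      moreover have "Q x \<bullet> y = x \<bullet> Q y" for x y
        using Q12 by (simp add: K_def \<Q>_def Q_def scaleR_blinfun.rep_eq plus_blinfun.rep_eq inner_add_left inner_add_right)
      ultimately show ?thesis by (simp add: \<Q>_def)
    qed
    moreover have "form_norm Q g \<le> r0 - form_norm R g0 / 4" if "g \<in> S" for g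
      using par[of g] g0(2)[OF that] Q12 that by (force simp: K_def)
    ultimately have "r0 - form_norm R g0 / 4 \<in> I" by (auto simp: I_def K_def)
    then have "r0 \<le> r0 - form_norm R g0 / 4" unfolding r0_def using bdd by (rule cInf_lower)
    then show False using d by simp
  qed
  have invQ: "Q (g x) \<bullet> g y = Q x \<bullet> y" if g: "g \<in> S" for g x y
  proof -
    \<comment> \<open>The pullback of \<open>Q\<close> by \<open>g\<close>. Composition with
      \<open>g\<close> maps S into S, so the level \<open>r0\<close> is not exceeded, and uniqueness
      identifies \<open>Q'\<close> with \<open>Q\<close>.\<close>
    define Q' where "Q' = Blinfun (\<lambda>x. adjoint g (Q (g x)))"
    have "linear (\<lambda>x. adjoint g (Q (g x)))"
      using linear_compose[OF _ adjoint_linear[OF bounded_linear.linear[OF blinfun.bounded_linear_right[of g]]], of "\<lambda>x. Q (g x)"]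
        linear_compose[OF bounded_linear.linear[OF blinfun.bounded_linear_right[of g]] bounded_linear.linear[OF blinfun.bounded_linear_right[of Q]]]
      by (simp add: o_def)
    then have Q'x: "Q' x = adjoint g (Q (g x))" for x
      unfolding Q'_def by (subst bounded_linear_Blinfun_apply) (simp_all add: linear_conv_bounded_linear)
    have form: "Q' x \<bullet> y = Q (g x) \<bullet> g y" for x y
      using adjoint_works[OF bounded_linear.linear[OF blinfun.bounded_linear_right[of g]], of y "Q (g x)"]
      by (simp add: Q'x inner_commute)
    have symQ: "Q x \<bullet> y = x \<bullet> Q y" for x y
      using \<open>Q \<in> K r0\<close> by (simp add: K_def \<Q>_def)
    have "Q' \<in> \<Q>"
    proof -
      have "x \<bullet> x \<le> Q' (g1 x) \<bullet> g1 x" if "g1 \<in> S" for g1 x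
        using \<open>Q \<in> K r0\<close> comp[OF g that] by (force simp: K_def \<Q>_def form)
      moreover have "Q' x \<bullet> y = x \<bullet> Q' y" for x y
        using symQ[of "g x" "g y"] form[of y x] form[of x y] inner_commute[of "Q' y" x]
          inner_commute[of "Q (g y)" "g x"] by linarith
      ultimately show ?thesis by (simp add: \<Q>_def)
    qed
    moreover have "form_norm Q' g1 \<le> r0" if "g1 \<in> S" for g1
    proof -
      have "form_norm Q' g1 = form_norm Q (g o\<^sub>L g1)" by (simp add: form_norm_def form)
      then show ?thesis using \<open>Q \<in> K r0\<close> comp[OF g that] by (simp add: K_def)
    qed
    ultimately have "Q' = Q" using \<open>Q \<in> K r0\<close> by (intro unique) (auto simp: K_def)
    then show ?thesis using form[of x y] by simp
  qed
  show ?thesis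
  proof (intro exI[of _ "\<lambda>x y. Q x \<bullet> y"] conjI allI impI ballI)
    show "bilinear (\<lambda>x y. Q x \<bullet> y)"
      by (simp add: bilinear_def linear_iff inner_add_left inner_add_right blinfun.add_right blinfun.scaleR_right)
    show "Q x \<bullet> y = Q y \<bullet> x" for x y
      using \<open>Q \<in> K r0\<close> by (simp add: K_def \<Q>_def inner_commute)
    show "0 < Q x \<bullet> x" if "x \<noteq> 0" for x
    proof -
      have "x \<bullet> x \<le> Q (id_blinfun x) \<bullet> id_blinfun x"
        using \<open>Q \<in> K r0\<close> S(2) unfolding K_def \<Q>_def by blast
      then have "x \<bullet> x \<le> Q x \<bullet> x" by simp
      with that show ?thesis
        by (rule order.strict_trans2[OF inner_gt_zero_iff[THEN iffD2]])
    qed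
  qed (rule invQ)
qed

section \<open>Engel's theorem and Cartan subalgebras\<close>

text \<open>On unit vectors of \<open>L\<close> orthogonal to \<open>N\<close> the distance of f x
  from \<open>N\<close> has a positive minimum \<kappa> by compactness, while s g moves f x by at
  most \<bar>s\<bar> b. Applied to f = ad z, this keeps the null spaces of elements near z inside
  that of z.\<close>

lemma perturbation_injective_mod:
  fixes f g :: "'e::euclidean_space \<Rightarrow> 'e"
  assumes "linear f" "linear g" "subspace N" "subspace L" "N \<subseteq> L" "f ` N \<subseteq> N" "g ` N \<subseteq> N"
    and inj: "\<And>x. x \<in> L \<Longrightarrow> f x \<in> N \<Longrightarrow> x \<in> N"
  shows "\<exists>\<epsilon>>0. \<forall>s. \<bar>s\<bar> < \<epsilon> \<longrightarrow> (\<forall>x\<in>L. f x + s *\<^sub>R g x \<in> N \<longrightarrow> x \<in> N)"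
proof -
  define C where "C = {x \<in> L. norm x = 1 \<and> (\<forall>y\<in>N. x \<bullet> y = 0)}"
  have C_eq: "C = sphere 0 1 \<inter> (L \<inter> (\<Inter>y\<in>N. {x. x \<bullet> y = 0}))"
    by (auto simp: C_def)
  have "closed (\<Inter>y\<in>N. {x. x \<bullet> y = 0})"
    by (intro closed_INT ballI closed_Collect_eq continuous_intros)
  then have "compact C"
    unfolding C_eq using \<open>subspace L\<close>
    by (intro compact_Int_closed compact_sphere closed_Int closed_subspace[of L])
  have contf: "continuous_on S f" for S
    using \<open>linear f\<close> by (intro linear_continuous_on) (simp add: linear_conv_bounded_linear)
  have "N \<noteq> {}" "closed N"
    using \<open>subspace N\<close> subspace_0 closed_subspace by auto
  have "\<exists>\<kappa>>0. \<forall>x\<in>C. \<kappa> \<le> infdist (f x) N"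
  proof (cases "C = {}")
    case True
    then show ?thesis by (intro exI[of _ 1]) auto
  next
    case False
    have "continuous_on C (\<lambda>x. infdist (f x) N)"
      by (intro continuous_on_infdist contf)
    with \<open>compact C\<close> False obtain x0 where x0: "x0 \<in> C" "\<forall>x\<in>C. infdist (f x0) N \<le> infdist (f x) N"
      using continuous_attains_inf by blast
    have "x0 \<notin> N"
      using x0(1) by (auto simp: C_def)
    then have "f x0 \<notin> N"
      using x0(1) inj by (auto simp: C_def)
    then have "infdist (f x0) N > 0"
      using \<open>closed N\<close> \<open>N \<noteq> {}\<close> in_closed_iff_infdist_zero infdist_nonneg
      by (metis less_eq_real_def)
    with x0 show ?thesis by blast
  qed
  then obtain \<kappa> where \<kappa>: "\<kappa> > 0" "\<And>x. x \<in> C \<Longrightarrow> \<kappa> \<le> infdist (f x) N" by blast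
  obtain b where b: "b > 0" "\<And>x. norm (g x) \<le> b * norm x"
    using linear_bounded_pos[OF \<open>linear g\<close>] by blast
  show ?thesis
  proof (intro exI[of _ "\<kappa> / b"] conjI allI impI ballI)
    show "\<kappa> / b > 0" using \<kappa> b by simp
    fix s x assume s: "\<bar>s\<bar> < \<kappa> / b" and x: "x \<in> L" "f x + s *\<^sub>R g x \<in> N"
    obtain y z where yz: "y \<in> N" "\<And>w. w \<in> N \<Longrightarrow> orthogonal z w" "x = y + z"
      using orthogonal_subspace_decomp_exists[of N x] \<open>subspace N\<close>
      by (metis span_eq_iff)
    show "x \<in> N"
    proof (rule ccontr)
      assume "x \<notin> N"
      then have "z \<noteq> 0" using yz by auto
      have "z \<in> L"
        using yz x \<open>N \<subseteq> L\<close> \<open>subspace L\<close> subspace_diff[of L x y] by auto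
      define u where "u = z /\<^sub>R norm z"
      have "u \<in> C"
        using \<open>z \<in> L\<close> \<open>z \<noteq> 0\<close> yz(2) \<open>subspace L\<close>
        by (auto simp: C_def u_def subspace_scale orthogonal_def)
      have "f z + s *\<^sub>R g z = (f x + s *\<^sub>R g x) - (f y + s *\<^sub>R g y)"
        using \<open>linear f\<close> \<open>linear g\<close> yz(3) by (simp add: linear_add algebra_simps)
      moreover have "f y + s *\<^sub>R g y \<in> N"
        using yz(1) assms(3,6,7) by (intro subspace_add subspace_scale) auto
      ultimately have "f z + s *\<^sub>R g z \<in> N"
        using x(2) \<open>subspace N\<close> subspace_diff by metis
      then have "(f z + s *\<^sub>R g z) /\<^sub>R norm z \<in> N"
        using \<open>subspace N\<close> subspace_scale by blast
      also have "(f z + s *\<^sub>R g z) /\<^sub>R norm z = f u + s *\<^sub>R g u"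
        using \<open>linear f\<close> \<open>linear g\<close> by (simp add: u_def linear_scale algebra_simps)
      finally have "infdist (f u) N \<le> dist (f u) (f u + s *\<^sub>R g u)"
        by (rule infdist_le)
      also have "\<dots> \<le> \<bar>s\<bar> * b"
        using b(2)[of u] \<open>u \<in> C\<close> by (auto simp: dist_norm C_def intro: mult_left_mono)
      also have "\<dots> < \<kappa>" using s b by (simp add: field_simps)
      finally show False using \<kappa>(2)[OF \<open>u \<in> C\<close>] by simp
    qed
  qed
qed

lemma subspace_eq_of_dim_le:
  fixes S T :: "'e::euclidean_space set"
  assumes "subspace S" "subspace T" "S \<subseteq> T" "dim T \<le> dim S"
  shows "S = T"
  using assms by (rule subspace_dim_equal)

section \<open>Lie algebras and Engel's theorem\<close>

locale lie_algebra =
  fixes br :: "'e::euclidean_space \<Rightarrow> 'e \<Rightarrow> 'e"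
  assumes bilinear_br: "bilinear br"
    and br_swap: "br x y = - br y x"
    and jacobi: "br x (br y z) = br (br x y) z + br y (br x z)"
begin

lemma linear_br: "linear (br x)" and linear_br': "linear (\<lambda>x. br x y)"
  using bilinear_br by (auto simp: bilinear_def)

lemmas br_simps = bilinear_ladd[OF bilinear_br] bilinear_radd[OF bilinear_br]
  bilinear_lmul[OF bilinear_br] bilinear_rmul[OF bilinear_br]
  bilinear_lneg[OF bilinear_br] bilinear_rneg[OF bilinear_br]
  bilinear_lzero[OF bilinear_br] bilinear_rzero[OF bilinear_br]
  bilinear_lsub[OF bilinear_br] bilinear_rsub[OF bilinear_br]

lemma br_self [simp]: "br x x = 0"
  using br_swap[of x x] by (simp add: eq_neg_iff_add_eq_0 flip: scaleR_2)

lemma br_zero [simp]: "br 0 x = 0" "br x 0 = 0"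
  by (simp_all add: br_simps)

lemma linear_br_pow: "linear (br x ^^ k)"
proof (induction k)
  case (Suc k)
  then show ?case using linear_compose[OF _ linear_br] by (simp add: o_def)
qed (simp add: linear_ident id_def)

lemma br_pow_zero: "(br x ^^ k) y = 0 \<Longrightarrow> k \<le> l \<Longrightarrow> (br x ^^ l) y = 0"
proof -
  assume k: "(br x ^^ k) y = 0" "k \<le> l"
  then obtain d where "l = d + k"
    by (metis add.commute le_add_diff_inverse)
  then show ?thesis
    using k linear_0[OF linear_br_pow] by (simp add: funpow_add)
qed

lemma br_in_subspace_of_span:
  assumes "subspace W" "\<And>x. x \<in> M \<Longrightarrow> br x y \<in> W" "x \<in> span M"
  shows "br x y \<in> W"
  using assms(3)
proof (induction rule: span_induct)
  case base
  show ?case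
    using linear_subspace_vimage[OF linear_br'[of y] assms(1)] by (simp add: vimage_def)
qed (use assms in auto)

text \<open>Adjoining \<open>x\<close> to \<open>t\<close> still spans an abelian subalgebra of
  \<open>L\<close>, which maximality identifies with \<open>t\<close>.\<close>

lemma maximal_abelian_contains_centralizer:
  assumes "maximal_abelian br L t" "subspace L" "x \<in> L" "\<And>S. S \<in> t \<Longrightarrow> br S x = 0"
  shows "x \<in> t"
proof -
  have t: "subspace t" "t \<subseteq> L" "\<And>U V. U \<in> t \<Longrightarrow> V \<in> t \<Longrightarrow> br U V = 0"
    using assms(1) by (auto simp: maximal_abelian_def lie_subalgebra_def)
  define s where "s = span (insert x t)"
  have ab: "br U V = 0" if "U \<in> insert x t" "V \<in> insert x t" for U V
    using that t(3) assms(4) br_swap[of x] by auto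
  have ab': "br U V = 0" if "U \<in> s" "V \<in> s" for U V
  proof -
    have "br U V = 0" if "V \<in> insert x t" for V
      using br_in_subspace_of_span[of "{0}" "insert x t" V U] ab that \<open>U \<in> s\<close> by (auto simp: s_def)
    then have "br V U = 0" if "V \<in> insert x t" for V
      using that br_swap[of V U] by auto
    then have "br V U = 0"
      using br_in_subspace_of_span[of "{0}" "insert x t" U V] that(2) by (auto simp: s_def)
    then show ?thesis using br_swap[of U V] by auto
  qed
  have "s \<subseteq> L"
    unfolding s_def using assms(2,3) t(2) by (intro span_minimal) auto
  moreover have "lie_subalgebra br s"
    using ab' by (auto simp: lie_subalgebra_def s_def subspace_0)
  moreover have "t \<subseteq> s" unfolding s_def using span_superset[of "insert x t"] by auto
  ultimately have "s = t"
    using assms(1) ab' by (simp add: maximal_abelian_def)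
  then show ?thesis unfolding s_def using span_superset[of "insert x t"] by auto
qed

text \<open>A form of Engel's theorem relative to an invariant subspace \<open>W'\<close>, which replaces the passage
  to the quotient \<open>W / W'\<close>.\<close>

lemma engel_relative:
  assumes nilp: "\<And>x y. x \<in> N \<Longrightarrow> y \<in> N \<Longrightarrow> \<exists>k. (br x ^^ k) y = 0"
  shows "lie_subalgebra br M \<Longrightarrow> M \<subseteq> N \<Longrightarrow> subspace W \<Longrightarrow> subspace W' \<Longrightarrow> W' \<subset> W \<Longrightarrow> W \<subseteq> N \<Longrightarrow>
    (\<And>x w. x \<in> M \<Longrightarrow> w \<in> W \<Longrightarrow> br x w \<in> W) \<Longrightarrow> (\<And>x w. x \<in> M \<Longrightarrow> w \<in> W' \<Longrightarrow> br x w \<in> W') \<Longrightarrow>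
    \<exists>w\<in>W - W'. \<forall>x\<in>M. br x w \<in> W'"
proof (induction "dim M" arbitrary: M W W' rule: less_induct)
  case less
  note prems = less.prems
  have M: "subspace M" "\<And>x y. x \<in> M \<Longrightarrow> y \<in> M \<Longrightarrow> br x y \<in> M"
    using prems(1) by (auto simp: lie_subalgebra_def)
  show ?case
  proof (cases "M = {0}")
    case True
    then show ?thesis using prems(4,5) subspace_0 by auto
  next
    case False
    \<comment> \<open>A proper subalgebra of greatest dimension will turn out to have codimension
      one; \<open>{0}\<close> is a candidate because \<open>M\<close> is nonzero.\<close>
    define \<M> where "\<M> = {M'. lie_subalgebra br M' \<and> M' \<subset> M}"
    have "{0} \<in> \<M>"
      using False M(1) by (auto simp: \<M>_def lie_subalgebra_def subspace_0)
    moreover have "finite (dim ` \<M>)"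
      by (rule finite_subset[of _ "{..dim M}"]) (auto simp: \<M>_def intro!: dim_subset)
    ultimately obtain M' where M': "M' \<in> \<M>" and M'_max: "\<And>M''. M'' \<in> \<M> \<Longrightarrow> dim M'' \<le> dim M'"
      using Max_in[of "dim ` \<M>"] Max_ge[of "dim ` \<M>"] by (metis (no_types, lifting) empty_iff image_iff)
    have M's: "subspace M'" "\<And>x y. x \<in> M' \<Longrightarrow> y \<in> M' \<Longrightarrow> br x y \<in> M'" "M' \<subseteq> M" "lie_subalgebra br M'" "M' \<subset> M"
      using M' by (auto simp: \<M>_def lie_subalgebra_def)
    have dlt: "dim A < dim B" if "subspace A" "subspace B" "A \<subset> B" for A B :: "'e set"
      using that by (metis dim_psubset span_eq_iff)
    have lt: "dim M' < dim M"
      using M' M(1) by (intro dlt) (auto simp: \<M>_def lie_subalgebra_def)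
    \<comment> \<open>Induction hypothesis for \<open>M'\<close> acting on \<open>M\<close> modulo
      \<open>M'\<close>: the vector y found outside \<open>M'\<close> normalises it, so
      \<open>M'\<close> and y span a subalgebra, which by maximality is all of
      \<open>M\<close>.\<close>
    obtain y where y: "y \<in> M - M'" "\<And>x. x \<in> M' \<Longrightarrow> br x y \<in> M'"
      using less.hyps[OF lt M's(4) order_trans[OF M's(3) prems(2)] M(1) M's(1) M's(5) prems(2) M(2) M's(2)] M's(3)
      by (meson subset_iff)
    have Meq: "M = span (insert y M')"
    proof -
      define M1 where "M1 = span (insert y M')"
      have M1: "subspace M1" "M' \<subset> M1" "M1 \<subseteq> M"
      proof -
        show "M1 \<subseteq> M" unfolding M1_def using y M(1) M's(3) by (intro span_minimal) auto
        show "M' \<subset> M1" unfolding M1_def using y span_superset[of "insert y M'"] by auto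
      qed (simp add: M1_def)
      have b1: "br a b \<in> M1" if "a \<in> insert y M'" "b \<in> insert y M'" for a b
      proof -
        have "br a' y \<in> M1" "br y a' \<in> M1" if "a' \<in> M'" for a'
          using y(2)[OF that] M1(1,2) br_swap[of y a'] by (auto simp: subspace_neg)
        then show ?thesis using that M's(2)[of a b] M1(1,2) subspace_0[OF M1(1)] by auto
      qed
      have b2: "br a b \<in> M1" if "a \<in> M1" "b \<in> insert y M'" for a b
        using br_in_subspace_of_span[OF M1(1), of "insert y M'" b a] b1 that by (auto simp: M1_def)
      then have b3: "br b a \<in> M1" if "a \<in> M1" "b \<in> insert y M'" for a b
        using that br_swap[of b a] M1(1) by (auto simp: subspace_neg)
      have b4: "br b a \<in> M1" if "a \<in> M1" "b \<in> M1" for a b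
        using br_in_subspace_of_span[OF M1(1), of "insert y M'" a b] b3 that by (auto simp: M1_def)
      have "M1 = M"
      proof (rule ccontr)
        assume "M1 \<noteq> M"
        then have "M1 \<in> \<M>" using M1 b4 by (auto simp: \<M>_def lie_subalgebra_def)
        then have "dim M1 \<le> dim M'" by (rule M'_max)
        with dlt[OF M's(1) M1(1,2)] show False by simp
      qed
      then show ?thesis by (simp add: M1_def)
    qed
    obtain w0 where w0: "w0 \<in> W - W'" "\<And>x. x \<in> M' \<Longrightarrow> br x w0 \<in> W'"
    proof -
      have "\<exists>w\<in>W - W'. \<forall>x\<in>M'. br x w \<in> W'"
        by (rule less.hyps[OF lt M's(4)]) (use prems M's(3) in auto)
      then show ?thesis using that by blast
    qed
    \<comment> \<open>The vectors that \<open>M'\<close> sends into \<open>W'\<close>. Since y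
      normalises \<open>M'\<close>, this space is stable under ad y and contains all iterates of
      \<open>w0\<close>.\<close>
    define W1 where "W1 = {w \<in> W. \<forall>x\<in>M'. br x w \<in> W'}"
    have yW1: "br y w \<in> W1" if "w \<in> W1" for w
    proof -
      have "br x (br y w) \<in> W'" if "x \<in> M'" for x
      proof -
        have "br (br x y) w \<in> W'" using y(2)[OF that] \<open>w \<in> W1\<close> by (simp add: W1_def)
        moreover have "br y (br x w) \<in> W'" using y(1) that \<open>w \<in> W1\<close> prems(8) by (simp add: W1_def)
        ultimately show ?thesis unfolding jacobi[of x y w] by (rule subspace_add[OF prems(4)])
      qed
      then show ?thesis using \<open>w \<in> W1\<close> y(1) prems(7) by (auto simp: W1_def)
    qed
    have pow: "(br y ^^ k) w0 \<in> W1" for k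
      by (induction k) (use yW1 w0 in \<open>auto simp: W1_def\<close>)
    obtain k0 where "(br y ^^ k0) w0 = 0"
      using nilp[of y w0] y(1) w0(1) prems(2,6) by blast
    then have ex: "\<exists>k. (br y ^^ k) w0 \<in> W'"
      using prems(4) subspace_0 by metis
    \<comment> \<open>The last iterate before the orbit of \<open>w0\<close> under ad y enters
      \<open>W'\<close> is the vector sought: both y and \<open>M'\<close> send it into
      \<open>W'\<close>.\<close>
    define k where "k = (LEAST k. (br y ^^ k) w0 \<in> W')"
    have k: "(br y ^^ k) w0 \<in> W'" unfolding k_def using ex by (rule LeastI_ex)
    then obtain j where j: "k = Suc j" using w0(1) by (cases k) auto
    define w where "w = (br y ^^ j) w0"
    have "w \<notin> W'" unfolding w_def using j k_def not_less_Least by (metis lessI)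
    moreover have "br y w \<in> W'" using k j by (simp add: w_def)
    moreover have "w \<in> W1" unfolding w_def by (rule pow)
    ultimately have "w \<in> W - W'" "\<And>x. x \<in> insert y M' \<Longrightarrow> br x w \<in> W'"
      by (auto simp: W1_def)
    then show ?thesis
      using br_in_subspace_of_span[OF prems(4), of "insert y M'" w] Meq by auto
  qed
qed

text \<open>Induction on the codimension of an ideal \<open>W\<close> that the lower central series
  is to reach. The relative form gives w outside \<open>W\<close> with [N, w] inside
  \<open>W\<close>; once the series has entered the span of \<open>W\<close> and w, its next term
  lies in \<open>W\<close>.\<close>

lemma engel:
  assumes N: "lie_subalgebra br N"
    and nilp: "\<And>x y. x \<in> N \<Longrightarrow> y \<in> N \<Longrightarrow> \<exists>k. (br x ^^ k) y = 0"
  shows "\<exists>k. lower_central br N k \<subseteq> {0}"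
proof -
  have sN: "subspace N" "\<And>x y. x \<in> N \<Longrightarrow> y \<in> N \<Longrightarrow> br x y \<in> N"
    using N by (auto simp: lie_subalgebra_def)
  have "\<exists>k. lower_central br N k \<subseteq> W"
    if "subspace W" "W \<subseteq> N" "\<And>x w. x \<in> N \<Longrightarrow> w \<in> W \<Longrightarrow> br x w \<in> W" for W
    using that
  proof (induction "dim N - dim W" arbitrary: W rule: less_induct)
    case less
    show ?case
    proof (cases "W = N")
      case True
      then show ?thesis by (intro exI[of _ 0]) simp
    next
      case False
      then have "W \<subset> N" using less.prems(2) by blast
      have "\<exists>w\<in>N - W. \<forall>x\<in>N. br x w \<in> W"
        by (rule engel_relative[of N]) (fact nilp N order_refl sN less.prems \<open>W \<subset> N\<close>)+
      then obtain w where w: "w \<in> N - W" "\<And>x. x \<in> N \<Longrightarrow> br x w \<in> W"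
        by blast
      define W1 where "W1 = span (insert w W)"
      have W1: "subspace W1" "W1 \<subseteq> N" "W \<subseteq> W1" "w \<in> W1"
      proof -
        show "W1 \<subseteq> N" unfolding W1_def using w sN(1) less.prems(2) by (intro span_minimal) auto
        show "W \<subseteq> W1" "w \<in> W1" unfolding W1_def using span_superset[of "insert w W"] by auto
      qed (simp add: W1_def)
      have brW: "br x u \<in> W" if "x \<in> N" "u \<in> W1" for x u
      proof -
        have "br v x \<in> W" if "v \<in> insert w W" for v
        proof -
          have "br x v \<in> W" using that w(2)[OF \<open>x \<in> N\<close>] less.prems(3)[OF \<open>x \<in> N\<close>] by auto
          then show ?thesis using br_swap[of v x] less.prems(1) subspace_neg by metis
        qed
        then have "br u x \<in> W"
          using br_in_subspace_of_span[OF less.prems(1), of "insert w W" x u] that by (auto simp: W1_def)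
        then show ?thesis using br_swap[of x u] less.prems(1) subspace_neg by metis
      qed
      have "dim W < dim W1"
      proof (rule dim_psubset)
        have "span W = W" "span W1 = W1" using W1(1) less.prems(1) span_eq_iff by blast+
        moreover have "W \<subset> W1" using w W1 by blast
        ultimately show "span W \<subset> span W1" by metis
      qed
      moreover have "dim W1 \<le> dim N" using W1 by (intro dim_subset)
      ultimately have "dim N - dim W1 < dim N - dim W" by auto
      then obtain k where k: "lower_central br N k \<subseteq> W1"
        using less.hyps[of W1] W1 brW by blast
      have "{br U V |U V. U \<in> N \<and> V \<in> lower_central br N k} \<subseteq> W"
        using brW k by blast
      then have "lower_central br N (Suc k) \<subseteq> W"
        using less.prems(1) by (simp add: span_minimal)
      then show ?thesis by blast
    qed
  qed
  from this[of "{0}"] show ?thesis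
    using sN by (auto simp: subspace_0)
qed

end

lemma polynomial_function_linear:
  assumes "polynomial_function p" "linear (f :: 'a::euclidean_space \<Rightarrow> 'b::real_normed_vector)"
  shows "polynomial_function (\<lambda>u. f (p u))"
  unfolding polynomial_function_def o_def
proof (intro allI impI)
  fix g :: "'b \<Rightarrow> real" assume "bounded_linear g"
  then have "bounded_linear (\<lambda>x. g (f x))"
    using bounded_linear_compose[of g f] assms(2) by (simp add: linear_conv_bounded_linear)
  then show "real_polynomial_function (\<lambda>x. g (f (p x)))"
    using assms(1) by (auto simp: polynomial_function_def o_def)
qed

lemma polynomial_function_eq_0:
  fixes p :: "real \<Rightarrow> 'e::euclidean_space"
  assumes "polynomial_function p" "infinite {u. p u = 0}"
  shows "p u = 0"
proof (rule euclidean_eqI)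
  fix b :: 'e assume "b \<in> Basis"
  have "real_polynomial_function (\<lambda>u. p u \<bullet> b)"
    using assms(1) bounded_linear_inner_left[of b] by (auto simp: polynomial_function_def o_def)
  then obtain a n where a: "\<And>u. p u \<bullet> b = (\<Sum>i\<le>n. a i * u ^ i)"
    using real_polynomial_function_iff_sum by metis
  have "infinite {u. (\<Sum>i\<le>n. a i * u ^ i) = 0}"
    using assms(2) by (rule infinite_super[rotated]) (auto simp flip: a)
  then have "\<forall>i\<le>n. a i = 0"
    using polyfun_rootbound(1) by blast
  then show "p u \<bullet> b = 0 \<bullet> b" by (simp add: a)
qed

lemma has_vector_derivative_in_subspace:
  fixes f :: "real \<Rightarrow> 'e::euclidean_space"
  assumes "(f has_vector_derivative d) (at 0)" "subspace V" "\<And>s. f s \<in> V"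
  shows "d \<in> V"
proof -
  obtain y z where yz: "y \<in> V" "\<And>w. w \<in> V \<Longrightarrow> orthogonal z w" "d = y + z"
    using orthogonal_subspace_decomp_exists[of V d] span_eq_iff[THEN iffD2, OF assms(2)] by metis
  have "((\<lambda>s. f s \<bullet> z) has_vector_derivative d \<bullet> z) (at 0)"
    using bounded_linear.has_vector_derivative[OF bounded_linear_inner_left assms(1)] .
  moreover have "(\<lambda>s. f s \<bullet> z) = (\<lambda>s. 0)"
    using yz(2)[OF assms(3)] by (auto simp: orthogonal_def inner_commute)
  ultimately have "d \<bullet> z = 0"
    using has_vector_derivative_const[of 0 "at 0"] vector_derivative_unique_at by metis
  then have "z = 0"
    using yz(2)[OF yz(1)] yz(3) by (simp add: inner_add_left inner_add_right orthogonal_def inner_commute)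
  then show ?thesis using yz by simp
qed

section \<open>Fitting null components, Cartan subalgebras and regular elements\<close>

context lie_algebra
begin

definition fitting_null :: "'e \<Rightarrow> 'e set \<Rightarrow> 'e set" where
  "fitting_null z L = {w \<in> L. \<exists>k. (br z ^^ k) w = 0}"

text \<open>Since ad z is a derivation, each application of it to [a, b] uses up one power on a or
  one on b; the induction on i + j stands for the binomial formula.\<close>

lemma br_pow_br_zero:
  "(br z ^^ i) a = 0 \<Longrightarrow> (br z ^^ j) b = 0 \<Longrightarrow> (br z ^^ (i + j)) (br a b) = 0"
proof (induction "i + j" arbitrary: i j a b)
  case 0
  then show ?case by simp
next
  case (Suc n)
  show ?case
  proof (cases "i = 0 \<or> j = 0")
    case True
    then have "br a b = 0" using Suc.prems by auto
    then show ?thesis using linear_0[OF linear_br_pow] by simp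
  next
    case False
    then obtain i' j' where ij: "i = Suc i'" "j = Suc j'" by (meson not0_implies_Suc)
    have "(br z ^^ n) (br (br z a) b) = 0"
      using Suc.hyps(1)[of i' j "br z a" b] Suc.hyps(2) Suc.prems ij by (simp add: funpow_swap1)
    moreover have "(br z ^^ n) (br a (br z b)) = 0"
      using Suc.hyps(1)[of i j' a "br z b"] Suc.hyps(2) Suc.prems ij by (simp add: funpow_swap1)
    ultimately have "(br z ^^ n) (br z (br a b)) = 0"
      by (subst jacobi) (simp add: linear_add[OF linear_br_pow])
    then show ?thesis
      by (simp add: funpow_swap1 flip: Suc.hyps(2))
  qed
qed

lemma fitting_null_subalgebra:
  assumes "lie_subalgebra br L"
  shows "lie_subalgebra br (fitting_null z L)"
proof -
  have L: "subspace L" "\<And>x y. x \<in> L \<Longrightarrow> y \<in> L \<Longrightarrow> br x y \<in> L"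
    using assms by (auto simp: lie_subalgebra_def)
  have "subspace (fitting_null z L)"
    unfolding subspace_def
  proof (intro conjI ballI allI)
    show "0 \<in> fitting_null z L"
      using L(1) by (simp add: fitting_null_def subspace_0 linear_0[OF linear_br_pow])
    show "x + y \<in> fitting_null z L" if xy: "x \<in> fitting_null z L" "y \<in> fitting_null z L" for x y
    proof -
      obtain i j where "(br z ^^ i) x = 0" "(br z ^^ j) y = 0"
        using xy by (auto simp: fitting_null_def)
      then have "(br z ^^ (max i j)) (x + y) = 0"
        using br_pow_zero[of i z x "max i j"] br_pow_zero[of j z y "max i j"]
        by (simp add: linear_add[OF linear_br_pow])
      then show ?thesis using xy L(1) by (auto simp: fitting_null_def subspace_add)
    qed
    show "c *\<^sub>R x \<in> fitting_null z L" if "x \<in> fitting_null z L" for c x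
      using that L(1) by (auto simp: fitting_null_def subspace_scale linear_scale[OF linear_br_pow])
  qed
  moreover have "br x y \<in> fitting_null z L" if xy: "x \<in> fitting_null z L" "y \<in> fitting_null z L" for x y
  proof -
    obtain i j where "(br z ^^ i) x = 0" "(br z ^^ j) y = 0"
      using xy by (auto simp: fitting_null_def)
    then have "(br z ^^ (i + j)) (br x y) = 0" by (rule br_pow_br_zero)
    moreover have "br x y \<in> L" using xy L(2) by (simp add: fitting_null_def)
    ultimately show ?thesis unfolding fitting_null_def by blast
  qed
  ultimately show ?thesis by (simp add: lie_subalgebra_def)
qed

lemma fitting_null_self: "z \<in> L \<Longrightarrow> z \<in> fitting_null z L"
proof -
  assume "z \<in> L"
  moreover have "(br z ^^ 1) z = 0" by simp
  ultimately show ?thesis unfolding fitting_null_def by blast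
qed

lemma polynomial_function_br_pow: "polynomial_function (\<lambda>u::real. (br (x + u *\<^sub>R z) ^^ k) y)"
proof (induction k)
  case (Suc k)
  have "(\<lambda>u::real. (br (x + u *\<^sub>R z) ^^ Suc k) y) =
      (\<lambda>u. br x ((br (x + u *\<^sub>R z) ^^ k) y) + u *\<^sub>R br z ((br (x + u *\<^sub>R z) ^^ k) y))"
    by (simp add: br_simps)
  then show ?case
    using polynomial_function_add[OF polynomial_function_linear[OF Suc linear_br[of x]]
        polynomial_function_mult[OF polynomial_function_id polynomial_function_linear[OF Suc linear_br[of z]]]]
    by simp
qed simp

lemma br_scale_pow: "(br (c *\<^sub>R x) ^^ k) y = c ^ k *\<^sub>R (br x ^^ k) y"
  by (induction k) (simp_all add: br_simps)

text \<open>For small s the null component of z + s x is contained in that of z, hence equal to it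
  by minimality, so ad (z + s x) is nilpotent on y. Nilpotency is a polynomial condition, which then
  carries over from these elements to x itself.\<close>

lemma minimal_fitting_null_nilpotent:
  assumes L: "lie_subalgebra br L" and z: "z \<in> L"
    and min: "\<And>z'. z' \<in> L \<Longrightarrow> dim (fitting_null z L) \<le> dim (fitting_null z' L)"
    and x: "x \<in> fitting_null z L" and y: "y \<in> fitting_null z L"
  shows "\<exists>k. (br x ^^ k) y = 0"
proof -
  define N where "N = fitting_null z L"
  have sL: "subspace L" "\<And>x y. x \<in> L \<Longrightarrow> y \<in> L \<Longrightarrow> br x y \<in> L"
    using L by (auto simp: lie_subalgebra_def)
  have sN: "subspace N" "\<And>x y. x \<in> N \<Longrightarrow> y \<in> N \<Longrightarrow> br x y \<in> N" "N \<subseteq> L" "z \<in> N"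
    using fitting_null_subalgebra[OF L, of z] fitting_null_self[OF z]
    by (auto simp: lie_subalgebra_def N_def fitting_null_def)
  have inv: "w \<in> N" if w: "w \<in> L" "br z w \<in> N" for w
  proof -
    obtain k where "(br z ^^ k) (br z w) = 0" using w(2) by (auto simp: N_def fitting_null_def)
    then have "(br z ^^ Suc k) w = 0" by (simp add: funpow_swap1)
    then show ?thesis using w(1) unfolding N_def fitting_null_def by blast
  qed
  have "\<exists>\<epsilon>>0. \<forall>s. \<bar>s\<bar> < \<epsilon> \<longrightarrow> (\<forall>w\<in>L. br z w + s *\<^sub>R br x w \<in> N \<longrightarrow> w \<in> N)"
    by (rule perturbation_injective_mod)
      (use sL sN x inv linear_br in \<open>auto simp: N_def\<close>)
  then obtain \<epsilon> where \<epsilon>: "\<epsilon> > 0"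
    "\<And>s w. \<bar>s\<bar> < \<epsilon> \<Longrightarrow> w \<in> L \<Longrightarrow> br z w + s *\<^sub>R br x w \<in> N \<Longrightarrow> w \<in> N" by blast
  have nil: "\<exists>k. (br (z + s *\<^sub>R x) ^^ k) y = 0" if s: "\<bar>s\<bar> < \<epsilon>" for s
  proof -
    have zs: "z + s *\<^sub>R x \<in> L"
      using z x sL(1) by (auto simp: fitting_null_def intro!: subspace_add subspace_scale)
    \<comment> \<open>One factor is removed at a time: modulo \<open>N\<close> the perturbed
      operator is still injective.\<close>
    have "w \<in> L \<Longrightarrow> (br (z + s *\<^sub>R x) ^^ k) w = 0 \<Longrightarrow> w \<in> N" for k w
    proof (induction k arbitrary: w)
      case 0
      then show ?case using sN(1) by (simp add: subspace_0)
    next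
      case (Suc k)
      have "br (z + s *\<^sub>R x) w \<in> N"
        using Suc sL(2)[OF zs] by (simp add: funpow_swap1)
      then show ?case using \<epsilon>(2)[OF s Suc.prems(1)] by (simp add: br_simps)
    qed
    then have "fitting_null (z + s *\<^sub>R x) L \<subseteq> N"
      by (auto simp: fitting_null_def)
    moreover have "subspace (fitting_null (z + s *\<^sub>R x) L)"
      using fitting_null_subalgebra[OF L] by (simp add: lie_subalgebra_def)
    ultimately have "fitting_null (z + s *\<^sub>R x) L = N"
      using sN(1) min[OF zs] by (intro subspace_eq_of_dim_le) (auto simp: N_def)
    then show ?thesis using y by (auto simp: N_def fitting_null_def)
  qed
  \<comment> \<open>The exponent k depends on s. Countably many exponents serve an uncountable
    interval, so one of them serves infinitely many s.\<close>
  define I where "I k = {s\<in>{0<..<\<epsilon>}. (br (z + s *\<^sub>R x) ^^ k) y = 0}" for k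
  have "{0<..<\<epsilon>} \<subseteq> (\<Union>k. I k)"
    using nil by (auto simp: I_def)
  moreover have "uncountable {0<..<\<epsilon>}" using \<epsilon>(1) by (rule uncountable_open_interval[THEN iffD2])
  ultimately have "uncountable (\<Union>k. I k)" using countable_subset by blast
  then obtain k where "infinite (I k)"
    by (meson countable_UN countable_finite countableI_type)
  then have "infinite (inverse ` I k)"
    by (subst finite_image_iff) (auto simp: inj_on_def)
  moreover have "inverse ` I k \<subseteq> {u. (br (x + u *\<^sub>R z) ^^ k) y = 0}"
  proof -
  have "(br (x + u *\<^sub>R z) ^^ k) y = 0" if u: "u \<in> inverse ` I k" for u
  proof -
    obtain s where "s \<in> I k" "u = inverse s"
      using u by blast
    then have s: "s > 0" "u = inverse s" "(br (z + s *\<^sub>R x) ^^ k) y = 0"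
      by (simp_all add: I_def)
    have "x + u *\<^sub>R z = u *\<^sub>R (z + s *\<^sub>R x)" using s by (simp add: algebra_simps)
    then show ?thesis using s(3) by (simp add: br_scale_pow del: scaleR_add_right)
  qed
  then show ?thesis by blast
  qed
  ultimately have "infinite {u. (br (x + u *\<^sub>R z) ^^ k) y = 0}"
    using infinite_super by blast
  \<comment> \<open>z + s x is proportional to x + u z for u = 1 / s. With the parameter on z, the
    value u = 0 leaves ad x alone.\<close>
  from polynomial_function_eq_0[OF polynomial_function_br_pow this, of 0] show ?thesis by auto
qed

text \<open>The smallest Fitting null component is nilpotent by Engel's theorem. It is its own
  normaliser: if x normalises it, then [z, x] is killed by a power of ad z, and hence so is
  x.\<close>

lemma cartan_subalgebra_exists:
  assumes L: "lie_subalgebra br L"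
  shows "\<exists>a. cartan_subalgebra br L a"
proof -
  have "0 \<in> L" using L by (simp add: lie_subalgebra_def subspace_0)
  then obtain z where z: "z \<in> L" "\<And>z'. z' \<in> L \<Longrightarrow> dim (fitting_null z L) \<le> dim (fitting_null z' L)"
    using ex_has_least_nat[of "\<lambda>z. z \<in> L" 0 "\<lambda>z. dim (fitting_null z L)"] by blast
  define N where "N = fitting_null z L"
  have N: "lie_subalgebra br N" unfolding N_def by (rule fitting_null_subalgebra[OF L])
  have "z \<in> N" "N \<subseteq> L" unfolding N_def using fitting_null_self[OF z(1)] by (auto simp: fitting_null_def)
  have nilp: "\<exists>k. lower_central br N k \<subseteq> {0}"
    by (rule engel[OF N], unfold N_def) (rule minimal_fitting_null_nilpotent[OF L z])
  have *: "x \<in> N" if x: "x \<in> L" "\<And>V. V \<in> N \<Longrightarrow> br x V \<in> N" for x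
  proof -
    have "br z x \<in> N"
      using x(2)[OF \<open>z \<in> N\<close>] br_swap[of z x] N by (simp add: lie_subalgebra_def subspace_neg)
    then obtain k where "(br z ^^ k) (br z x) = 0" by (auto simp: N_def fitting_null_def)
    then have "(br z ^^ Suc k) x = 0" by (simp add: funpow_swap1)
    then show ?thesis using x(1) unfolding N_def fitting_null_def by blast
  qed
  have "cartan_subalgebra br L N"
  proof -
    have "{U \<in> L. \<forall>V\<in>N. br U V \<in> N} \<subseteq> N" using * by blast
    moreover have "N \<subseteq> {U \<in> L. \<forall>V\<in>N. br U V \<in> N}"
      using N \<open>N \<subseteq> L\<close> by (auto simp: lie_subalgebra_def)
    ultimately have "{U \<in> L. \<forall>V\<in>N. br U V \<in> N} = N" by (rule equalityI)
    then show ?thesis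
      using N \<open>N \<subseteq> L\<close> nilp by (simp add: cartan_subalgebra_def)
  qed
  then show ?thesis by blast
qed

text \<open>Choose T in \<open>a\<close> with the smallest kernel of ad T. The hypothesis
  \<open>ss\<close> makes ad T injective modulo its kernel, so for small s the kernel of ad (T + s
  S) lies in it and is equal to it by minimality. A vector killed by T and by T + s S is killed by
  S.\<close>

lemma regular_element:
  assumes a: "subspace a" "\<And>S T. S \<in> a \<Longrightarrow> T \<in> a \<Longrightarrow> br S T = 0"
    and ss: "\<And>T x. T \<in> a \<Longrightarrow> br T (br T x) = 0 \<Longrightarrow> br T x = 0"
  shows "\<exists>T\<in>a. \<forall>x. br T x = 0 \<longrightarrow> (\<forall>S\<in>a. br S x = 0)"
proof -
  have "0 \<in> a" using a(1) by (rule subspace_0)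
  then obtain T where T: "T \<in> a" "\<And>T'. T' \<in> a \<Longrightarrow> dim {x. br T x = 0} \<le> dim {x. br T' x = 0}"
    using ex_has_least_nat[of "\<lambda>z. z \<in> a" 0 "\<lambda>z. dim {x. br z x = 0}"] by blast
  define N where "N = {x. br T x = 0}"
  have sker: "subspace {x. br T' x = 0}" for T'
    using linear_subspace_kernel[OF linear_br] .
  have "br S x = 0" if S: "S \<in> a" and x: "x \<in> N" for S x
  proof -
    have "\<exists>\<epsilon>>0. \<forall>s. \<bar>s\<bar> < \<epsilon> \<longrightarrow> (\<forall>w\<in>UNIV. br T w + s *\<^sub>R br S w \<in> N \<longrightarrow> w \<in> N)"
    proof (rule perturbation_injective_mod)
      show "br S ` N \<subseteq> N"
        using jacobi[of T S] a(2)[OF T(1) S] by (auto simp: N_def)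
    qed (use sker linear_br ss[OF T(1)] in \<open>auto simp: N_def\<close>)
    then obtain \<epsilon> where \<epsilon>: "\<epsilon> > 0" "\<And>s w. \<bar>s\<bar> < \<epsilon> \<Longrightarrow> br T w + s *\<^sub>R br S w \<in> N \<Longrightarrow> w \<in> N" by blast
    define s where "s = \<epsilon> / 2"
    have s: "s \<noteq> 0" "\<bar>s\<bar> < \<epsilon>" using \<epsilon>(1) by (auto simp: s_def)
    define T' where "T' = T + s *\<^sub>R S"
    have "{x. br T' x = 0} \<subseteq> N"
    proof
      fix w assume "w \<in> {x. br T' x = 0}"
      then have "br T w + s *\<^sub>R br S w = 0" by (simp add: T'_def br_simps)
      then show "w \<in> N" using \<epsilon>(2)[OF s(2), of w] subspace_0[OF sker[of T]] by (simp add: N_def)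
    qed
    moreover have "T' \<in> a" unfolding T'_def using T S a(1) by (intro subspace_add subspace_scale)
    ultimately have "{x. br T' x = 0} = N"
      using T(2) sker by (intro subspace_eq_of_dim_le) (auto simp: N_def)
    then have "br T' x = 0" using x by blast
    then show ?thesis using x s(1) by (simp add: T'_def br_simps N_def)
  qed
  then show ?thesis using T(1) by (auto simp: N_def)
qed

end

section \<open>Compact automorphism groups and conjugation into a maximal abelian subalgebra\<close>

locale compact_pair = lie_algebra br for br :: "'e::euclidean_space \<Rightarrow> 'e \<Rightarrow> 'e" +
  fixes q :: "'e \<Rightarrow> 'e \<Rightarrow> real" and S :: "('e \<Rightarrow>\<^sub>L 'e) set" and h t :: "'e set"
  assumes bilinear_q: "bilinear q"
    and q_sym: "q x y = q y x"
    and q_pos: "x \<noteq> 0 \<Longrightarrow> 0 < q x x"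
    and q_inv: "g \<in> S \<Longrightarrow> q (g x) (g y) = q x y"
    and compact_S: "compact S"
    and id_S: "id_blinfun \<in> S"
    and comp_S: "g \<in> S \<Longrightarrow> g' \<in> S \<Longrightarrow> g o\<^sub>L g' \<in> S"
    and inv_S: "g \<in> S \<Longrightarrow> \<exists>g'\<in>S. g' o\<^sub>L g = id_blinfun"
    and aut_S: "g \<in> S \<Longrightarrow> g (br x y) = br (g x) (g y)"
    and h_S: "g \<in> S \<Longrightarrow> x \<in> h \<Longrightarrow> g x \<in> h"
    and tangent_S: "U \<in> h \<Longrightarrow> \<exists>\<phi>. (\<forall>s::real. \<phi> s \<in> S) \<and> \<phi> 0 = id_blinfun \<and>
      (\<forall>x. ((\<lambda>s. \<phi> s x) has_vector_derivative br U x) (at 0))"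
    and h_alg: "lie_subalgebra br h"
    and t_max: "maximal_abelian br h t"
begin

lemmas q_simps = bilinear_ladd[OF bilinear_q] bilinear_radd[OF bilinear_q]
  bilinear_lmul[OF bilinear_q] bilinear_rmul[OF bilinear_q]
  bilinear_lneg[OF bilinear_q] bilinear_rneg[OF bilinear_q]
  bilinear_lzero[OF bilinear_q] bilinear_rzero[OF bilinear_q]
  bilinear_lsub[OF bilinear_q] bilinear_rsub[OF bilinear_q]

lemma q_eq_0 [simp]: "q x x = 0 \<longleftrightarrow> x = 0"
  using q_pos[of x] by (cases "x = 0") (auto simp: q_simps)

lemma q_ge_0: "q x x \<ge> 0"
  using q_pos[of x] by (cases "x = 0") (auto simp: q_simps)

lemma h: "subspace h" "\<And>x y. x \<in> h \<Longrightarrow> y \<in> h \<Longrightarrow> br x y \<in> h"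
  using h_alg by (auto simp: lie_subalgebra_def)

lemma t: "subspace t" "t \<subseteq> h" "\<And>U V. U \<in> t \<Longrightarrow> V \<in> t \<Longrightarrow> br U V = 0"
  using t_max by (auto simp: maximal_abelian_def lie_subalgebra_def)

text \<open>Invariance of \<open>q\<close> is differentiated along the curve from
  \<open>tangent_S\<close>, which takes the place of the one-parameter group exp (s ad U).\<close>

lemma q_skew:
  assumes "U \<in> h"
  shows "q (br U x) y = - q x (br U y)"
proof -
  obtain \<phi> where \<phi>: "\<And>s::real. \<phi> s \<in> S" "\<phi> 0 = id_blinfun"
    "\<And>x. ((\<lambda>s. \<phi> s x) has_vector_derivative br U x) (at 0)"
    using tangent_S[OF assms] by blast
  have "bounded_bilinear q" using bilinear_q by (simp add: bilinear_conv_bounded_bilinear)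
  from bounded_bilinear.has_vector_derivative[OF this \<phi>(3)[of x] \<phi>(3)[of y]]
  have "((\<lambda>s. q (\<phi> s x) (\<phi> s y)) has_vector_derivative q x (br U y) + q (br U x) y) (at 0)"
    by (simp add: \<phi>(2))
  moreover have "(\<lambda>s. q (\<phi> s x) (\<phi> s y)) = (\<lambda>s. q x y)"
    using q_inv[OF \<phi>(1)] by simp
  ultimately have "q x (br U y) + q (br U x) y = 0"
    using vector_derivative_unique_at[OF _ has_vector_derivative_const] by metis
  then show ?thesis by simp
qed

text \<open>By skew-symmetry the squared \<open>q\<close>-norm of [U, x] is minus the pairing of x
  with [U, [U, x]].\<close>

lemma h_semisimple:
  assumes "U \<in> h" "br U (br U x) = 0"
  shows "br U x = 0"
  using q_skew[OF assms(1), of x "br U x"] assms(2) by (simp add: q_simps)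

lemma t_regular: "\<exists>T\<in>t. \<forall>x. br T x = 0 \<longrightarrow> (\<forall>S\<in>t. br S x = 0)"
  by (rule regular_element) (use t h_semisimple in blast)+

text \<open>Hunt's proof that every element is conjugate into a maximal torus: minimise the inner product with
  a regular element \<open>T\<close> over the orbit.\<close>

lemma conjugate_into_t:
  assumes "X \<in> h"
  shows "\<exists>g\<in>S. g X \<in> t"
proof -
  obtain T where T: "T \<in> t" "\<And>x S. br T x = 0 \<Longrightarrow> S \<in> t \<Longrightarrow> br S x = 0"
    using t_regular by blast
  have "bounded_linear (\<lambda>y. q y T)"
    using bilinear_q by (simp add: bilinear_def flip: linear_conv_bounded_linear)
  then have "continuous_on S (\<lambda>g. q (g X) T)"
    by (intro bounded_linear.continuous_on[of "\<lambda>y. q y T"] continuous_intros) auto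
  then obtain g where g: "g \<in> S" "\<And>g'. g' \<in> S \<Longrightarrow> q (g X) T \<le> q (g' X) T"
    using continuous_attains_inf[OF compact_S] id_S by blast
  have gX: "g X \<in> h" using g(1) assms by (rule h_S)
  \<comment> \<open>First variation: left multiplication by the curve with velocity ad W stays in
    \<open>S\<close>, so the minimum at s = 0 has derivative zero.\<close>
  have crit: "q (br W (g X)) T = 0" if W: "W \<in> h" for W
  proof -
    obtain \<phi> where \<phi>: "\<And>s::real. \<phi> s \<in> S" "\<phi> 0 = id_blinfun"
      "\<And>x. ((\<lambda>s. \<phi> s x) has_vector_derivative br W x) (at 0)"
      using tangent_S[OF W] by blast
    have "((\<lambda>s. q (\<phi> s (g X)) T) has_vector_derivative q (br W (g X)) T) (at 0)"
      using bounded_linear.has_vector_derivative[OF \<open>bounded_linear (\<lambda>y. q y T)\<close> \<phi>(3)] .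
    then have "((\<lambda>s. q (\<phi> s (g X)) T) has_real_derivative q (br W (g X)) T) (at 0)"
      by (simp add: has_real_derivative_iff_has_vector_derivative)
    moreover have "q (\<phi> 0 (g X)) T \<le> q (\<phi> s (g X)) T" for s
      using g(2)[OF comp_S[OF \<phi>(1) g(1)]] by (simp add: \<phi>(2))
    ultimately show ?thesis
      using DERIV_local_min[of "\<lambda>s. q (\<phi> s (g X)) T" _ 0 1] by auto
  qed
  \<comment> \<open>In the direction W = [g X, T], skew-symmetry turns the criticality condition
    into q W W = 0. Thus g X commutes with T, and by regularity of T with all of
    \<open>t\<close>.\<close>
  define W where "W = br (g X) T"
  have "W \<in> h" unfolding W_def using gX T(1) t(2) h(2) by auto
  then have "q (br (g X) W) T = 0"
    using crit[of W] br_swap[of W "g X"] by (simp add: q_simps)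
  then have "q W W = 0"
    using q_skew[OF gX, of W T] by (simp add: W_def)
  then have "br T (g X) = 0" using br_swap[of T "g X"] by (simp add: W_def)
  then have "g X \<in> t"
    using T(2) by (intro maximal_abelian_contains_centralizer[OF t_max h(1) gX]) auto
  then show ?thesis using g(1) by blast
qed

text \<open>The iterates of ad x on y run down the lower central series, so some power of ad x kills
  y; semisimplicity of ad x then reduces the exponent to one.\<close>

lemma cartan_in_h_abelian:
  assumes "cartan_subalgebra br h a" "x \<in> a" "y \<in> a"
  shows "br x y = 0"
proof -
  have a: "a \<subseteq> h" using assms(1) by (simp add: cartan_subalgebra_def)
  obtain k where k: "lower_central br a k \<subseteq> {0}"
    using assms(1) unfolding cartan_subalgebra_def by blast
  have "(br x ^^ j) y \<in> lower_central br a j" for j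
  proof (induction j)
    case (Suc j)
    then show ?case using assms(2) by (auto intro!: span_base)
  qed (use assms in simp)
  then have "(br x ^^ k) y = 0" using k by blast
  moreover have "(br x ^^ Suc j) y = 0 \<Longrightarrow> br x y = 0" for j
  proof (induction j)
    case (Suc j)
    then show ?case using h_semisimple[of x "(br x ^^ j) y"] assms(2) a by auto
  qed simp
  ultimately show ?thesis by (cases k) auto
qed

text \<open>It is enough to conjugate one regular element A of \<open>a\<close> into
  \<open>t\<close>. Then \<open>t\<close>, conjugated back, commutes with A and therefore with all
  of \<open>a\<close>; so the image of \<open>a\<close> centralises \<open>t\<close> and lies in
  it.\<close>

lemma dim_cartan_in_h:
  assumes "cartan_subalgebra br h a"
  shows "dim a \<le> dim t"
proof -
  have a: "subspace a" "a \<subseteq> h"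
    using assms by (simp_all add: cartan_subalgebra_def lie_subalgebra_def)
  have "\<exists>T\<in>a. \<forall>x. br T x = 0 \<longrightarrow> (\<forall>S\<in>a. br S x = 0)"
    by (rule regular_element) (use a cartan_in_h_abelian[OF assms] h_semisimple in blast)+
  then obtain A where A: "A \<in> a" "\<And>x B. br A x = 0 \<Longrightarrow> B \<in> a \<Longrightarrow> br B x = 0" by blast
  obtain g where g: "g \<in> S" "g A \<in> t" using conjugate_into_t A(1) a(2) by blast
  obtain g' where g': "g' \<in> S" "g' o\<^sub>L g = id_blinfun" using inv_S[OF g(1)] by blast
  have g'g: "g' (g x) = x" for x
    using arg_cong[OF g'(2), of "\<lambda>f. blinfun_apply f x"] by simp
  have inj: "inj (blinfun_apply g)" by (rule inj_on_inverseI) (rule g'g)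
  have gg': "g (g' x) = x" for x
  proof -
    have "surj (blinfun_apply g)"
      using linear_inj_imp_surj[OF bounded_linear.linear[OF blinfun.bounded_linear_right] inj] .
    then obtain y where "x = g y" by (meson surjD)
    then show ?thesis by (simp add: g'g)
  qed
  have "g B \<in> t" if B: "B \<in> a" for B
  proof (rule maximal_abelian_contains_centralizer[OF t_max h(1)])
    show "g B \<in> h" using g(1) B a(2) h_S by blast
    fix T assume T: "T \<in> t"
    have "br A (g' T) = br (g' (g A)) (g' T)" by (simp add: g'g)
    also have "\<dots> = g' (br (g A) T)" using aut_S[OF g'(1)] by simp
    also have "\<dots> = 0" using t(3)[OF g(2) T] by (simp add: blinfun.zero_right)
    finally have "br B (g' T) = 0" using A(2) B by blast
    then have "br (g B) T = 0"
      using aut_S[OF g(1), of B "g' T"] by (simp add: gg' blinfun.zero_right)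
    then show "br T (g B) = 0" using br_swap[of T "g B"] by simp
  qed
  then have "dim (blinfun_apply g ` a) \<le> dim t" by (intro dim_subset) auto
  moreover have "dim (blinfun_apply g ` a) = dim a"
    using inj by (intro dim_image_eq bounded_linear.linear blinfun.bounded_linear_right)
      (auto simp: inj_on_def)
  ultimately show ?thesis by simp
qed

lemma finite_dims: "finite (dim ` (A :: 'e set set))"
  by (rule finite_subset[of _ "{..DIM('e)}"]) (auto simp: dim_subset_UNIV)

text \<open>The bound on \<open>Max\<close> needs a nonempty set, so \<open>t\<close> itself is
  shown to be a Cartan subalgebra of \<open>h\<close>. For x normalising \<open>t\<close> one has
  [T, [T, x]] = 0, hence [T, x] = 0 by semisimplicity.\<close>

lemma lie_rank_h: "lie_rank br h \<le> dim t"
proof -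
  have "cartan_subalgebra br h t"
    unfolding cartan_subalgebra_def
  proof (intro conjI)
    have "{br U V |U V. U \<in> t \<and> V \<in> t} \<subseteq> {0}" using t(3) by auto
    then have "lower_central br t (Suc 0) \<subseteq> {0}" using span_minimal[OF _ subspace_single_0] by simp
    then show "\<exists>k. lower_central br t k \<subseteq> {0}" by blast
    have "x \<in> t" if x: "x \<in> h" "\<And>V. V \<in> t \<Longrightarrow> br x V \<in> t" for x
    proof (rule maximal_abelian_contains_centralizer[OF t_max h(1) x(1)])
      fix T assume T: "T \<in> t"
      have "br T (br T x) = 0"
        using t(3)[OF T x(2)[OF T]] br_swap[of T x] by (simp add: br_simps)
      then show "br T x = 0" using h_semisimple T t(2) by blast
    qed
    then have "{U \<in> h. \<forall>V\<in>t. br U V \<in> t} \<subseteq> t" by blast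
    moreover have "t \<subseteq> {U \<in> h. \<forall>V\<in>t. br U V \<in> t}"
    proof
      fix T assume T: "T \<in> t"
      then have "br T V \<in> t" if "V \<in> t" for V
        using t(3)[OF T that] subspace_0[OF t(1)] by simp
      then show "T \<in> {U \<in> h. \<forall>V\<in>t. br U V \<in> t}" using T t(2) by blast
    qed
    ultimately show "{U \<in> h. \<forall>V\<in>t. br U V \<in> t} = t" by blast
  qed (use t in \<open>auto simp: lie_subalgebra_def subspace_0\<close>)
  then have "dim ` {a. cartan_subalgebra br h a} \<noteq> {}" by blast
  then show ?thesis
    unfolding lie_rank_def using dim_cartan_in_h by (subst Max_le_iff[OF finite_dims]) auto
qed

text \<open>Let L be the centraliser of \<open>t\<close> and a a Cartan subalgebra of L. It contains
  \<open>t\<close>, which is central in L, and it is a Cartan subalgebra of the whole algebra. So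
  dim a is at most the common rank, which is at most dim t; hence a = \<open>t\<close>. Elements of
  L then normalise a and lie in it.\<close>

lemma centralizer_t:
  assumes rank: "lie_rank br UNIV = lie_rank br h"
    and x: "\<And>T. T \<in> t \<Longrightarrow> br T x = 0"
  shows "x \<in> t"
proof -
  define L where "L = {x. \<forall>T\<in>t. br T x = 0}"
  have "lie_subalgebra br L"
    unfolding lie_subalgebra_def
  proof (intro conjI ballI)
    show "subspace L" by (auto simp: L_def subspace_def br_simps)
    show "br U V \<in> L" if "U \<in> L" "V \<in> L" for U V
      using that by (auto simp: L_def jacobi[of _ U V])
  qed
  then obtain a where a: "cartan_subalgebra br L a" using cartan_subalgebra_exists by blast
  have sa: "subspace a" "a \<subseteq> L" using a by (simp_all add: cartan_subalgebra_def lie_subalgebra_def)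
  have norm: "x \<in> a" if "x \<in> L" "\<And>V. V \<in> a \<Longrightarrow> br x V \<in> a" for x
  proof -
    have "{U \<in> L. \<forall>V\<in>a. br U V \<in> a} = a" using a by (simp add: cartan_subalgebra_def)
    then show ?thesis using that by blast
  qed
  have "t \<subseteq> a"
  proof
    fix T assume T: "T \<in> t"
    show "T \<in> a"
    proof (rule norm)
      show "T \<in> L" using T t(3) by (auto simp: L_def)
      show "br T V \<in> a" if "V \<in> a" for V
        using that sa T subspace_0[OF sa(1)] by (auto simp: L_def)
    qed
  qed
  \<comment> \<open>The normaliser of a in the whole algebra stays in L: [x, T] lies in a, hence
    commutes with T, and semisimplicity of ad T gives [T, x] = 0.\<close>
  have "x \<in> a" if x: "\<And>V. V \<in> a \<Longrightarrow> br x V \<in> a" for x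
  proof (rule norm)
    have "br T x = 0" if T: "T \<in> t" for T
    proof (rule h_semisimple)
      have "br x T \<in> L" using x[of T] T \<open>t \<subseteq> a\<close> sa(2) by blast
      then have "br T (br x T) = 0" using T by (simp add: L_def)
      then show "br T (br T x) = 0" using br_swap[of T x] by (simp add: br_simps)
    qed (use T t(2) in auto)
    then show "x \<in> L" by (simp add: L_def)
  qed (use x in auto)
  then have "{U \<in> UNIV. \<forall>V\<in>a. br U V \<in> a} \<subseteq> a" by blast
  moreover have "a \<subseteq> {U \<in> UNIV. \<forall>V\<in>a. br U V \<in> a}"
    using a by (simp add: cartan_subalgebra_def lie_subalgebra_def subset_iff)
  ultimately have "{U \<in> UNIV. \<forall>V\<in>a. br U V \<in> a} = a" by (rule equalityI)
  then have "cartan_subalgebra br UNIV a"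
    using a by (simp add: cartan_subalgebra_def)
  then have "dim a \<le> lie_rank br UNIV"
    unfolding lie_rank_def by (intro Max_ge finite_dims) auto
  then have "dim a \<le> dim t" using rank lie_rank_h by simp
  then have "t = a" using sa(1) t(1) \<open>t \<subseteq> a\<close> by (intro subspace_eq_of_dim_le)
  show ?thesis
  proof -
    have "x \<in> a"
    proof (rule norm)
      show "x \<in> L" using x by (simp add: L_def)
      show "br x V \<in> a" if "V \<in> a" for V
        using x[of V] that \<open>t = a\<close> br_swap[of x V] subspace_0[OF sa(1)] by simp
    qed
    then show ?thesis using \<open>t = a\<close> by simp
  qed
qed

end

section \<open>Weights and the Killing form\<close>

text \<open>Positivity is asked on \<open>V\<close> alone because the lemma serves both
  \<open>q\<close> and minus the Killing form, which is known to be positive on \<open>h\<close>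
  only. An orthonormal family of greatest cardinality must span \<open>V\<close>, since a nonzero
  residue could be normalised and added.\<close>

lemma orthonormal_basis_exists:
  fixes p :: "'e::euclidean_space \<Rightarrow> 'e \<Rightarrow> real"
  assumes p: "bilinear p" "\<And>x y. p x y = p y x"
    and V: "subspace V" "\<And>x. x \<in> V \<Longrightarrow> x \<noteq> 0 \<Longrightarrow> 0 < p x x"
  shows "\<exists>E. finite E \<and> E \<subseteq> V \<and> (\<forall>e\<in>E. \<forall>f\<in>E. p e f = (if e = f then 1 else 0)) \<and>
    (\<forall>x\<in>V. x = (\<Sum>e\<in>E. p x e *\<^sub>R e))"
proof -
  note p_simps = bilinear_ladd[OF p(1)] bilinear_radd[OF p(1)] bilinear_lmul[OF p(1)] bilinear_rmul[OF p(1)]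
    bilinear_lzero[OF p(1)] bilinear_rzero[OF p(1)] bilinear_lsub[OF p(1)] bilinear_rsub[OF p(1)]
  have p_sum: "p (\<Sum>e\<in>E. u e *\<^sub>R e) f = (\<Sum>e\<in>E. u e * p e f)" for E u f
    by (induction E rule: infinite_finite_induct) (simp_all add: p_simps)
  define \<E> where "\<E> = {E. finite E \<and> E \<subseteq> V \<and> (\<forall>e\<in>E. \<forall>f\<in>E. p e f = (if e = f then 1 else 0))}"
  have pick: "(\<Sum>e\<in>E. u e * p e f) = u f" if E: "E \<in> \<E>" and "f \<in> E" for E u f
  proof -
    have "(\<Sum>e\<in>E. u e * p e f) = (\<Sum>e\<in>E. if e = f then u f else 0)"
      using that by (intro sum.cong) (auto simp: \<E>_def)
    then show ?thesis using that by (simp add: \<E>_def)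
  qed
  have card_le: "card E \<le> DIM('e)" if E: "E \<in> \<E>" for E
  proof -
    have fin: "finite E" using E by (simp add: \<E>_def)
    have "independent E"
    proof
      assume "dependent E"
      then obtain u v where uv: "v \<in> E" "u v \<noteq> 0" "(\<Sum>v\<in>E. u v *\<^sub>R v) = 0"
        using dependent_finite[OF fin] by auto
      then show False using pick[OF E uv(1), of u] p_sum[of u E v] by (simp add: p_simps)
    qed
    then show ?thesis by (rule independent_bound[THEN conjunct2])
  qed
  have "{} \<in> \<E>" by (simp add: \<E>_def)
  then obtain E where E: "E \<in> \<E>" "\<And>E'. E' \<in> \<E> \<Longrightarrow> card E' \<le> card E"
    using ex_has_greatest_nat[of "\<lambda>E. E \<in> \<E>" "{}" card "Suc DIM('e)"] card_le by (metis le_imp_less_Suc)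
  have "x = (\<Sum>e\<in>E. p x e *\<^sub>R e)" if x: "x \<in> V" for x
  proof (rule ccontr)
    define r where "r = x - (\<Sum>e\<in>E. p x e *\<^sub>R e)"
    assume "x \<noteq> (\<Sum>e\<in>E. p x e *\<^sub>R e)"
    then have "r \<noteq> 0" by (simp add: r_def)
    have "r \<in> V"
      unfolding r_def using x E(1) V(1)
      by (intro subspace_diff subspace_sum subspace_scale) (auto simp: \<E>_def)
    have rE: "p r f = 0" if "f \<in> E" for f
      using pick[OF E(1) that, of "p x"] by (simp add: r_def p_simps p_sum)
    define f where "f = (1 / sqrt (p r r)) *\<^sub>R r"
    have rr: "p r r > 0" using V(2) \<open>r \<in> V\<close> \<open>r \<noteq> 0\<close> by blast
    have ff: "p f f = 1" using rr by (simp add: f_def p_simps)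
    have fE: "p f e = 0" "p e f = 0" if "e \<in> E" for e
      using rE[OF that] p(2)[of e r] by (simp_all add: f_def p_simps)
    have "f \<notin> E" using fE(1)[of f] ff by auto
    have "insert f E \<in> \<E>"
      using E(1) ff fE \<open>f \<notin> E\<close> \<open>r \<in> V\<close> V(1) by (auto simp: \<E>_def f_def subspace_scale)
    then have "card (insert f E) \<le> card E" by (rule E(2))
    then show False using \<open>f \<notin> E\<close> E(1) by (simp add: \<E>_def)
  qed
  then show ?thesis using E(1) unfolding \<E>_def by blast
qed

section \<open>Traces and invariance of the Killing form\<close>

definition linear_trace :: "('e::euclidean_space \<Rightarrow> 'e) \<Rightarrow> real" where
  "linear_trace f = (\<Sum>b\<in>Basis. f b \<bullet> b)"

lemma linear_trace_commute:
  fixes f g :: "'e::euclidean_space \<Rightarrow> 'e"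
  assumes "linear f" "linear g"
  shows "linear_trace (\<lambda>x. f (g x)) = linear_trace (\<lambda>x. g (f x))"
proof -
  have e: "f (g b) \<bullet> b = (\<Sum>c\<in>Basis. (g b \<bullet> c) * (f c \<bullet> b))" if "linear f" for f g :: "'e \<Rightarrow> 'e" and b
  proof -
    have "f (g b) = f (\<Sum>c\<in>Basis. (g b \<bullet> c) *\<^sub>R c)" by (simp add: euclidean_representation)
    also have "\<dots> = (\<Sum>c\<in>Basis. (g b \<bullet> c) *\<^sub>R f c)"
      using that by (simp add: linear_sum linear_scale)
    finally show ?thesis by (simp add: inner_sum_left)
  qed
  have "linear_trace (\<lambda>x. f (g x)) = (\<Sum>b\<in>Basis. \<Sum>c\<in>Basis. (g b \<bullet> c) * (f c \<bullet> b))"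
    by (simp add: linear_trace_def e[OF assms(1)])
  also have "\<dots> = (\<Sum>c\<in>Basis. \<Sum>b\<in>Basis. (f c \<bullet> b) * (g b \<bullet> c))"
    by (subst sum.swap) (simp add: mult.commute)
  also have "\<dots> = linear_trace (\<lambda>x. g (f x))"
    by (simp add: linear_trace_def e[OF assms(2)])
  finally show ?thesis .
qed

text \<open>The Killing form is defined with the standard basis; this moves its trace to a basis
  orthonormal for an invariant form, where skew-symmetry can be applied.\<close>

lemma linear_trace_orthonormal:
  fixes p :: "'e::euclidean_space \<Rightarrow> 'e \<Rightarrow> real"
  assumes "bilinear p" "linear f" "finite E" "\<And>x. x = (\<Sum>e\<in>E. p x e *\<^sub>R e)"
  shows "linear_trace f = (\<Sum>e\<in>E. p (f e) e)"
proof -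
  have "f b \<bullet> b = (\<Sum>e\<in>E. p b e * (f e \<bullet> b))" for b
  proof -
    have "f b = f (\<Sum>e\<in>E. p b e *\<^sub>R e)" using assms(4) by metis
    also have "\<dots> = (\<Sum>e\<in>E. p b e *\<^sub>R f e)"
      using assms(2) by (simp add: linear_sum linear_scale)
    finally show ?thesis by (simp add: inner_sum_left)
  qed
  then have "linear_trace f = (\<Sum>e\<in>E. \<Sum>b\<in>Basis. p b e * (f e \<bullet> b))"
    unfolding linear_trace_def by (subst sum.swap) simp
  also have "\<dots> = (\<Sum>e\<in>E. p (f e) e)"
  proof (rule sum.cong[OF refl])
    fix e
    have lin: "linear (\<lambda>x. p x e)" using assms(1) by (simp add: bilinear_def)
    have "p (\<Sum>b\<in>Basis. (f e \<bullet> b) *\<^sub>R b) e = (\<Sum>b\<in>Basis. (f e \<bullet> b) * p b e)"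
      by (simp add: linear_sum[OF lin] linear_scale[OF lin])
    then show "(\<Sum>b\<in>Basis. p b e * (f e \<bullet> b)) = p (f e) e"
      by (simp add: euclidean_representation mult.commute)
  qed
  finally show ?thesis .
qed

context lie_algebra
begin

lemma killing_trace: "killing br x y = linear_trace (\<lambda>z. br x (br y z))"
  by (simp add: killing_def linear_trace_def)

lemma linear_br_br: "linear (\<lambda>w. br x (br y w))"
  using linear_compose[OF linear_br linear_br] by (simp add: o_def)

lemma killing_sym: "killing br x y = killing br y x"
  unfolding killing_trace by (rule linear_trace_commute[OF linear_br linear_br])

lemma bilinear_killing: "bilinear (killing br)"
proof -
  have "linear (killing br x)" for x
    by (simp add: linear_iff killing_def br_simps inner_add_left sum.distrib sum_distrib_left)
  then show ?thesis unfolding bilinear_def using killing_sym by (metis (no_types, lifting) ext)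
qed

lemmas killing_simps = bilinear_ladd[OF bilinear_killing] bilinear_radd[OF bilinear_killing]
  bilinear_lmul[OF bilinear_killing] bilinear_rmul[OF bilinear_killing]
  bilinear_lneg[OF bilinear_killing] bilinear_rneg[OF bilinear_killing]
  bilinear_lzero[OF bilinear_killing] bilinear_rzero[OF bilinear_killing]
  bilinear_lsub[OF bilinear_killing] bilinear_rsub[OF bilinear_killing]

text \<open>Writing ad [z, x] and ad [z, y] as commutators gives four traces of triple products; two
  are identical and cyclicity matches the others.\<close>

lemma killing_invariant: "killing br (br z x) y = - killing br x (br z y)"
proof -
  have tr_diff: "linear_trace (\<lambda>w. f w - g w) = linear_trace f - linear_trace g" for f g :: "'e \<Rightarrow> 'e"
    by (simp add: linear_trace_def inner_diff_left sum_subtractf)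
  have br2: "br (br a b) w = br a (br b w) - br b (br a w)" for a b w
    by (simp add: jacobi[of a b w])
  have "killing br (br z x) y = linear_trace (\<lambda>w. br z (br x (br y w))) - linear_trace (\<lambda>w. br x (br z (br y w)))"
    unfolding killing_trace br2 tr_diff ..
  moreover have "killing br x (br z y) = linear_trace (\<lambda>w. br x (br z (br y w))) - linear_trace (\<lambda>w. br x (br y (br z w)))"
    unfolding killing_trace br2 br_simps tr_diff ..
  moreover have "linear_trace (\<lambda>w. br z (br x (br y w))) = linear_trace (\<lambda>w. br x (br y (br z w)))"
    by (rule linear_trace_commute[OF linear_br linear_br_br])
  ultimately show ?thesis by simp
qed

end

section \<open>Sign of the Killing form on h, and real weight vectors\<close>

context compact_pair
begin

text \<open>In a \<open>q\<close>-orthonormal basis the trace of (ad x)^2 is minus the sum of the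
  squared norms of the vectors [x, e]. If it vanished, ad x would be zero, which nondegeneracy of
  the Killing form excludes.\<close>

lemma killing_negative:
  assumes "semisimple br" "x \<in> h" "x \<noteq> 0"
  shows "killing br x x < 0"
proof -
  obtain E where E: "finite E" "\<And>x. x = (\<Sum>e\<in>E. q x e *\<^sub>R e)"
    using orthonormal_basis_exists[OF bilinear_q q_sym subspace_UNIV q_pos] by auto
  have "killing br x x = (\<Sum>e\<in>E. q (br x (br x e)) e)"
    unfolding killing_trace by (rule linear_trace_orthonormal[OF bilinear_q linear_br_br E])
  also have "\<dots> = - (\<Sum>e\<in>E. q (br x e) (br x e))"
    by (simp add: q_skew[OF assms(2)] sum_negf)
  finally have K: "killing br x x = - (\<Sum>e\<in>E. q (br x e) (br x e))" .
  have "(\<Sum>e\<in>E. q (br x e) (br x e)) \<noteq> 0"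
  proof
    assume "(\<Sum>e\<in>E. q (br x e) (br x e)) = 0"
    then have e0: "br x e = 0" if "e \<in> E" for e
      using that E(1) by (simp add: sum_nonneg_eq_0_iff q_ge_0)
    have "br x y = 0" for y
    proof -
      have "br x y = br x (\<Sum>e\<in>E. q y e *\<^sub>R e)" using E(2) by metis
      also have "\<dots> = (\<Sum>e\<in>E. q y e *\<^sub>R br x e)"
        using linear_br by (simp add: linear_sum linear_scale)
      finally show ?thesis by (simp add: e0)
    qed
    then have "\<forall>V\<in>UNIV. killing br x V = 0" by (simp add: killing_def)
    then show False using assms(1,3) unfolding semisimple_def nondegenerate_on_def by blast
  qed
  moreover have "(\<Sum>e\<in>E. q (br x e) (br x e)) \<ge> 0" by (intro sum_nonneg q_ge_0)
  ultimately show ?thesis using K by simp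
qed

text \<open>The eigenvector maximises the Rayleigh quotient over unit vectors of \<open>W\<close>.
  For its value ev, the form ev q(x, y) - q(A x, y) is positive semidefinite and vanishes at the
  maximiser w0, so w0 lies in its radical; testing against ev w0 - A w0 gives the eigenvalue
  equation.\<close>

lemma symmetric_eigenvector:
  assumes W: "subspace W" "W \<noteq> {0}" and A: "linear A" "\<And>x. x \<in> W \<Longrightarrow> A x \<in> W"
    and sym: "\<And>x y. x \<in> W \<Longrightarrow> y \<in> W \<Longrightarrow> q (A x) y = q x (A y)"
  shows "\<exists>ev w. w \<in> W \<and> w \<noteq> 0 \<and> A w = ev *\<^sub>R w"
proof -
  define C where "C = sphere 0 1 \<inter> W"
  have "compact C"
    unfolding C_def by (intro compact_Int_closed compact_sphere closed_subspace W(1))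
  obtain w1 where w1: "w1 \<in> W" "w1 \<noteq> 0" using W subspace_0 by blast
  then have "w1 /\<^sub>R norm w1 \<in> C" using W(1) by (simp add: C_def subspace_scale)
  then have "C \<noteq> {}" by blast
  have bq: "bounded_bilinear q" using bilinear_q by (simp add: bilinear_conv_bounded_bilinear)
  have bA: "bounded_linear A" using A(1) by (simp add: linear_conv_bounded_linear)
  have "continuous_on C (\<lambda>w. q (A w) w / q w w)"
    by (intro continuous_on_divide bounded_bilinear.continuous_on[OF bq] continuous_on_id
        bounded_linear.continuous_on[OF bA]) (auto simp: C_def)
  from continuous_attains_sup[OF \<open>compact C\<close> \<open>C \<noteq> {}\<close> this]
  obtain w0 where w0: "w0 \<in> C" "\<And>w. w \<in> C \<Longrightarrow> q (A w) w / q w w \<le> q (A w0) w0 / q w0 w0"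
    by blast
  define ev where "ev = q (A w0) w0 / q w0 w0"
  have "w0 \<in> W" "w0 \<noteq> 0" using w0(1) by (auto simp: C_def)
  define p where "p x y = ev * q x y - q (A x) y" for x y
  have p_ge: "p x x \<ge> 0" if x: "x \<in> W" for x
  proof (cases "x = 0")
    case True
    then show ?thesis using A(1) by (simp add: p_def q_simps linear_0)
  next
    case False
    define u where "u = x /\<^sub>R norm x"
    have "u \<in> C" using x False W(1) by (simp add: C_def u_def subspace_scale)
    then have "q (A u) u / q u u \<le> ev" using w0(2) by (simp add: ev_def)
    moreover have "q (A u) u / q u u = q (A x) x / q x x"
      using A(1) False by (simp add: u_def linear_scale q_simps)
    ultimately show ?thesis using q_pos[OF False] by (simp add: p_def field_simps)
  qed
  have p0: "p w0 w0 = 0" using \<open>w0 \<noteq> 0\<close> by (simp add: p_def ev_def)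
  have p_zero: "p w0 y = 0" if y: "y \<in> W" for y
  proof (rule ccontr)
    assume c: "p w0 y \<noteq> 0"
    define d where "d = p y y"
    \<comment> \<open>This s makes 2 s p(w0, y) + s^2 d negative. The denominator d + 1 in place of
      the optimal d covers the case d = 0.\<close>
    define s where "s = - p w0 y / (d + 1)"
    have d: "d \<ge> 0" using p_ge[OF y] by (simp add: d_def)
    have "p y w0 = p w0 y"
      using sym[OF y \<open>w0 \<in> W\<close>] by (simp add: p_def q_sym[of y])
    moreover have "p (w0 + s *\<^sub>R y) (w0 + s *\<^sub>R y) = p w0 w0 + s * p w0 y + s * p y w0 + s * s * p y y"
      using A(1) by (simp add: p_def q_simps linear_add linear_scale algebra_simps)
    ultimately have "p (w0 + s *\<^sub>R y) (w0 + s *\<^sub>R y) = 2 * s * p w0 y + s\<^sup>2 * d"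
      using p0 by (simp add: d_def power2_eq_square)
    moreover have "2 * s * p w0 y + s\<^sup>2 * d = - ((p w0 y)\<^sup>2 * (d + 2) / (d + 1)\<^sup>2)"
      using d by (simp add: s_def power2_eq_square divide_simps) (simp add: algebra_simps)
    moreover have "(p w0 y)\<^sup>2 * (d + 2) / (d + 1)\<^sup>2 > 0" using c d by simp
    ultimately show False
      using p_ge[of "w0 + s *\<^sub>R y"] y \<open>w0 \<in> W\<close> W(1) by (simp add: subspace_add subspace_scale)
  qed
  define y where "y = ev *\<^sub>R w0 - A w0"
  have "y \<in> W" unfolding y_def using A(2) \<open>w0 \<in> W\<close> W(1) by (intro subspace_diff subspace_scale)
  moreover have "p w0 z = q y z" for z by (simp add: p_def y_def q_simps)
  ultimately have "q y y = 0" using p_zero[of y] by simp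
  then have "A w0 = ev *\<^sub>R w0" by (simp add: y_def)
  then show ?thesis using \<open>w0 \<in> W\<close> \<open>w0 \<noteq> 0\<close> by blast
qed

text \<open>\<open>y + iw\<close> is a weight vector of \<open>t\<close> for the weight \<open>i a\<close>.\<close>

definition weight_pair :: "('e \<Rightarrow> real) \<Rightarrow> 'e \<Rightarrow> 'e \<Rightarrow> bool" where
  "weight_pair a y w \<longleftrightarrow> (\<forall>T\<in>t. br T y = - a T *\<^sub>R w \<and> br T w = a T *\<^sub>R y)"

text \<open>A real form of Schur's lemma. On a smallest nonzero t-stable subspace every symmetric
  operator commuting with t is a scalar, as its eigenspaces are t-stable. The square of a nonzero ad
  T0 is then a negative scalar, so a multiple J of ad T0 is a complex structure, and every ad T is a
  real multiple of J.\<close>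

lemma weight_pair_exists:
  assumes W: "subspace W" "W \<noteq> {0}" "\<And>T x. T \<in> t \<Longrightarrow> x \<in> W \<Longrightarrow> br T x \<in> W"
    and nz: "\<And>x. x \<in> W \<Longrightarrow> (\<And>T. T \<in> t \<Longrightarrow> br T x = 0) \<Longrightarrow> x = 0"
  shows "\<exists>a y w. y \<in> W \<and> w \<in> W \<and> y \<noteq> 0 \<and> weight_pair a y w \<and> (\<exists>T\<in>t. a T \<noteq> 0)"
proof -
  define \<W> where "\<W> = {W'. subspace W' \<and> W' \<subseteq> W \<and> W' \<noteq> {0} \<and> (\<forall>T\<in>t. \<forall>x\<in>W'. br T x \<in> W')}"
  have "W \<in> \<W>" using W by (simp add: \<W>_def)
  then obtain W0 where W0: "W0 \<in> \<W>" "\<And>W'. W' \<in> \<W> \<Longrightarrow> dim W0 \<le> dim W'"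
    using ex_has_least_nat[of "\<lambda>W. W \<in> \<W>" W dim] by blast
  have W0': "subspace W0" "W0 \<subseteq> W" "W0 \<noteq> {0}" "\<And>T x. T \<in> t \<Longrightarrow> x \<in> W0 \<Longrightarrow> br T x \<in> W0"
    using W0(1) by (simp_all add: \<W>_def)
  have scalar: "\<exists>ev. \<forall>x\<in>W0. A x = ev *\<^sub>R x"
    if A: "linear A" "\<And>x. x \<in> W0 \<Longrightarrow> A x \<in> W0" "\<And>x y. x \<in> W0 \<Longrightarrow> y \<in> W0 \<Longrightarrow> q (A x) y = q x (A y)"
      "\<And>T x. T \<in> t \<Longrightarrow> br T (A x) = A (br T x)" for A
  proof -
    obtain ev w where w: "w \<in> W0" "w \<noteq> 0" "A w = ev *\<^sub>R w"
      using symmetric_eigenvector[OF W0'(1,3) A(1,2,3)] by blast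
    define W1 where "W1 = {x \<in> W0. A x = ev *\<^sub>R x}"
    have "subspace W1"
      using W0'(1) A(1) by (simp add: W1_def subspace_def linear_0 linear_add linear_scale scaleR_add_right)
    moreover have "br T x \<in> W1" if "T \<in> t" "x \<in> W1" for T x
      using that W0'(4) A(4)[OF that(1), of x] by (simp add: W1_def br_simps)
    moreover have "w \<in> W1" using w by (simp add: W1_def)
    moreover have "W1 \<subseteq> W0" by (auto simp: W1_def)
    ultimately have "W1 \<in> \<W>" using W0'(2) w(2) by (auto simp: \<W>_def)
    then have "W1 = W0"
      using W0(2) \<open>subspace W1\<close> \<open>W1 \<subseteq> W0\<close> W0'(1) by (intro subspace_eq_of_dim_le)
    then show ?thesis by (auto simp: W1_def)
  qed
  have comm: "br T (br T' x) = br T' (br T x)" if "T \<in> t" "T' \<in> t" for T T' x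
    using jacobi[of T T' x] t(3)[OF that] by simp
  obtain x0 where x0: "x0 \<in> W0" "x0 \<noteq> 0" using W0'(1,3) subspace_0 by blast
  then obtain T0 where T0: "T0 \<in> t" "br T0 x0 \<noteq> 0" using nz W0'(2) by blast
  have skew: "q (br T x) y = - q x (br T y)" if "T \<in> t" for T x y
    using q_skew that t(2) by blast
  have "\<exists>ev. \<forall>x\<in>W0. br T0 (br T0 x) = ev *\<^sub>R x"
  proof (rule scalar[OF linear_br_br])
    show "br T0 (br T0 x) \<in> W0" if "x \<in> W0" for x
      using W0'(4)[OF T0(1) W0'(4)[OF T0(1) that]] .
    show "q (br T0 (br T0 x)) y = q x (br T0 (br T0 y))" for x y
      by (simp add: skew[OF T0(1)] q_simps)
    show "br T (br T0 (br T0 x)) = br T0 (br T0 (br T x))" if "T \<in> t" for T x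
      by (simp add: comm[OF that T0(1)])
  qed
  then obtain ev where ev: "\<And>x. x \<in> W0 \<Longrightarrow> br T0 (br T0 x) = ev *\<^sub>R x" by blast
  have "ev * q x0 x0 = - q (br T0 x0) (br T0 x0)"
    using skew[OF T0(1), of "br T0 x0" x0] ev[OF x0(1)] by (simp add: q_simps)
  moreover have "q (br T0 x0) (br T0 x0) > 0" using q_pos[OF T0(2)] .
  ultimately have "ev < 0" using q_pos[OF x0(2)] by (smt (verit) mult_nonneg_nonneg)
  define \<mu> where "\<mu> = sqrt (- ev)"
  have \<mu>: "\<mu> > 0" "\<mu> * \<mu> = - ev" using \<open>ev < 0\<close> by (simp_all add: \<mu>_def)
  \<comment> \<open>Rescaled so that J squares to -1 on \<open>W0\<close>.\<close>
  define J where "J x = (1 / \<mu>) *\<^sub>R br T0 x" for x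
  have JJ: "J (J x) = - x" if "x \<in> W0" for x
  proof -
    have "J (J x) = (ev / (\<mu> * \<mu>)) *\<^sub>R x" using ev[OF that] by (simp add: J_def br_simps)
    then show ?thesis using \<mu> \<open>ev < 0\<close> by simp
  qed
  have J_W0: "J x \<in> W0" if "x \<in> W0" for x
    unfolding J_def using W0'(1) W0'(4)[OF T0(1) that] by (rule subspace_scale)
  \<comment> \<open>The product of two commuting skew operators is symmetric, so the scalar property
    applies to ad T composed with J and yields the weight a T.\<close>
  have ex: "\<exists>r. \<forall>x\<in>W0. br T (J x) = r *\<^sub>R x" if T: "T \<in> t" for T
  proof (rule scalar)
    show "linear (\<lambda>x. br T (J x))"
      by (simp add: J_def linear_iff br_simps scaleR_add_right)
    show "br T (J x) \<in> W0" if "x \<in> W0" for x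
      using W0'(4)[OF T J_W0[OF that]] .
    show "q (br T (J x)) y = q x (br T (J y))" for x y
      using comm[OF T T0(1), of y] by (simp add: J_def br_simps q_simps skew[OF T] skew[OF T0(1)])
    show "br T' (br T (J x)) = br T (J (br T' x))" if "T' \<in> t" for T' x
      using comm[OF that T] comm[OF that T0(1)] by (simp add: J_def br_simps)
  qed
  obtain a where a': "\<And>T. T \<in> t \<Longrightarrow> \<forall>x\<in>W0. br T (J x) = a T *\<^sub>R x"
    using ex by metis
  have a: "br T (J x) = a T *\<^sub>R x" if "T \<in> t" "x \<in> W0" for T x
    using a'[OF that(1)] that(2) by (rule bspec)
  have "br T x0 = - a T *\<^sub>R J x0" if "T \<in> t" for T
  proof -
    have "- br T x0 = a T *\<^sub>R J x0"
      using a[OF that J_W0[OF x0(1)]] JJ[OF x0(1)] by (simp add: br_simps)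
    from arg_cong[OF this, of uminus] show ?thesis by simp
  qed
  then have "weight_pair a x0 (J x0)"
    using a x0(1) by (simp add: weight_pair_def)
  moreover have "a T0 \<noteq> 0"
  proof
    assume "a T0 = 0"
    then have "br T0 (J x0) = 0" using a[OF T0(1) x0(1)] by simp
    then have "J (J x0) = 0" by (simp add: J_def[of "J x0"])
    then show False using JJ[OF x0(1)] x0(2) by simp
  qed
  ultimately show ?thesis
    using x0 J_W0[OF x0(1)] subsetD[OF W0'(2)] T0(1) by meson
qed

end

section \<open>Equal rank: weights of h and m, orthogonality, and the curvature form\<close>

locale equal_rank_pair = compact_pair +
  fixes m :: "'a set"
  assumes m: "subspace m" "h \<inter> m = {0}" "{U + V |U V. U \<in> h \<and> V \<in> m} = UNIV"
    and m_S: "g \<in> S \<Longrightarrow> x \<in> m \<Longrightarrow> g x \<in> m"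
    and ss: "semisimple br"
    and rank: "lie_rank br UNIV = lie_rank br h"
begin

lemma br_h_m:
  assumes "U \<in> h" "x \<in> m"
  shows "br U x \<in> m"
proof -
  obtain \<phi> where \<phi>: "\<And>s::real. \<phi> s \<in> S" "((\<lambda>s. \<phi> s x) has_vector_derivative br U x) (at 0)"
    using tangent_S[OF assms(1)] by blast
  show ?thesis by (rule has_vector_derivative_in_subspace[OF \<phi>(2) m(1) m_S[OF \<phi>(1) assms(2)]])
qed

lemma no_zero_weight:
  assumes "x \<in> m" "\<And>T. T \<in> t \<Longrightarrow> br T x = 0"
  shows "x = 0"
  using centralizer_t[OF rank assms(2)] assms(1) t(2) m(2) by blast

text \<open>Put Z = x1 + i x2 and u = y + i w, both of weight i a. The vanishing of [conj Z, u]
  turns [T, y], with T = [x1, x2], into the sum of (ad x1)^2 w and (ad x2)^2 w, whose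
  \<open>q\<close>-pairing with w is nonpositive. But [T, y] = - a(T) w with a(T) < 0, so w = 0, and
  then y = 0.\<close>

lemma weights_disjoint:
  assumes x: "weight_pair a x1 x2" "x1 \<in> h" "x2 \<in> h" "x1 \<noteq> 0 \<or> x2 \<noteq> 0"
    and y: "weight_pair a y w" "y \<in> m" "w \<in> m"
    and T1: "T1 \<in> t" "a T1 \<noteq> 0"
  shows "y = 0"
proof -
  have x': "br T x1 = - a T *\<^sub>R x2" "br T x2 = a T *\<^sub>R x1" if "T \<in> t" for T
    using x(1) that by (auto simp: weight_pair_def)
  have y': "br T y = - a T *\<^sub>R w" "br T w = a T *\<^sub>R y" if "T \<in> t" for T
    using y(1) that by (auto simp: weight_pair_def)
  have "x2 \<noteq> 0"
  proof
    assume "x2 = 0"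
    then have "a T1 *\<^sub>R x1 = 0" using x'(2)[OF T1(1)] by simp
    then show False using x(4) T1(2) \<open>x2 = 0\<close> by simp
  qed
  then have Kx2: "killing br x2 x2 < 0" using killing_negative[OF ss x(3)] by blast
  \<comment> \<open>Up to the factor i / 2 this is [Z, conj Z]: a vector of weight zero in
    \<open>h\<close>, hence in \<open>t\<close>.\<close>
  define T where "T = br x1 x2"
  have "T \<in> t"
  proof (rule maximal_abelian_contains_centralizer[OF t_max h(1)])
    show "T \<in> h" unfolding T_def using x(2,3) by (rule h(2))
    show "br R T = 0" if "R \<in> t" for R
      unfolding T_def using x'[OF that] by (simp add: jacobi[of R] br_simps)
  qed
  \<comment> \<open>\<open>T\<close> represents the weight a through the Killing form up to the
    positive factor - killing x2 x2. Negativity of killing T T therefore makes a T negative.\<close>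
  have K: "killing br T R = - a R * killing br x2 x2" if "R \<in> t" for R
    using killing_invariant[of x1 x2 R] x'(1)[OF that] br_swap[of x1 R] by (simp add: T_def killing_simps)
  have "T \<noteq> 0"
    using K[OF T1(1)] T1(2) Kx2 by (auto simp: killing_simps)
  then have "killing br T T < 0" using killing_negative[OF ss] \<open>T \<in> t\<close> t(2) by blast
  then have aT: "a T < 0" using K[OF \<open>T \<in> t\<close>] Kx2 by (simp add: mult_less_0_iff zero_less_mult_iff)
  \<comment> \<open>\<open>e1\<close> and \<open>e2\<close> are the real and imaginary parts of
    [conj Z, u] = 0, a vector of weight zero in \<open>m\<close>.\<close>
  have e1: "br x1 y + br x2 w = 0"
  proof (rule no_zero_weight)
    show "br x1 y + br x2 w \<in> m" using x y br_h_m m(1) by (intro subspace_add) auto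
    show "br R (br x1 y + br x2 w) = 0" if "R \<in> t" for R
      using x'[OF that] y'[OF that] by (simp add: br_simps jacobi[of R])
  qed
  have e2: "br x1 w - br x2 y = 0"
  proof (rule no_zero_weight)
    show "br x1 w - br x2 y \<in> m" using x y br_h_m m(1) by (intro subspace_diff) auto
    show "br R (br x1 w - br x2 y) = 0" if "R \<in> t" for R
      using x'[OF that] y'[OF that] by (simp add: br_simps jacobi[of R])
  qed
  \<comment> \<open>By \<open>e1\<close> and \<open>e2\<close> the mixed terms become squares:
    [x2, y] = [x1, w] and [x1, y] = - [x2, w].\<close>
  have "br T y = br x1 (br x2 y) - br x2 (br x1 y)"
    by (simp add: T_def jacobi[of x1 x2 y])
  also have "\<dots> = br x1 (br x1 w) + br x2 (br x2 w)"
    using e1 e2 by (simp add: eq_neg_iff_add_eq_0[symmetric] br_simps)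
  finally have "q (br T y) w = - q (br x1 w) (br x1 w) - q (br x2 w) (br x2 w)"
    by (simp add: q_simps q_skew[OF x(2), of "br x1 w"] q_skew[OF x(3), of "br x2 w"])
  then have "- a T * q w w \<le> 0"
    using y'(1)[OF \<open>T \<in> t\<close>] q_ge_0[of "br x1 w"] q_ge_0[of "br x2 w"] by (simp add: q_simps)
  then have "q w w \<le> 0" using aT by (simp add: zero_le_mult_iff)
  then have "w = 0" using q_pos[of w] by force
  then show "y = 0" using y'(2)[OF T1(1)] T1(2) by simp
qed

text \<open>If the pairing were nonzero, the Killing-orthogonal projection to \<open>h\<close> would
  be t-equivariant and nonzero on m. A weight vector of m outside its kernel would then be carried
  to one of \<open>h\<close> with the same weight, contradicting
  \<open>weights_disjoint\<close>.\<close>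

lemma killing_h_m:
  assumes "x \<in> h" "u \<in> m"
  shows "killing br x u = 0"
proof (rule ccontr)
  assume nz: "killing br x u \<noteq> 0"
  define N where "N = {u \<in> m. \<forall>x\<in>h. killing br x u = 0}"
  \<comment> \<open>The complement of the null space \<open>N\<close> is taken for the definite form
    \<open>q\<close>; skew-symmetry of ad T makes it stable under \<open>t\<close>.\<close>
  define W where "W = {u \<in> m. \<forall>n\<in>N. q u n = 0}"
  have sN: "subspace N" using m(1) by (simp add: N_def subspace_def killing_simps)
  have sW: "subspace W" using m(1) by (simp add: W_def subspace_def q_simps)
  have tN: "br T n \<in> N" if "T \<in> t" "n \<in> N" for T n
  proof -
    have "T \<in> h" using that t(2) by blast
    have "killing br x (br T n) = 0" if "x \<in> h" for x
      using killing_invariant[of T x n] h(2)[OF \<open>T \<in> h\<close> that] \<open>n \<in> N\<close> by (simp add: N_def)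
    then show ?thesis using br_h_m[OF \<open>T \<in> h\<close>] that by (simp add: N_def)
  qed
  have tW: "br T u \<in> W" if "T \<in> t" "u \<in> W" for T u
    using that tN[OF that(1)] br_h_m[of T u] q_skew[of T u] t(2) by (auto simp: W_def)
  have "W \<noteq> {0}"
  proof -
    obtain E where E: "finite E" "E \<subseteq> N" "\<forall>e\<in>E. \<forall>f\<in>E. q e f = (if e = f then 1 else 0)"
      "\<forall>x\<in>N. x = (\<Sum>e\<in>E. q x e *\<^sub>R e)"
      using orthonormal_basis_exists[OF bilinear_q q_sym sN q_pos] by blast
    define n where "n = (\<Sum>e\<in>E. q u e *\<^sub>R e)"
    have "n \<in> N" unfolding n_def using sN E(2) by (intro subspace_sum subspace_scale) auto
    have lin: "linear (\<lambda>x. q x f)" "linear (q f)" for f using bilinear_q by (simp_all add: bilinear_def)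
    have perp: "q (u - n) e = 0" if "e \<in> E" for e
    proof -
      have "q n e = (\<Sum>f\<in>E. q u f * q f e)"
        unfolding n_def by (simp add: linear_sum[OF lin(1)] linear_scale[OF lin(1)])
      also have "\<dots> = (\<Sum>f\<in>E. if f = e then q u e else 0)"
        using E(3) that by (intro sum.cong) auto
      also have "\<dots> = q u e" using E(1) that by simp
      finally show ?thesis by (simp add: q_simps)
    qed
    have "q (u - n) k = 0" if "k \<in> N" for k
    proof -
      have "q (u - n) (\<Sum>e\<in>E. q k e *\<^sub>R e) = 0"
        by (simp add: linear_sum[OF lin(2)] linear_scale[OF lin(2)] perp)
      then show ?thesis using E(4) that by metis
    qed
    then have "u - n \<in> W" using assms(2) \<open>n \<in> N\<close> m(1) by (simp add: W_def N_def subspace_diff)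
    moreover have "u - n \<noteq> 0"
      using nz assms(1) \<open>n \<in> N\<close> by (auto simp: N_def)
    ultimately show ?thesis by blast
  qed
  then obtain a y w where yw: "y \<in> W" "w \<in> W" "y \<noteq> 0" "weight_pair a y w" "\<exists>T\<in>t. a T \<noteq> 0"
    using weight_pair_exists[OF sW _ tW] no_zero_weight unfolding W_def by blast
  have bp: "bilinear (\<lambda>x y. - killing br x y)"
    using bilinear_killing by (simp add: bilinear_def linear_iff killing_simps)
  have "\<exists>E. finite E \<and> E \<subseteq> h \<and> (\<forall>e\<in>E. \<forall>f\<in>E. - killing br e f = (if e = f then 1 else 0)) \<and>
    (\<forall>x\<in>h. x = (\<Sum>e\<in>E. (- killing br x e) *\<^sub>R e))"
    by (rule orthonormal_basis_exists[OF bp]) (use h(1) killing_negative[OF ss] killing_sym in auto)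
  then obtain E where E: "E \<subseteq> h" "\<And>x. x \<in> h \<Longrightarrow> x = (\<Sum>e\<in>E. (- killing br x e) *\<^sub>R e)"
    by blast
  \<comment> \<open>Killing-orthogonal projection to \<open>h\<close>. The basis is orthonormal for
    minus the Killing form, whence the signs. Within \<open>m\<close> the kernel is
    \<open>N\<close>, so nonzero vectors of \<open>W\<close> survive.\<close>
  define \<phi> where "\<phi> u = (\<Sum>e\<in>E. (- killing br u e) *\<^sub>R e)" for u
  have \<phi>h: "\<phi> u \<in> h" for u unfolding \<phi>_def using h(1) E(1) by (intro subspace_sum subspace_scale) auto
  have linK: "linear (killing br z)" "linear (\<lambda>x. killing br x z)" for z
    using bilinear_killing by (simp_all add: bilinear_def)
  have \<phi>K: "killing br (\<phi> u) x = killing br u x" if "x \<in> h" for u x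
  proof -
    have "killing br (\<phi> u) x = (\<Sum>e\<in>E. - killing br u e * killing br e x)"
      unfolding \<phi>_def by (simp only: linear_sum[OF linK(2)] linear_scale[OF linK(2)] real_scaleR_def)
    also have "\<dots> = (\<Sum>e\<in>E. - killing br x e * killing br u e)"
      by (intro sum.cong refl) (simp add: killing_sym[of _ x])
    also have "\<dots> = killing br u (\<Sum>e\<in>E. (- killing br x e) *\<^sub>R e)"
      by (simp only: linear_sum[OF linK(1)] linear_scale[OF linK(1)] real_scaleR_def)
    finally show ?thesis using E(2)[OF that] by simp
  qed
  have \<phi>_scale: "\<phi> (c *\<^sub>R u) = c *\<^sub>R \<phi> u" for c u
    by (simp add: \<phi>_def killing_simps scaleR_right.sum)
  have \<phi>_br: "\<phi> (br T u) = br T (\<phi> u)" if "T \<in> t" for T u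
  proof -
    have T: "T \<in> h" using that t(2) by blast
    \<comment> \<open>By invariance of the Killing form d is orthogonal to itself; since it lies in
      \<open>h\<close>, definiteness there gives d = 0.\<close>
    define d where "d = \<phi> (br T u) - br T (\<phi> u)"
    have "d \<in> h" unfolding d_def using h T \<phi>h by (intro subspace_diff) auto
    have "killing br d d = killing br (br T u) d + killing br (\<phi> u) (br T d)"
      using \<phi>K[OF \<open>d \<in> h\<close>, of "br T u"] killing_invariant[of T "\<phi> u" d]
      by (simp add: d_def[THEN arg_cong[where f = "\<lambda>z. killing br z d"]] killing_simps)
    also have "\<dots> = 0"
      using \<phi>K[OF h(2)[OF T \<open>d \<in> h\<close>], of u] killing_invariant[of T u d] by simp
    finally have "d = 0" using killing_negative[OF ss \<open>d \<in> h\<close>] by force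
    then show ?thesis by (simp add: d_def)
  qed
  have "weight_pair a (\<phi> y) (\<phi> w)"
    using yw(4) unfolding weight_pair_def by (metis \<phi>_br \<phi>_scale)
  moreover have "\<phi> y \<noteq> 0"
  proof
    assume "\<phi> y = 0"
    then have "killing br x y = 0" if "x \<in> h" for x
      using \<phi>K[OF that, of y] by (simp add: killing_simps killing_sym[of x])
    then have "y \<in> N" using yw(1) by (simp add: N_def W_def)
    then have "q y y = 0" using yw(1) by (simp add: W_def)
    then show False using yw(3) by simp
  qed
  ultimately show False
    using weights_disjoint[of a "\<phi> y" "\<phi> w" y w] \<phi>h yw by (auto simp: W_def)
qed

lemma proj_along_h_m:
  "proj_along h m Z \<in> h" "Z - proj_along h m Z \<in> m"
proof -
  obtain U V where UV: "Z = U + V" "U \<in> h" "V \<in> m" using m(3) by blast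
  have "\<exists>!V. V \<in> h \<and> Z - V \<in> m"
  proof (rule ex1I[of _ U])
    show "U \<in> h \<and> Z - U \<in> m" using UV by simp
    fix V' assume V': "V' \<in> h \<and> Z - V' \<in> m"
    have "(Z - V') - (Z - U) \<in> m"
      using m(1)
    proof (rule subspace_diff)
      show "Z - V' \<in> m" "Z - U \<in> m" using V' UV by simp_all
    qed
    then have "U - V' \<in> h \<inter> m" using UV V' h(1) by (simp add: subspace_diff)
    then show "V' = U" using m(2) by simp
  qed
  from theI'[OF this] show "proj_along h m Z \<in> h" "Z - proj_along h m Z \<in> m"
    by (simp_all add: proj_along_def)
qed

lemma nondegenerate_curvature:
  assumes X: "X \<in> h"
    and reg: "\<And>g \<alpha>. g \<in> S \<Longrightarrow> \<alpha> \<in> roots br t UNIV - roots br t h \<Longrightarrow> g X \<notin> root_hyperplane t \<alpha>"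
    and U: "U \<in> m" and deg: "\<And>V. V \<in> m \<Longrightarrow> killing br X (proj_along h m (br U V)) = 0"
  shows "U = 0"
proof -
  \<comment> \<open>As \<open>X\<close> lies in \<open>h\<close>, orthogonality to \<open>m\<close>
    allows the projection of [U, V] to be replaced by [U, V] itself.\<close>
  have K0: "killing br (br U X) V = 0" if V: "V \<in> m" for V
  proof -
    have "killing br X (br U V) = killing br X (proj_along h m (br U V)) + killing br X (br U V - proj_along h m (br U V))"
      by (simp add: killing_simps)
    also have "\<dots> = 0" using deg[OF V] killing_h_m[OF X proj_along_h_m(2)] by simp
    finally show ?thesis using killing_invariant[of U X V] by simp
  qed
  have "br U X \<in> m" using br_h_m[OF X U] br_swap[of U X] m(1) by (simp add: subspace_neg)
  \<comment> \<open>[U, X] lies in \<open>m\<close>: it is orthogonal to \<open>m\<close> by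
    \<open>K0\<close> and to \<open>h\<close> by \<open>killing_h_m\<close>, hence to
    everything.\<close>
  have "killing br (br U X) Z = 0" for Z
  proof -
    obtain U' V' where "Z = U' + V'" "U' \<in> h" "V' \<in> m" using m(3) by blast
    then show ?thesis
      using K0 killing_h_m[OF _ \<open>br U X \<in> m\<close>] killing_sym by (simp add: killing_simps)
  qed
  then have "br U X = 0"
    using ss unfolding semisimple_def nondegenerate_on_def by blast
  obtain g where g: "g \<in> S" "g X \<in> t" using conjugate_into_t[OF X] by blast
  \<comment> \<open>The kernel of ad (g X) on \<open>m\<close>. It is stable under \<open>t\<close>
    because g X lies in the abelian algebra \<open>t\<close>, so a nonzero kernel contains weight
    vectors.\<close>
  define W where "W = {u \<in> m. br (g X) u = 0}"
  have sW: "subspace W" using m(1) by (simp add: W_def subspace_def br_simps)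
  have "g U \<in> W"
    using m_S[OF g(1) U] aut_S[OF g(1), of X U] \<open>br U X = 0\<close> br_swap[of X U]
    by (simp add: W_def blinfun.zero_right)
  have tW: "br T u \<in> W" if "T \<in> t" "u \<in> W" for T u
    using that br_h_m[of T u] t(2) jacobi[of "g X" T u] t(3)[OF g(2) that(1)] by (auto simp: W_def)
  have "g U = 0"
  proof (rule ccontr)
    assume "g U \<noteq> 0"
    then have "W \<noteq> {0}" using \<open>g U \<in> W\<close> by blast
    then obtain a y w T0 where yw: "y \<in> W" "w \<in> W" "y \<noteq> 0" "weight_pair a y w" "T0 \<in> t" "a T0 \<noteq> 0"
      using weight_pair_exists[OF sW _ tW] no_zero_weight unfolding W_def by blast
    have y': "br T y = - a T *\<^sub>R w" "br T w = a T *\<^sub>R y" if "T \<in> t" for T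
      using yw(4) that by (auto simp: weight_pair_def)
    have t0: "0 \<in> t" using t(1) by (rule subspace_0)
    \<comment> \<open>Nothing is assumed about linearity of the weight function; the value at 0 is
      read off from the weight equation.\<close>
    have a0: "a 0 = 0" using y'(2)[OF t0] yw(3) by simp
    have agX: "a (g X) = 0" using y'(2)[OF g(2)] yw(2,3) by (simp add: W_def)
    \<comment> \<open>The complex-linear extension of i a: at T1 + i T2 its value is i a(T1) -
      a(T2). The restriction puts it in the extensional form that \<open>roots\<close> asks
      for.\<close>
    define \<alpha> where "\<alpha> = restrict (\<lambda>T. Complex (- a (snd T)) (a (fst T))) (t \<times> t)"
    have \<alpha>: "\<alpha> T = Complex (- a (snd T)) (a (fst T))" if "T \<in> t \<times> t" for T
      using that by (simp add: \<alpha>_def)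
    have "\<alpha> (T0, 0) \<noteq> 0" using yw(5,6) t0 by (simp add: \<alpha> complex_eq_iff)
    moreover have "bracket_pair br T (y, w) = scaleC_pair (\<alpha> T) (y, w)" if T: "T \<in> t \<times> t" for T
    proof -
      have "fst T \<in> t" "snd T \<in> t" using T by auto
      then show ?thesis by (simp add: bracket_pair_def scaleC_pair_def \<alpha>[OF T] y')
    qed
    moreover have "\<alpha> \<in> extensional (t \<times> t)" by (simp add: \<alpha>_def)
    moreover have "(y, w) \<noteq> 0" using yw(3) by (simp add: zero_prod_def)
    ultimately have "\<alpha> \<in> roots br t UNIV"
      using yw(5) t0 unfolding roots_def by blast
    moreover have "\<alpha> \<notin> roots br t h"
    proof
      assume "\<alpha> \<in> roots br t h"
      then obtain Z where Z: "Z \<in> h \<times> h" "Z \<noteq> 0"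
        "\<And>T. T \<in> t \<times> t \<Longrightarrow> bracket_pair br T Z = scaleC_pair (\<alpha> T) Z"
        unfolding roots_def by blast
      \<comment> \<open>On the real elements (T, 0) the eigenvector equation is exactly the weight
        equation for the real and imaginary parts of Z, so \<open>weights_disjoint\<close>
        applies.\<close>
      have "weight_pair a (fst Z) (snd Z)"
        unfolding weight_pair_def
      proof
        fix T assume T: "T \<in> t"
        then show "br T (fst Z) = - a T *\<^sub>R snd Z \<and> br T (snd Z) = a T *\<^sub>R fst Z"
          using Z(3)[of "(T, 0)"] t0 by (simp add: bracket_pair_def scaleC_pair_def \<alpha> a0)
      qed
      moreover have "fst Z \<in> h" "snd Z \<in> h" using Z(1) by auto
      moreover have "fst Z \<noteq> 0 \<or> snd Z \<noteq> 0" using Z(2) by (simp add: prod_eq_iff)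
      ultimately have "y = 0"
        using weights_disjoint yw unfolding W_def by blast
      then show False using yw(3) by blast
    qed
    moreover have "g X \<in> root_hyperplane t \<alpha>"
      using g(2) t0 by (simp add: root_hyperplane_def \<alpha> agX a0 complex_eq_iff)
    ultimately show False using reg[OF g(1), of \<alpha>] by blast
  qed
  obtain g' where "g' o\<^sub>L g = id_blinfun" using inv_S[OF g(1)] by blast
  from arg_cong[OF this, of "\<lambda>f. blinfun_apply f U"] show "U = 0"
    using \<open>g U = 0\<close> by (simp add: blinfun.zero_right)
qed

end

section \<open>Calculus of smooth maps\<close>

lemma frechet_derivative_eqI: "(f has_derivative f') (at x) \<Longrightarrow> frechet_derivative f (at x) = f'"
  by (metis frechet_derivative_at)

lemma frechet_derivative_cong_open:
  assumes "open S" "x \<in> S" "\<And>y. y \<in> S \<Longrightarrow> f y = g y" "f differentiable (at x)"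
  shows "g differentiable (at x)" "frechet_derivative g (at x) = frechet_derivative f (at x)"
proof -
  have "(f has_derivative frechet_derivative f (at x)) (at x)"
    using assms(4) frechet_derivative_works by blast
  then have "(g has_derivative frechet_derivative f (at x)) (at x)"
    by (rule has_derivative_transform_within_open[OF _ assms(1,2,3)])
  then show "g differentiable (at x)" "frechet_derivative g (at x) = frechet_derivative f (at x)"
    by (auto simp: differentiable_def frechet_derivative_eqI)
qed

text \<open>Openness of \<open>S\<close> lets equality on \<open>S\<close> pass to the derivatives,
  hence to all iterates.\<close>

lemma Ck_on_cong:
  "open S \<Longrightarrow> (\<And>x. x \<in> S \<Longrightarrow> f x = g x) \<Longrightarrow> Ck_on k f S \<Longrightarrow> Ck_on k g S"
proof (induction k arbitrary: f g)
  case 0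
  then show ?case by (simp cong: continuous_on_cong)
next
  case (Suc k)
  have fg: "g differentiable (at x)" "frechet_derivative f (at x) = frechet_derivative g (at x)" if "x \<in> S" for x
    using frechet_derivative_cong_open[OF Suc.prems(1) that Suc.prems(2)] Suc.prems(3) that by simp_all
  have "Ck_on k (\<lambda>x. frechet_derivative g (at x) w) S" for w
    by (rule Suc.IH[OF Suc.prems(1), of "\<lambda>x. frechet_derivative f (at x) w"]) (use Suc.prems(3) fg in auto)
  then show ?case using fg by simp
qed

lemma Ck_on_subset: "Ck_on k f S \<Longrightarrow> T \<subseteq> S \<Longrightarrow> Ck_on k f T"
  by (induction k arbitrary: f) (auto intro: continuous_on_subset)

lemma Ck_on_local:
  "(\<And>x. x \<in> S \<Longrightarrow> \<exists>T. open T \<and> x \<in> T \<and> Ck_on k f T) \<Longrightarrow> Ck_on k f S"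
proof (induction k arbitrary: f)
  case 0
  have "isCont f x" if "x \<in> S" for x
    using 0[OF that] continuous_on_eq_continuous_at by auto
  then show ?case by (simp add: continuous_at_imp_continuous_on)
next
  case (Suc k)
  have "f differentiable (at x)" if "x \<in> S" for x
    using Suc.prems[OF that] by auto
  moreover have "Ck_on k (\<lambda>x. frechet_derivative f (at x) w) S" for w
    by (rule Suc.IH) (use Suc.prems in fastforce)
  ultimately show ?case by simp
qed

lemma Ck_on_SucD: "Ck_on (Suc k) f S \<Longrightarrow> Ck_on k f S"
proof (induction k arbitrary: f)
  case 0
  then show ?case
    by (auto intro!: continuous_at_imp_continuous_on differentiable_imp_continuous_within)
next
  case (Suc k)
  have "Ck_on k (\<lambda>x. frechet_derivative f (at x) w) S" for w
    using Suc.prems by (intro Suc.IH) simp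
  then show ?case using Suc.prems by simp
qed

lemma Ck_on_const: "Ck_on k (\<lambda>x. c) S"
  by (induction k arbitrary: c) simp_all

lemma Ck_on_linear: "bounded_linear f \<Longrightarrow> Ck_on k f S"
  by (cases k) (auto intro: linear_continuous_on bounded_linear_imp_differentiable Ck_on_const
      simp: frechet_derivative_eqI[OF bounded_linear_imp_has_derivative])

lemma Ck_on_compose_linear:
  "bounded_linear L \<Longrightarrow> open S \<Longrightarrow> Ck_on k f S \<Longrightarrow> Ck_on k (\<lambda>x. L (f x)) S"
proof (induction k arbitrary: f)
  case 0
  then show ?case by (simp add: bounded_linear.continuous_on)
next
  case (Suc k)
  have d: "((\<lambda>x. L (f x)) has_derivative (\<lambda>w. L (frechet_derivative f (at x) w))) (at x)" if "x \<in> S" for x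
    using bounded_linear.has_derivative[OF Suc.prems(1)] Suc.prems(3) that
    by (auto simp: frechet_derivative_works)
  have "Ck_on k (\<lambda>x. frechet_derivative (\<lambda>x. L (f x)) (at x) w) S" for w
    by (rule Ck_on_cong[OF Suc.prems(2), of "\<lambda>x. L (frechet_derivative f (at x) w)"])
      (use Suc frechet_derivative_eqI[OF d] in auto)
  then show ?case using d by (auto simp: differentiable_def)
qed

lemma Ck_on_add:
  "open S \<Longrightarrow> Ck_on k f S \<Longrightarrow> Ck_on k g S \<Longrightarrow> Ck_on k (\<lambda>x. f x + g x) S"
proof (induction k arbitrary: f g)
  case 0
  then show ?case by (simp add: continuous_on_add)
next
  case (Suc k)
  have d: "((\<lambda>x. f x + g x) has_derivative
      (\<lambda>w. frechet_derivative f (at x) w + frechet_derivative g (at x) w)) (at x)" if "x \<in> S" for x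
    using Suc.prems that by (intro has_derivative_add) (auto simp: frechet_derivative_works)
  have "Ck_on k (\<lambda>x. frechet_derivative (\<lambda>x. f x + g x) (at x) w) S" for w
    by (rule Ck_on_cong[OF Suc.prems(1), of "\<lambda>x. frechet_derivative f (at x) w + frechet_derivative g (at x) w"])
      (use Suc frechet_derivative_eqI[OF d] in auto)
  then show ?case using d by (auto simp: differentiable_def)
qed

lemma Ck_on_sum:
  "open S \<Longrightarrow> (\<And>i. i \<in> I \<Longrightarrow> Ck_on k (f i) S) \<Longrightarrow> Ck_on k (\<lambda>x. \<Sum>i\<in>I. f i x) S"
  by (induction I rule: infinite_finite_induct) (simp_all add: Ck_on_const Ck_on_add)

lemma Ck_on_scaleR:
  "open S \<Longrightarrow> Ck_on k f S \<Longrightarrow> Ck_on k g S \<Longrightarrow> Ck_on k (\<lambda>x. f x *\<^sub>R g x) S"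
proof (induction k arbitrary: f g)
  case 0
  then show ?case by (simp add: continuous_on_scaleR)
next
  case (Suc k)
  have d: "((\<lambda>x. f x *\<^sub>R g x) has_derivative
      (\<lambda>w. f x *\<^sub>R frechet_derivative g (at x) w + frechet_derivative f (at x) w *\<^sub>R g x)) (at x)" if "x \<in> S" for x
    using Suc.prems that by (intro has_derivative_scaleR) (auto simp: frechet_derivative_works)
  have "Ck_on k (\<lambda>x. frechet_derivative (\<lambda>x. f x *\<^sub>R g x) (at x) w) S" for w
  proof (rule Ck_on_cong[OF Suc.prems(1)])
    show "Ck_on k (\<lambda>x. f x *\<^sub>R frechet_derivative g (at x) w + frechet_derivative f (at x) w *\<^sub>R g x) S"
      using Suc.prems Ck_on_SucD[OF Suc.prems(2)] Ck_on_SucD[OF Suc.prems(3)]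
      by (simp add: Ck_on_add Suc.IH)
  qed (simp add: frechet_derivative_eqI[OF d])
  then show ?case using d by (auto simp: differentiable_def)
qed

lemma Ck_on_compose:
  fixes f :: "'a::euclidean_space \<Rightarrow> 'b::euclidean_space"
  shows "open S \<Longrightarrow> open T \<Longrightarrow> f ` S \<subseteq> T \<Longrightarrow> Ck_on k f S \<Longrightarrow> Ck_on k g T \<Longrightarrow> Ck_on k (\<lambda>x. g (f x)) S"
proof (induction k arbitrary: g)
  case 0
  then show ?case using continuous_on_compose2[of T g S f] by simp
next
  case (Suc k)
  have d: "((\<lambda>x. g (f x)) has_derivative
      (\<lambda>w. frechet_derivative g (at (f x)) (frechet_derivative f (at x) w))) (at x)" if "x \<in> S" for x
  proof -
    have "(f has_derivative frechet_derivative f (at x)) (at x)"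
      using Suc.prems(4) that by (simp add: frechet_derivative_works)
    moreover have "(g has_derivative frechet_derivative g (at (f x))) (at (f x))"
      using Suc.prems(3,5) that by (simp add: frechet_derivative_works image_subset_iff)
    ultimately show ?thesis by (rule has_derivative_compose)
  qed
  have "Ck_on k (\<lambda>x. frechet_derivative (\<lambda>x. g (f x)) (at x) w) S" for w
  proof (rule Ck_on_cong[OF Suc.prems(1)])
    \<comment> \<open>\<open>Ck_on\<close> speaks of derivatives in constant directions, whereas the
      chain rule produces a direction depending on x. Expanding it in the basis gives scalar
      coefficients times derivatives of g in fixed directions, to which the induction hypothesis
      applies.\<close>
    show "Ck_on k (\<lambda>x. \<Sum>b\<in>Basis. (frechet_derivative f (at x) w \<bullet> b) *\<^sub>R frechet_derivative g (at (f x)) b) S"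
    proof (intro Ck_on_sum Ck_on_scaleR Suc.prems(1))
      fix b :: 'b
      show "Ck_on k (\<lambda>x. frechet_derivative f (at x) w \<bullet> b) S"
        by (rule Ck_on_compose_linear[OF bounded_linear_inner_left Suc.prems(1)]) (use Suc.prems(4) in simp)
      show "Ck_on k (\<lambda>x. frechet_derivative g (at (f x)) b) S"
        by (rule Suc.IH[OF Suc.prems(1-3) Ck_on_SucD[OF Suc.prems(4)]]) (use Suc.prems(5) in simp)
    qed
    fix x assume x: "x \<in> S"
    have lin: "linear (frechet_derivative g (at (f x)))"
      using Suc.prems(3,5) x by (simp add: linear_frechet_derivative image_subset_iff)
    have "frechet_derivative g (at (f x)) (\<Sum>b\<in>Basis. (frechet_derivative f (at x) w \<bullet> b) *\<^sub>R b) =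
        (\<Sum>b\<in>Basis. (frechet_derivative f (at x) w \<bullet> b) *\<^sub>R frechet_derivative g (at (f x)) b)"
      by (simp add: linear_sum[OF lin] linear_scale[OF lin])
    then show "(\<Sum>b\<in>Basis. (frechet_derivative f (at x) w \<bullet> b) *\<^sub>R frechet_derivative g (at (f x)) b) =
        frechet_derivative (\<lambda>x. g (f x)) (at x) w"
      by (simp add: frechet_derivative_eqI[OF d[OF x]] euclidean_representation)
  qed
  then show ?case using d by (auto simp: differentiable_def)
qed

lemma Ck_on_Pair:
  assumes "open S" "Ck_on k f S" "Ck_on k g S"
  shows "Ck_on k (\<lambda>x. (f x, g x)) S"
proof -
  have "bounded_linear (\<lambda>x. (x, 0))" "bounded_linear (\<lambda>x. (0, x))"
    by (auto intro!: bounded_linear_Pair bounded_linear_ident bounded_linear_zero)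
  then have "Ck_on k (\<lambda>x. (f x, 0) + (0, g x)) S"
    using Ck_on_add[OF assms(1) Ck_on_compose_linear[OF _ assms(1,2)] Ck_on_compose_linear[OF _ assms(1,3)]]
    by blast
  then show ?thesis by simp
qed

lemma smooth_on_cong: "smooth_on S f \<Longrightarrow> open S \<Longrightarrow> (\<And>x. x \<in> S \<Longrightarrow> f x = g x) \<Longrightarrow> smooth_on S g"
  unfolding smooth_on_def using Ck_on_cong by blast

lemma smooth_on_subset: "smooth_on S f \<Longrightarrow> T \<subseteq> S \<Longrightarrow> smooth_on T f"
  unfolding smooth_on_def using Ck_on_subset by blast

lemma smooth_on_local:
  assumes "\<And>x. x \<in> S \<Longrightarrow> \<exists>T. open T \<and> x \<in> T \<and> smooth_on T f"
  shows "smooth_on S f"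
  unfolding smooth_on_def
proof
  show "Ck_on k f S" for k
    by (rule Ck_on_local) (use assms in \<open>auto simp: smooth_on_def\<close>)
qed

lemma smooth_on_compose:
  fixes f :: "'a::euclidean_space \<Rightarrow> 'b::euclidean_space"
  shows "smooth_on S f \<Longrightarrow> smooth_on T g \<Longrightarrow> open S \<Longrightarrow> open T \<Longrightarrow> f ` S \<subseteq> T \<Longrightarrow> smooth_on S (\<lambda>x. g (f x))"
  unfolding smooth_on_def by (simp add: Ck_on_compose)

lemma smooth_on_Pair:
  "smooth_on S f \<Longrightarrow> smooth_on S g \<Longrightarrow> open S \<Longrightarrow> smooth_on S (\<lambda>x. (f x, g x))"
  unfolding smooth_on_def by (simp add: Ck_on_Pair)

lemma smooth_on_const: "smooth_on S (\<lambda>x. c)"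
  unfolding smooth_on_def by (simp add: Ck_on_const)

lemma smooth_on_linear: "bounded_linear f \<Longrightarrow> smooth_on S f"
  unfolding smooth_on_def by (simp add: Ck_on_linear)

lemma smooth_on_frechet_derivative: "smooth_on S f \<Longrightarrow> smooth_on S (\<lambda>x. frechet_derivative f (at x) w)"
  unfolding smooth_on_def
proof
  assume *: "\<forall>k. Ck_on k f S"
  show "Ck_on k (\<lambda>x. frechet_derivative f (at x) w) S" for k
    using spec[OF *, of "Suc k"] by simp
qed

lemma smooth_on_continuous: "smooth_on S f \<Longrightarrow> continuous_on S f"
  unfolding smooth_on_def by (drule spec[of _ 0]) simp

lemma smooth_on_differentiable: "smooth_on S f \<Longrightarrow> x \<in> S \<Longrightarrow> f differentiable (at x)"
  unfolding smooth_on_def by (drule spec[of _ 1]) simp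

lemma smooth_on_has_derivative:
  "smooth_on S f \<Longrightarrow> x \<in> S \<Longrightarrow> (f has_derivative frechet_derivative f (at x)) (at x)"
  using smooth_on_differentiable frechet_derivative_works by blast

text \<open>The mean value theorem is applied along u to the difference of f across e v, and then
  along v to the derivative obtained. The double difference is symmetric in u and v, which is what
  equates the mixed derivatives in the limit.\<close>

lemma double_difference_mvt:
  fixes f :: "'a::euclidean_space \<Rightarrow> real"
  assumes f: "smooth_on S f" and e: "0 < e"
    and in_S: "\<And>r s. 0 \<le> r \<Longrightarrow> r \<le> e \<Longrightarrow> 0 \<le> s \<Longrightarrow> s \<le> e \<Longrightarrow> x + r *\<^sub>R u + s *\<^sub>R v \<in> S"
  shows "\<exists>r s. 0 < r \<and> r < e \<and> 0 < s \<and> s < e \<and>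
    f (x + e *\<^sub>R u + e *\<^sub>R v) - f (x + e *\<^sub>R u) - (f (x + e *\<^sub>R v) - f x) =
    e * e * frechet_derivative (\<lambda>y. frechet_derivative f (at y) u) (at (x + r *\<^sub>R u + s *\<^sub>R v)) v"
proof -
  have D: "((\<lambda>r. g (y + r *\<^sub>R w)) has_real_derivative frechet_derivative g (at (y + r *\<^sub>R w)) w) (at r)"
    if g: "smooth_on S g" "y + r *\<^sub>R w \<in> S" for g :: "'a \<Rightarrow> real" and y w r
  proof -
    have "((\<lambda>r. y + r *\<^sub>R w) has_derivative (\<lambda>h. h *\<^sub>R w)) (at r)"
      by (auto intro!: derivative_eq_intros)
    from has_derivative_compose[OF this smooth_on_has_derivative[OF g]]
    have "((\<lambda>r. g (y + r *\<^sub>R w)) has_derivative (\<lambda>h. frechet_derivative g (at (y + r *\<^sub>R w)) (h *\<^sub>R w))) (at r)" .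
    moreover have "frechet_derivative g (at (y + r *\<^sub>R w)) (h *\<^sub>R w) = frechet_derivative g (at (y + r *\<^sub>R w)) w * h" for h
      using linear_scale[OF linear_frechet_derivative[OF smooth_on_differentiable[OF g]]] by simp
    ultimately show ?thesis by (simp add: has_field_derivative_def mult_commute_abs)
  qed
  define \<phi> where "\<phi> r = f ((x + e *\<^sub>R v) + r *\<^sub>R u) - f (x + r *\<^sub>R u)" for r
  have "\<exists>r>0. r < e \<and> \<phi> e - \<phi> 0 = (e - 0) *
      (frechet_derivative f (at ((x + e *\<^sub>R v) + r *\<^sub>R u)) u - frechet_derivative f (at (x + r *\<^sub>R u)) u)"
  proof (rule MVT2[OF e])
    fix r :: real assume r: "0 \<le> r" "r \<le> e"
    have "x + e *\<^sub>R v + r *\<^sub>R u \<in> S" "x + r *\<^sub>R u \<in> S"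
      using in_S[OF r, of e] in_S[OF r, of 0] e by (simp_all add: add_ac)
    then show "DERIV \<phi> r :> frechet_derivative f (at ((x + e *\<^sub>R v) + r *\<^sub>R u)) u - frechet_derivative f (at (x + r *\<^sub>R u)) u"
      unfolding \<phi>_def by (intro DERIV_diff D f)
  qed
  then obtain r where r: "0 < r" "r < e" "\<phi> e - \<phi> 0 = e *
      (frechet_derivative f (at ((x + e *\<^sub>R v) + r *\<^sub>R u)) u - frechet_derivative f (at (x + r *\<^sub>R u)) u)"
    by auto
  define g where "g y = frechet_derivative f (at y) u" for y
  have g: "smooth_on S g" unfolding g_def using f by (rule smooth_on_frechet_derivative)
  have "\<exists>s>0. s < e \<and> g (x + r *\<^sub>R u + e *\<^sub>R v) - g (x + r *\<^sub>R u + 0 *\<^sub>R v) = (e - 0) *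
      frechet_derivative g (at (x + r *\<^sub>R u + s *\<^sub>R v)) v"
    by (rule MVT2[OF e]) (use r in \<open>auto intro!: D g in_S\<close>)
  then obtain s where s: "0 < s" "s < e" "g (x + r *\<^sub>R u + e *\<^sub>R v) - g (x + r *\<^sub>R u) = e *
      frechet_derivative g (at (x + r *\<^sub>R u + s *\<^sub>R v)) v" by auto
  have "\<phi> e - \<phi> 0 = e * (g (x + r *\<^sub>R u + e *\<^sub>R v) - g (x + r *\<^sub>R u))"
    using r(3) by (simp add: g_def add_ac)
  then have "\<phi> e - \<phi> 0 = e * e * frechet_derivative g (at (x + r *\<^sub>R u + s *\<^sub>R v)) v"
    using s(3) by simp
  moreover have "\<phi> e - \<phi> 0 = f (x + e *\<^sub>R u + e *\<^sub>R v) - f (x + e *\<^sub>R u) - (f (x + e *\<^sub>R v) - f x)"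
    by (simp add: \<phi>_def add_ac)
  ultimately show ?thesis
    using r(1,2) s(1,2) unfolding g_def by (intro exI[of _ r] exI[of _ s]) simp
qed

lemma mixed_derivatives_commute_real:
  fixes f :: "'a::euclidean_space \<Rightarrow> real"
  assumes f: "smooth_on S f" and S: "open S" "x \<in> S"
  shows "frechet_derivative (\<lambda>y. frechet_derivative f (at y) u) (at x) v =
         frechet_derivative (\<lambda>y. frechet_derivative f (at y) v) (at x) u"
proof -
  define P where "P y = frechet_derivative (\<lambda>y. frechet_derivative f (at y) u) (at y) v" for y
  define Q where "Q y = frechet_derivative (\<lambda>y. frechet_derivative f (at y) v) (at y) u" for y
  have "smooth_on S P" "smooth_on S Q"
    unfolding P_def Q_def by (intro smooth_on_frechet_derivative f)+
  then have cont: "isCont P x" "isCont Q x"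
    using smooth_on_continuous continuous_on_eq_continuous_at[OF S(1)] S(2) by blast+
  have "\<bar>P x - Q x\<bar> \<le> \<epsilon>" if \<epsilon>: "\<epsilon> > 0" for \<epsilon>
  proof -
    obtain d1 where d1: "d1 > 0" "\<And>y. dist y x < d1 \<Longrightarrow> \<bar>P y - P x\<bar> < \<epsilon> / 2"
      using cont(1) half_gt_zero[OF \<epsilon>] unfolding continuous_at_eps_delta dist_real_def by blast
    obtain d2 where d2: "d2 > 0" "\<And>y. dist y x < d2 \<Longrightarrow> \<bar>Q y - Q x\<bar> < \<epsilon> / 2"
      using cont(2) half_gt_zero[OF \<epsilon>] unfolding continuous_at_eps_delta dist_real_def by blast
    obtain d3 where d3: "d3 > 0" "ball x d3 \<subseteq> S" using S open_contains_ball by blast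
    define d where "d = min d1 (min d2 d3)"
    define N where "N = norm u + norm v + 1"
    \<comment> \<open>The parallelogram with sides e u and e v stays within d / 2 of x. The summand
      1 in \<open>N\<close> covers u = v = 0.\<close>
    define e where "e = d / (2 * N)"
    have d: "d > 0" using d1 d2 d3 by (simp add: d_def)
    have "N > 0" by (simp add: N_def add_nonneg_pos)
    then have e: "e > 0" using d by (simp add: e_def)
    have close: "dist (x + r *\<^sub>R u + s *\<^sub>R v) x < d" if "0 \<le> r" "r \<le> e" "0 \<le> s" "s \<le> e" for r s
    proof -
      have "dist (x + r *\<^sub>R u + s *\<^sub>R v) x = norm (r *\<^sub>R u + s *\<^sub>R v)" by (simp add: dist_norm add_ac)
      also have "\<dots> \<le> r * norm u + s * norm v" using norm_triangle_ineq[of "r *\<^sub>R u" "s *\<^sub>R v"] that by simp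
      also have "\<dots> \<le> e * norm u + e * norm v" using that by (intro add_mono mult_right_mono) auto
      also have "\<dots> \<le> e * N" using e by (simp add: N_def algebra_simps)
      also have "\<dots> = d / 2" using \<open>N > 0\<close> by (simp add: e_def)
      also have "\<dots> < d" using d by simp
      finally show ?thesis .
    qed
    have in_S: "x + r *\<^sub>R u + s *\<^sub>R v \<in> S" if "0 \<le> r" "r \<le> e" "0 \<le> s" "s \<le> e" for r s
      using close[OF that] d3(2) by (auto simp: d_def dist_commute)
    then have in_S': "x + r *\<^sub>R v + s *\<^sub>R u \<in> S" if "0 \<le> r" "r \<le> e" "0 \<le> s" "s \<le> e" for r s
      using in_S[OF that(3,4,1,2)] by (simp add: add_ac)
    obtain r s where rs: "0 < r" "r < e" "0 < s" "s < e"
      "f (x + e *\<^sub>R u + e *\<^sub>R v) - f (x + e *\<^sub>R u) - (f (x + e *\<^sub>R v) - f x) = e * e * P (x + r *\<^sub>R u + s *\<^sub>R v)"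
      using double_difference_mvt[OF f e in_S] unfolding P_def by blast
    obtain r' s' where rs': "0 < r'" "r' < e" "0 < s'" "s' < e"
      "f (x + e *\<^sub>R v + e *\<^sub>R u) - f (x + e *\<^sub>R v) - (f (x + e *\<^sub>R u) - f x) = e * e * Q (x + r' *\<^sub>R v + s' *\<^sub>R u)"
      using double_difference_mvt[OF f e in_S'] unfolding Q_def by blast
    have "e * e * P (x + r *\<^sub>R u + s *\<^sub>R v) = e * e * Q (x + r' *\<^sub>R v + s' *\<^sub>R u)"
    proof -
      have "x + e *\<^sub>R v + e *\<^sub>R u = x + e *\<^sub>R u + e *\<^sub>R v" by (simp add: add_ac)
      then show ?thesis using rs(5) rs'(5) by (simp only:)
    qed
    then have PQ: "P (x + r *\<^sub>R u + s *\<^sub>R v) = Q (x + s' *\<^sub>R u + r' *\<^sub>R v)"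
      using e by (simp add: add_ac)
    have "\<bar>P (x + r *\<^sub>R u + s *\<^sub>R v) - P x\<bar> < \<epsilon> / 2"
      using close[of r s] rs by (intro d1) (simp add: d_def)
    moreover have "\<bar>Q (x + s' *\<^sub>R u + r' *\<^sub>R v) - Q x\<bar> < \<epsilon> / 2"
      using close[of s' r'] rs' by (intro d2) (simp add: d_def)
    ultimately show ?thesis using PQ by linarith
  qed
  then have "\<bar>P x - Q x\<bar> \<le> 0" by (rule field_le_epsilon) simp
  then show ?thesis by (simp add: P_def Q_def)
qed

lemma mixed_derivatives_commute:
  fixes f :: "'a::euclidean_space \<Rightarrow> 'b::euclidean_space"
  assumes f: "smooth_on S f" and S: "open S" "x \<in> S"
  shows "frechet_derivative (\<lambda>y. frechet_derivative f (at y) u) (at x) v =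
         frechet_derivative (\<lambda>y. frechet_derivative f (at y) v) (at x) u"
proof (rule euclidean_eqI)
  fix b :: 'b
  have inner: "frechet_derivative (\<lambda>y. g y \<bullet> b) (at y) w = frechet_derivative g (at y) w \<bullet> b"
    if "smooth_on S g" "y \<in> S" for g :: "'a \<Rightarrow> 'b" and y w
    using frechet_derivative_eqI[OF bounded_linear.has_derivative[OF bounded_linear_inner_left
        smooth_on_has_derivative[OF that]], of b] by simp
  have fb: "smooth_on S (\<lambda>y. f y \<bullet> b)"
    using f S(1) unfolding smooth_on_def by (simp add: Ck_on_compose_linear[OF bounded_linear_inner_left])
  have "frechet_derivative (\<lambda>y. frechet_derivative f (at y) u) (at x) v \<bullet> b =
      frechet_derivative (\<lambda>y. frechet_derivative (\<lambda>y. f y \<bullet> b) (at y) u) (at x) v" for u v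
  proof -
    have s: "smooth_on S (\<lambda>y. frechet_derivative f (at y) u)"
      using f by (rule smooth_on_frechet_derivative)
    have s': "smooth_on S (\<lambda>y. frechet_derivative (\<lambda>y. f y \<bullet> b) (at y) u)"
      using fb by (rule smooth_on_frechet_derivative)
    have "frechet_derivative (\<lambda>y. frechet_derivative f (at y) u \<bullet> b) (at x) =
        frechet_derivative (\<lambda>y. frechet_derivative (\<lambda>y. f y \<bullet> b) (at y) u) (at x)"
      by (rule frechet_derivative_cong_open(2)[OF S _ smooth_on_differentiable[OF s' S(2)]])
        (simp add: inner[OF f])
    then show ?thesis using inner[OF s S(2)] by metis
  qed
  then show "frechet_derivative (\<lambda>y. frechet_derivative f (at y) u) (at x) v \<bullet> b =
      frechet_derivative (\<lambda>y. frechet_derivative f (at y) v) (at x) u \<bullet> b"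
    using mixed_derivatives_commute_real[OF fb S] by simp
qed

section \<open>Smooth maps between manifolds\<close>

text \<open>The property under which \<open>chart_inv\<close> inverts the chart map. It refers to no
  topology, so it passes directly to \<open>prod_atlas\<close> and holds for
  \<open>real_line_atlas\<close>.\<close>

definition charts_inj :: "('m, 'e) chart set \<Rightarrow> bool" where
  "charts_inj A \<longleftrightarrow> (\<forall>c\<in>A. inj_on (snd c) (fst c))"

lemma charts_injD: "charts_inj A \<Longrightarrow> c \<in> A \<Longrightarrow> inj_on (snd c) (fst c)"
  by (simp add: charts_inj_def)

lemma chart_inv_eq: "charts_inj A \<Longrightarrow> c \<in> A \<Longrightarrow> p \<in> fst c \<Longrightarrow> chart_inv c (snd c p) = p"
  by (simp add: charts_inj_def)

lemma local_rep_eq: "charts_inj A \<Longrightarrow> c \<in> A \<Longrightarrow> p \<in> fst c \<Longrightarrow> local_rep c d f (snd c p) = snd d (f p)"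
  by (simp add: local_rep_def chart_inv_eq)

lemma smooth_mapD:
  assumes "smooth_map A B f" "c \<in> A" "d \<in> B"
  shows "open (snd c ` {p \<in> fst c. f p \<in> fst d})"
    "smooth_on (snd c ` {p \<in> fst c. f p \<in> fst d}) (local_rep c d f)"
  using assms by (simp_all add: smooth_map_def)

text \<open>No single chart of the middle space need contain the image of a source chart. The domain
  is cut into the open pieces \<open>N e\<close> on which f lands in the chart e; there the chain
  rule applies, and smoothness is local.\<close>

lemma smooth_map_compose:
  fixes A :: "('m, 'd::euclidean_space) chart set" and B :: "('n, 'e::euclidean_space) chart set"
  assumes f: "smooth_map A B f" and g: "smooth_map B C g"
    and inj: "charts_inj A" "charts_inj B"
    and cover: "\<And>c p. c \<in> A \<Longrightarrow> p \<in> fst c \<Longrightarrow> \<exists>e\<in>B. f p \<in> fst e"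
  shows "smooth_map A C (\<lambda>p. g (f p))"
  unfolding smooth_map_def
proof (intro ballI)
  fix c d assume c: "c \<in> A" and d: "d \<in> C"
  define P where "P = {p \<in> fst c. g (f p) \<in> fst d}"
  define N where "N e = snd c ` {p \<in> fst c. f p \<in> fst e \<and> g (f p) \<in> fst d}" for e :: "('n, 'e) chart"
  have N: "open (N e) \<and> smooth_on (N e) (local_rep c d (\<lambda>p. g (f p)))" if e: "e \<in> B" for e
  proof -
    define D where "D = snd c ` {p \<in> fst c. f p \<in> fst e}"
    define T where "T = snd e ` {q \<in> fst e. g q \<in> fst d}"
    define F where "F = local_rep c e f"
    have D: "open D" "smooth_on D F" unfolding D_def F_def using smooth_mapD[OF f c e] by simp_all
    have T: "open T" "smooth_on T (local_rep e d g)" unfolding T_def using smooth_mapD[OF g e d] by simp_all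
    have "N e = D \<inter> F -` T"
    proof (intro equalityI subsetI)
      fix x assume "x \<in> N e"
      then obtain p where p: "x = snd c p" "p \<in> fst c" "f p \<in> fst e" "g (f p) \<in> fst d"
        by (auto simp: N_def)
      then show "x \<in> D \<inter> F -` T" by (auto simp: D_def F_def T_def local_rep_eq[OF inj(1) c])
    next
      fix x assume x: "x \<in> D \<inter> F -` T"
      then obtain p where p: "x = snd c p" "p \<in> fst c" "f p \<in> fst e" by (auto simp: D_def)
      then obtain q where q: "q \<in> fst e" "g q \<in> fst d" "snd e (f p) = snd e q"
        using x by (auto simp: F_def T_def local_rep_eq[OF inj(1) c])
      then have "q = f p" using inj_onD[OF charts_injD[OF inj(2) e] q(3) p(3) q(1)] by simp
      then show "x \<in> N e" using p q by (auto simp: N_def)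
    qed
    moreover have "open (D \<inter> F -` T)"
      using continuous_open_preimage[OF smooth_on_continuous[OF D(2)] D(1) T(1)] .
    ultimately have NO: "open (N e)" and sub: "N e \<subseteq> D" "F ` N e \<subseteq> T" by auto
    have "smooth_on (N e) (\<lambda>x. local_rep e d g (F x))"
      by (rule smooth_on_compose[OF smooth_on_subset[OF D(2) sub(1)] T(2) NO T(1) sub(2)])
    then have "smooth_on (N e) (local_rep c d (\<lambda>p. g (f p)))"
    proof (rule smooth_on_cong[OF _ NO])
      fix x assume "x \<in> N e"
      then obtain p where p: "x = snd c p" "p \<in> fst c" "f p \<in> fst e" by (auto simp: N_def)
      then show "local_rep e d g (F x) = local_rep c d (\<lambda>p. g (f p)) x"
        by (simp add: F_def local_rep_eq[OF inj(1) c] local_rep_eq[OF inj(2) e])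
    qed
    then show ?thesis using NO by simp
  qed
  have ex: "\<exists>e\<in>B. x \<in> N e" if x: "x \<in> snd c ` P" for x
  proof -
    obtain p where p: "x = snd c p" "p \<in> fst c" "g (f p) \<in> fst d" using x by (auto simp: P_def)
    obtain e where "e \<in> B" "f p \<in> fst e" using cover[OF c p(2)] by blast
    then show ?thesis using p by (auto simp: N_def)
  qed
  have sub: "N e \<subseteq> snd c ` P" for e by (auto simp: N_def P_def)
  have "snd c ` P = (\<Union>e\<in>B. N e)" using ex sub by blast
  then have "open (snd c ` P)" using N by auto
  moreover have "smooth_on (snd c ` P) (local_rep c d (\<lambda>p. g (f p)))"
  proof (rule smooth_on_local)
    fix x assume "x \<in> snd c ` P"
    then obtain e where e: "e \<in> B" "x \<in> N e" using ex by blast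
    then show "\<exists>T. open T \<and> x \<in> T \<and> smooth_on T (local_rep c d (\<lambda>p. g (f p)))"
      using N[OF e(1)] by blast
  qed
  ultimately show "open (snd c ` {p \<in> fst c. g (f p) \<in> fst d}) \<and>
      smooth_on (snd c ` {p \<in> fst c. g (f p) \<in> fst d}) (local_rep c d (\<lambda>p. g (f p)))"
    by (simp add: P_def)
qed

lemma smooth_map_Pair:
  assumes f: "smooth_map A B f" and g: "smooth_map A C g" and inj: "charts_inj A"
  shows "smooth_map A (prod_atlas B C) (\<lambda>p. (f p, g p))"
  unfolding smooth_map_def
proof (intro ballI)
  fix c de assume c: "c \<in> A" and "de \<in> prod_atlas B C"
  then obtain d e where de: "d \<in> B" "e \<in> C" "de = (fst d \<times> fst e, map_prod (snd d) (snd e))"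
    by (auto simp: prod_atlas_def)
  define S where "S = snd c ` {p \<in> fst c. f p \<in> fst d} \<inter> snd c ` {p \<in> fst c. g p \<in> fst e}"
  have S_eq: "snd c ` {p \<in> fst c. (f p, g p) \<in> fst de} = S"
  proof -
    have "{p \<in> fst c. (f p, g p) \<in> fst de} = {p \<in> fst c. f p \<in> fst d} \<inter> {p \<in> fst c. g p \<in> fst e}"
      by (auto simp: de(3))
    moreover have "snd c ` ({p \<in> fst c. f p \<in> fst d} \<inter> {p \<in> fst c. g p \<in> fst e}) = S"
      unfolding S_def by (rule inj_on_image_Int[OF charts_injD[OF inj c]]) auto
    ultimately show ?thesis by simp
  qed
  have "open S" unfolding S_def using smooth_mapD(1)[OF f c de(1)] smooth_mapD(1)[OF g c de(2)] by (rule open_Int)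
  moreover have "smooth_on S (\<lambda>x. (local_rep c d f x, local_rep c e g x))"
    by (rule smooth_on_Pair[OF smooth_on_subset[OF smooth_mapD(2)[OF f c de(1)]]
          smooth_on_subset[OF smooth_mapD(2)[OF g c de(2)]] \<open>open S\<close>]) (auto simp: S_def)
  moreover have "(\<lambda>x. (local_rep c d f x, local_rep c e g x)) = local_rep c de (\<lambda>p. (f p, g p))"
    by (auto simp: local_rep_def de(3))
  ultimately show "open (snd c ` {p \<in> fst c. (f p, g p) \<in> fst de}) \<and>
      smooth_on (snd c ` {p \<in> fst c. (f p, g p) \<in> fst de}) (local_rep c de (\<lambda>p. (f p, g p)))"
    by (simp add: S_eq)
qed

lemma smooth_map_const:
  assumes "\<And>c. c \<in> A \<Longrightarrow> open (snd c ` fst c)"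
  shows "smooth_map A B (\<lambda>p. q)"
  unfolding smooth_map_def
proof (intro ballI)
  fix c d assume c: "c \<in> A" "d \<in> B"
  have "{p \<in> fst c. q \<in> fst d} = (if q \<in> fst d then fst c else {})" by auto
  moreover have "local_rep c d (\<lambda>p. q) = (\<lambda>x. snd d q)" by (auto simp: local_rep_def)
  ultimately show "open (snd c ` {p \<in> fst c. q \<in> fst d}) \<and>
      smooth_on (snd c ` {p \<in> fst c. q \<in> fst d}) (local_rep c d (\<lambda>p. q))"
    using assms[OF c(1)] by (simp add: smooth_on_const)
qed

lemma charts_inj_prod: "charts_inj A \<Longrightarrow> charts_inj B \<Longrightarrow> charts_inj (prod_atlas A B)"
  by (auto simp: charts_inj_def prod_atlas_def intro!: map_prod_inj_on)

lemma smooth_map_fst: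
  assumes id: "smooth_map A A (\<lambda>p. p)" and B: "\<And>c. c \<in> B \<Longrightarrow> open (snd c ` fst c)"
    and inj: "charts_inj A" "charts_inj B"
  shows "smooth_map (prod_atlas A B) A fst"
  unfolding smooth_map_def
proof (intro ballI)
  fix ce d assume "ce \<in> prod_atlas A B" and d: "d \<in> A"
  then obtain c e where ce: "c \<in> A" "e \<in> B" "ce = (fst c \<times> fst e, map_prod (snd c) (snd e))"
    by (auto simp: prod_atlas_def)
  have ce': "ce \<in> prod_atlas A B" unfolding prod_atlas_def using ce by blast
  define D where "D = snd c ` {p \<in> fst c. p \<in> fst d}"
  have D: "open D" "smooth_on D (local_rep c d (\<lambda>p. p))"
    using smooth_mapD[OF id ce(1) d] by (simp_all add: D_def)
  have S: "snd ce ` {p \<in> fst ce. fst p \<in> fst d} = D \<times> snd e ` fst e"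
    by (force simp: ce(3) D_def)
  have op: "open (D \<times> snd e ` fst e)" using D(1) B[OF ce(2)] by (rule open_Times)
  have "smooth_on (D \<times> snd e ` fst e) (\<lambda>z. local_rep c d (\<lambda>p. p) (fst z))"
    by (rule smooth_on_compose[OF smooth_on_linear[OF bounded_linear_fst] D(2) op D(1)]) auto
  then have "smooth_on (D \<times> snd e ` fst e) (local_rep ce d fst)"
  proof (rule smooth_on_cong[OF _ op])
    fix z assume "z \<in> D \<times> snd e ` fst e"
    then obtain p q where p: "z = (snd c p, snd e q)" "p \<in> fst c" "q \<in> fst e"
      by (auto simp: D_def)
    then have z: "z = snd ce (p, q)" "(p, q) \<in> fst ce" by (simp_all add: ce(3))
    have "local_rep c d (\<lambda>p. p) (fst z) = snd d p"
      using p by (simp add: local_rep_eq[OF inj(1) ce(1)])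
    also have "\<dots> = local_rep ce d fst z"
      using local_rep_eq[OF charts_inj_prod[OF inj] ce' z(2), of d fst] z(1) by simp
    finally show "local_rep c d (\<lambda>p. p) (fst z) = local_rep ce d fst z" .
  qed
  then show "open (snd ce ` {p \<in> fst ce. fst p \<in> fst d}) \<and>
      smooth_on (snd ce ` {p \<in> fst ce. fst p \<in> fst d}) (local_rep ce d fst)"
    using op by (simp add: S)
qed

lemma smooth_map_snd:
  assumes id: "smooth_map B B (\<lambda>p. p)" and A: "\<And>c. c \<in> A \<Longrightarrow> open (snd c ` fst c)"
    and inj: "charts_inj A" "charts_inj B"
  shows "smooth_map (prod_atlas A B) B snd"
  unfolding smooth_map_def
proof (intro ballI)
  fix ce d assume "ce \<in> prod_atlas A B" and d: "d \<in> B"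
  then obtain c e where ce: "c \<in> A" "e \<in> B" "ce = (fst c \<times> fst e, map_prod (snd c) (snd e))"
    by (auto simp: prod_atlas_def)
  have ce': "ce \<in> prod_atlas A B" unfolding prod_atlas_def using ce by blast
  define D where "D = snd e ` {p \<in> fst e. p \<in> fst d}"
  have D: "open D" "smooth_on D (local_rep e d (\<lambda>p. p))"
    using smooth_mapD[OF id ce(2) d] by (simp_all add: D_def)
  have S: "snd ce ` {p \<in> fst ce. snd p \<in> fst d} = snd c ` fst c \<times> D"
    by (force simp: ce(3) D_def)
  have op: "open (snd c ` fst c \<times> D)" using A[OF ce(1)] D(1) by (rule open_Times)
  have "smooth_on (snd c ` fst c \<times> D) (\<lambda>z. local_rep e d (\<lambda>p. p) (snd z))"
    by (rule smooth_on_compose[OF smooth_on_linear[OF bounded_linear_snd] D(2) op D(1)]) auto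
  then have "smooth_on (snd c ` fst c \<times> D) (local_rep ce d snd)"
  proof (rule smooth_on_cong[OF _ op])
    fix z assume "z \<in> snd c ` fst c \<times> D"
    then obtain p q where p: "z = (snd c p, snd e q)" "p \<in> fst c" "q \<in> fst e"
      by (auto simp: D_def)
    then have z: "z = snd ce (p, q)" "(p, q) \<in> fst ce" by (simp_all add: ce(3))
    have "local_rep e d (\<lambda>p. p) (snd z) = snd d q"
      using p by (simp add: local_rep_eq[OF inj(2) ce(2)])
    also have "\<dots> = local_rep ce d snd z"
      using local_rep_eq[OF charts_inj_prod[OF inj] ce' z(2), of d snd] z(1) by simp
    finally show "local_rep e d (\<lambda>p. p) (snd z) = local_rep ce d snd z" .
  qed
  then show "open (snd ce ` {p \<in> fst ce. snd p \<in> fst d}) \<and>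
      smooth_on (snd ce ` {p \<in> fst ce. snd p \<in> fst d}) (local_rep ce d snd)"
    using op by (simp add: S)
qed

lemma smooth_atlas_charts:
  assumes "smooth_atlas X A"
  shows "charts_inj A" "\<And>c. c \<in> A \<Longrightarrow> open (snd c ` fst c)" "smooth_map A A (\<lambda>p. p)"
    "(\<Union>c\<in>A. fst c) = topspace X" "\<And>c. c \<in> A \<Longrightarrow> openin X (fst c)"
    "\<And>c. c \<in> A \<Longrightarrow> homeomorphic_map (subtopology X (fst c)) (top_of_set (snd c ` fst c)) (snd c)"
proof -
  show op: "\<And>c. c \<in> A \<Longrightarrow> open (snd c ` fst c)" "\<And>c. c \<in> A \<Longrightarrow> openin X (fst c)"
    "(\<Union>c\<in>A. fst c) = topspace X"
    and hom: "\<And>c. c \<in> A \<Longrightarrow> homeomorphic_map (subtopology X (fst c)) (top_of_set (snd c ` fst c)) (snd c)"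
    using assms by (simp_all add: smooth_atlas_def)
  have top: "topspace (subtopology X (fst c)) = fst c" if "c \<in> A" for c
    using op(2)[OF that] openin_subset by (auto simp: topspace_subtopology)
  show inj: "charts_inj A"
    unfolding charts_inj_def using homeomorphic_imp_injective_map[OF hom] top by simp
  show "smooth_map A A (\<lambda>p. p)"
    unfolding smooth_map_def
  proof (intro ballI)
    fix c d assume c: "c \<in> A" and d: "d \<in> A"
    have eq: "{p \<in> fst c. p \<in> fst d} = fst c \<inter> fst d" by auto
    \<comment> \<open>Smoothness of the coordinate changes is part of the atlas; openness of their
      domains follows from the charts being homeomorphisms onto open sets.\<close>
    have "openin (subtopology X (fst c)) (fst c \<inter> fst d)"
      using op(2)[OF d] by (auto simp: openin_subtopology_Int2)
    then have "openin (top_of_set (snd c ` fst c)) (snd c ` (fst c \<inter> fst d))"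
      using homeomorphic_imp_open_map[OF hom[OF c]] by (simp add: open_map_def)
    then have "open (snd c ` (fst c \<inter> fst d))"
      using op(1)[OF c] openin_open_trans by blast
    moreover have "smooth_on (snd c ` (fst c \<inter> fst d)) (local_rep c d (\<lambda>p. p))"
      using assms c d by (simp add: smooth_atlas_def)
    ultimately show "open (snd c ` {p \<in> fst c. p \<in> fst d}) \<and>
        smooth_on (snd c ` {p \<in> fst c. p \<in> fst d}) (local_rep c d (\<lambda>p. p))"
      by (simp add: eq)
  qed
qed

section \<open>The adjoint representation of a Lie group\<close>

lemma has_vector_derivative_chain:
  assumes "(f has_vector_derivative U) (at s)" "(g has_derivative L) (at (f s))"
  shows "((\<lambda>s. g (f s)) has_vector_derivative L U) (at s)"
proof -
  have "((\<lambda>s. g (f s)) has_derivative (\<lambda>h. L (h *\<^sub>R U))) (at s)"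
    using assms(1) assms(2) unfolding has_vector_derivative_def by (rule has_derivative_compose)
  moreover have "(\<lambda>h. L (h *\<^sub>R U)) = (\<lambda>h. h *\<^sub>R L U)"
    using linear_scale[OF has_derivative_linear[OF assms(2)]] by auto
  ultimately show ?thesis by (simp add: has_vector_derivative_def)
qed

lemma has_vector_derivative_transform_open:
  assumes "(f has_vector_derivative U) (at s)" "open S" "s \<in> S" "\<And>r. r \<in> S \<Longrightarrow> f r = g r"
  shows "(g has_vector_derivative U) (at s)"
  unfolding has_vector_derivative_def
  by (rule has_derivative_transform_within_open[OF assms(1)[unfolded has_vector_derivative_def] assms(2,3)])
    (rule assms(4))

lemma real_line_atlas_charts: "charts_inj real_line_atlas"
  "\<And>c. c \<in> real_line_atlas \<Longrightarrow> open (snd c ` fst c)" "(UNIV, \<lambda>s. s) \<in> real_line_atlas"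
  by (simp_all add: charts_inj_def real_line_atlas_def inj_on_def)

lemma smooth_map_real_line_scale: "smooth_map real_line_atlas real_line_atlas (\<lambda>s. r * s)"
proof -
  have "local_rep (UNIV, \<lambda>s::real. s) (UNIV, \<lambda>s. s) (\<lambda>s. r * s) = (\<lambda>s. r * s)"
    using inv_into_f_f[of "\<lambda>s::real. s" UNIV] by (auto simp: local_rep_def inj_on_def)
  then show ?thesis
    by (simp add: smooth_map_def real_line_atlas_def smooth_on_linear[OF bounded_linear_mult_right])
qed

section \<open>Ad and the bracket in a chart at the identity\<close>

locale lie_group_chart = lie_group K X A
  for K :: "'k monoid" (structure) and X :: "'k topology" and A :: "('k, 'e::euclidean_space) chart set" +
  fixes c :: "('k, 'e) chart"
  assumes c: "c \<in> A" and one_c: "\<one> \<in> fst c"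
begin

lemmas charts = smooth_atlas_charts[OF atlas]

definition e0 :: 'e where "e0 = snd c \<one>"

definition D :: "'e set" where "D = snd c ` fst c"

lemma e0_D: "e0 \<in> D" using one_c by (simp add: e0_def D_def)

lemma open_D: "open D" unfolding D_def by (rule charts(2)[OF c])

lemma chart_carrier: "d \<in> A \<Longrightarrow> p \<in> fst d \<Longrightarrow> p \<in> carrier K"
  using charts(4) topspace_eq by auto

lemma chart_cover: "p \<in> carrier K \<Longrightarrow> \<exists>d\<in>A. p \<in> fst d"
  using charts(4) topspace_eq by auto

lemma chart_inv_chart: "d \<in> A \<Longrightarrow> p \<in> fst d \<Longrightarrow> chart_inv d (snd d p) = p"
  by (rule chart_inv_eq[OF charts(1)])

lemma smooth_map_into_group:
  assumes "smooth_map B A f" "smooth_map A C g" "charts_inj B"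
    "\<And>d p. d \<in> B \<Longrightarrow> p \<in> fst d \<Longrightarrow> f p \<in> carrier K"
  shows "smooth_map B C (\<lambda>p. g (f p))"
  by (rule smooth_map_compose[OF assms(1,2,3) charts(1)]) (use assms(4) chart_cover in blast)

lemma smooth_map_mult:
  assumes "smooth_map B A f" "smooth_map B A g" "charts_inj B"
    "\<And>d p. d \<in> B \<Longrightarrow> p \<in> fst d \<Longrightarrow> f p \<in> carrier K"
    "\<And>d p. d \<in> B \<Longrightarrow> p \<in> fst d \<Longrightarrow> g p \<in> carrier K"
  shows "smooth_map B A (\<lambda>p. f p \<otimes> g p)"
proof -
  have "smooth_map B A (\<lambda>p. (\<lambda>(x, y). x \<otimes> y) (f p, g p))"
  proof (rule smooth_map_compose[OF smooth_map_Pair[OF assms(1,2,3)] smooth_mult assms(3) charts_inj_prod[OF charts(1) charts(1)]])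
    fix d p assume dp: "d \<in> B" "p \<in> fst d"
    obtain e e' where "e \<in> A" "e' \<in> A" "f p \<in> fst e" "g p \<in> fst e'"
      using chart_cover assms(4,5)[OF dp] by blast
    then have "(fst e \<times> fst e', map_prod (snd e) (snd e')) \<in> prod_atlas A A"
      unfolding prod_atlas_def by blast
    moreover have "(f p, g p) \<in> fst (fst e \<times> fst e', map_prod (snd e) (snd e'))"
      using \<open>f p \<in> fst e\<close> \<open>g p \<in> fst e'\<close> by simp
    ultimately show "\<exists>e\<in>prod_atlas A A. (f p, g p) \<in> fst e" by blast
  qed
  then show ?thesis by simp
qed

lemma smooth_map_conj:
  assumes "g \<in> carrier K"
  shows "smooth_map A A (\<lambda>x. g \<otimes> x \<otimes> inv g)"
  by (intro smooth_map_mult smooth_map_const charts)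
    (use assms chart_carrier in auto)

lemma smooth_map_conj2: "smooth_map (prod_atlas A A) A (\<lambda>p. fst p \<otimes> snd p \<otimes> inv (fst p))"
proof -
  have inj: "charts_inj (prod_atlas A A)" by (rule charts_inj_prod[OF charts(1) charts(1)])
  have carr: "fst p \<in> carrier K" "snd p \<in> carrier K" if "d \<in> prod_atlas A A" "p \<in> fst d" for d p
    using that chart_carrier unfolding prod_atlas_def by auto
  have f: "smooth_map (prod_atlas A A) A fst" and s: "smooth_map (prod_atlas A A) A snd"
    by (rule smooth_map_fst[OF charts(3,2,1,1)] smooth_map_snd[OF charts(3,2,1,1)]; assumption)+
  have "smooth_map (prod_atlas A A) A (\<lambda>p. inv (fst p))"
    by (rule smooth_map_into_group[OF f smooth_inv inj carr(1)])
  then show ?thesis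
    by (intro smooth_map_mult f s inj) (use carr in auto)
qed

definition cj :: "'k \<Rightarrow> 'e \<Rightarrow> 'e" where
  "cj g = local_rep c c (\<lambda>x. g \<otimes> x \<otimes> inv g)"

definition cj_dom :: "'k \<Rightarrow> 'e set" where
  "cj_dom g = snd c ` {p \<in> fst c. g \<otimes> p \<otimes> inv g \<in> fst c}"

lemma cj_eq: "p \<in> fst c \<Longrightarrow> cj g (snd c p) = snd c (g \<otimes> p \<otimes> inv g)"
  unfolding cj_def by (rule local_rep_eq[OF charts(1) c])

lemma cj_e0: "g \<in> carrier K \<Longrightarrow> cj g e0 = e0"
  using cj_eq[OF one_c, of g] by (simp add: e0_def)

lemma cj_dom:
  assumes "g \<in> carrier K"
  shows "open (cj_dom g)" "smooth_on (cj_dom g) (cj g)" "e0 \<in> cj_dom g" "cj_dom g \<subseteq> D"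
proof -
  show "open (cj_dom g)" "smooth_on (cj_dom g) (cj g)"
    using smooth_mapD[OF smooth_map_conj[OF assms] c c] by (simp_all add: cj_dom_def cj_def)
  have "\<one> \<in> {p \<in> fst c. g \<otimes> p \<otimes> inv g \<in> fst c}" using one_c assms by simp
  then show "e0 \<in> cj_dom g" unfolding cj_dom_def e0_def by (rule imageI)
qed (auto simp: cj_dom_def D_def)

lemma Ad_has_derivative:
  assumes "g \<in> carrier K"
  shows "(cj g has_derivative Ad K c g) (at e0)"
  using smooth_on_has_derivative[OF cj_dom(2,3)[OF assms]] by (simp add: Ad_def cj_def e0_def)

lemma bounded_linear_Ad: "g \<in> carrier K \<Longrightarrow> bounded_linear (Ad K c g)"
  using Ad_has_derivative has_derivative_bounded_linear by blast

lemma Ad_mult: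
  assumes "g \<in> carrier K" "g' \<in> carrier K"
  shows "Ad K c (g \<otimes> g') V = Ad K c g (Ad K c g' V)"
proof -
  have "((\<lambda>x. cj g (cj g' x)) has_derivative (\<lambda>v. Ad K c g (Ad K c g' v))) (at e0)"
    using has_derivative_compose[OF Ad_has_derivative[OF assms(2)], of "cj g" "Ad K c g"]
      Ad_has_derivative[OF assms(1)] cj_e0[OF assms(2)] by simp
  then have "(cj (g \<otimes> g') has_derivative (\<lambda>v. Ad K c g (Ad K c g' v))) (at e0)"
  proof (rule has_derivative_transform_within_open[OF _ cj_dom(1,3)[OF assms(2)]])
    fix x assume "x \<in> cj_dom g'"
    then obtain p where p: "x = snd c p" "p \<in> fst c" "g' \<otimes> p \<otimes> inv g' \<in> fst c"
      by (auto simp: cj_dom_def)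
    have "g \<otimes> (g' \<otimes> p \<otimes> inv g') \<otimes> inv g = g \<otimes> g' \<otimes> p \<otimes> inv (g \<otimes> g')"
      using assms chart_carrier[OF c p(2)] by (simp add: inv_mult_group m_assoc)
    then show "cj g (cj g' x) = cj (g \<otimes> g') x"
      by (simp add: p(1) cj_eq[OF p(2)] cj_eq[OF p(3)])
  qed
  then have "Ad K c (g \<otimes> g') = (\<lambda>v. Ad K c g (Ad K c g' v))"
    using Ad_has_derivative[OF m_closed[OF assms]] has_derivative_unique by blast
  then show ?thesis by simp
qed

lemma Ad_one: "Ad K c \<one> V = V"
proof -
  have "(cj \<one> has_derivative (\<lambda>v. v)) (at e0)"
  proof (rule has_derivative_transform_within_open[OF has_derivative_ident open_D e0_D])
    fix x assume "x \<in> D"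
    then obtain p where p: "x = snd c p" "p \<in> fst c" by (auto simp: D_def)
    then show "x = cj \<one> x" using chart_carrier[OF c p(2)] by (simp add: cj_eq[OF p(2)])
  qed
  then have "Ad K c \<one> = (\<lambda>v. v)"
    using Ad_has_derivative[OF one_closed] has_derivative_unique by blast
  then show ?thesis by simp
qed

text \<open>Ad g V is the partial derivative of the conjugation (g, x) \<mapsto> g x g^-1 in its
  second variable at x = 1. Joint smoothness of that map makes it smooth in g.\<close>

lemma smooth_on_Ad:
  assumes d: "d \<in> A"
  shows "smooth_on (snd d ` fst d) (\<lambda>y. Ad K c (chart_inv d y) V)"
proof -
  define dc where "dc = (fst d \<times> fst c, map_prod (snd d) (snd c))"
  have dc: "dc \<in> prod_atlas A A" unfolding dc_def prod_atlas_def using d c by blast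
  define F where "F p = fst p \<otimes> snd p \<otimes> inv (fst p)" for p :: "'k \<times> 'k"
  define G where "G = local_rep dc c F"
  define W where "W = snd dc ` {p \<in> fst dc. F p \<in> fst c}"
  have W: "open W" "smooth_on W G"
    using smooth_mapD[OF smooth_map_conj2 dc c] by (simp_all add: W_def G_def F_def[abs_def])
  have G_eq: "G (snd d g, snd c p) = snd c (g \<otimes> p \<otimes> inv g)" if "g \<in> fst d" "p \<in> fst c" for g p
    using local_rep_eq[OF charts_inj_prod[OF charts(1) charts(1)] dc, of "(g, p)" c F] that
    by (simp add: G_def dc_def F_def)
  have in_W: "(snd d g, e0) \<in> W" if g: "g \<in> fst d" for g
  proof -
    have "(g, \<one>) \<in> {p \<in> fst dc. F p \<in> fst c}"
      using g one_c chart_carrier[OF d g] by (simp add: dc_def F_def)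
    then have "snd dc (g, \<one>) \<in> W" unfolding W_def by (rule imageI)
    then show ?thesis by (simp add: dc_def e0_def)
  qed
  have Ad_eq: "Ad K c g V = frechet_derivative G (at (snd d g, e0)) (0, V)" if g: "g \<in> fst d" for g
  proof -
    have "((\<lambda>x. G (snd d g, x)) has_derivative (\<lambda>v. frechet_derivative G (at (snd d g, e0)) (0, v))) (at e0)"
      by (rule has_derivative_compose[OF has_derivative_Pair[OF has_derivative_const has_derivative_ident]
            smooth_on_has_derivative[OF W(2) in_W[OF g]]])
    then have "(cj g has_derivative (\<lambda>v. frechet_derivative G (at (snd d g, e0)) (0, v))) (at e0)"
      by (rule has_derivative_transform_within_open[OF _ open_D e0_D])
        (auto simp: D_def cj_eq G_eq[OF g])
    then have "Ad K c g = (\<lambda>v. frechet_derivative G (at (snd d g, e0)) (0, v))"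
      using Ad_has_derivative[OF chart_carrier[OF d g]] has_derivative_unique by blast
    then show ?thesis by simp
  qed
  have "smooth_on (snd d ` fst d) (\<lambda>y. frechet_derivative G (at (y, e0)) (0, V))"
  proof (rule smooth_on_compose[OF smooth_on_Pair smooth_on_frechet_derivative[OF W(2)]])
    show "smooth_on (snd d ` fst d) (\<lambda>y. y)" by (rule smooth_on_linear[OF bounded_linear_ident])
    show "(\<lambda>x. (x, e0)) ` snd d ` fst d \<subseteq> W" using in_W by auto
  qed (use charts(2)[OF d] W(1) smooth_on_const in auto)
  then show ?thesis
    by (rule smooth_on_cong[OF _ charts(2)[OF d]]) (auto simp: Ad_eq chart_inv_chart[OF d])
qed

abbreviation "br \<equiv> lie_bracket K c"

lemma Ad_chart_has_derivative:
  "((\<lambda>y. Ad K c (chart_inv c y) V) has_derivative (\<lambda>U. br U V)) (at e0)"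
  using smooth_on_has_derivative[OF smooth_on_Ad[OF c, of V], of e0] e0_D
  by (simp add: lie_bracket_def D_def e0_def)

lemma chart_inv_e0: "chart_inv c e0 = \<one>"
  by (simp add: e0_def chart_inv_chart[OF c one_c])

lemma chart_inv_D: "y \<in> D \<Longrightarrow> chart_inv c y \<in> fst c" "y \<in> D \<Longrightarrow> snd c (chart_inv c y) = y"
  by (auto simp: D_def chart_inv_chart[OF c])

text \<open>In the first slot the bracket is a derivative, hence linear; in the second, linearity of
  each Ad is differentiated.\<close>

lemma bilinear_bracket: "bilinear br"
proof -
  have "linear (\<lambda>U. br U V)" for V
    using has_derivative_linear[OF Ad_chart_has_derivative] .
  moreover have "linear (br U)" for U
  proof (rule linearI)
    have lin: "linear (Ad K c (chart_inv c y))" if "y \<in> D" for y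
      using bounded_linear_Ad[OF chart_carrier[OF c chart_inv_D(1)[OF that]]] bounded_linear.linear by blast
    fix V W :: 'e and r :: real
    have "((\<lambda>y. Ad K c (chart_inv c y) (V + W)) has_derivative (\<lambda>U. br U V + br U W)) (at e0)"
      by (rule has_derivative_transform_within_open[OF has_derivative_add[OF Ad_chart_has_derivative Ad_chart_has_derivative] open_D e0_D])
        (simp add: linear_add[OF lin])
    from has_derivative_unique[OF this Ad_chart_has_derivative] show "br U (V + W) = br U V + br U W"
      by metis
    have "((\<lambda>y. Ad K c (chart_inv c y) (r *\<^sub>R V)) has_derivative (\<lambda>U. r *\<^sub>R br U V)) (at e0)"
      by (rule has_derivative_transform_within_open[OF has_derivative_scaleR_right[OF Ad_chart_has_derivative] open_D e0_D])
        (simp add: linear_scale[OF lin])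
    from has_derivative_unique[OF this Ad_chart_has_derivative] show "br U (r *\<^sub>R V) = r *\<^sub>R br U V"
      by metis
  qed
  ultimately show ?thesis by (simp add: bilinear_def)
qed

text \<open>Differentiate Ad g (Ad p V) = Ad (g p g^-1) (Ad g V) in p at the identity.\<close>

lemma Ad_bracket:
  assumes g: "g \<in> carrier K"
  shows "Ad K c g (br U V) = br (Ad K c g U) (Ad K c g V)"
proof -
  have "((\<lambda>y. Ad K c g (Ad K c (chart_inv c y) V)) has_derivative (\<lambda>U. Ad K c g (br U V))) (at e0)"
    by (rule bounded_linear.has_derivative[OF bounded_linear_Ad[OF g] Ad_chart_has_derivative])
  moreover have "((\<lambda>y. Ad K c (chart_inv c (cj g y)) (Ad K c g V)) has_derivative
      (\<lambda>U. br (Ad K c g U) (Ad K c g V))) (at e0)"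
    using has_derivative_compose[OF Ad_has_derivative[OF g], of "\<lambda>y. Ad K c (chart_inv c y) (Ad K c g V)"]
      Ad_chart_has_derivative[of "Ad K c g V"] cj_e0[OF g] by simp
  then have "((\<lambda>y. Ad K c g (Ad K c (chart_inv c y) V)) has_derivative
      (\<lambda>U. br (Ad K c g U) (Ad K c g V))) (at e0)"
  proof (rule has_derivative_transform_within_open[OF _ cj_dom(1,3)[OF g]])
    fix x assume "x \<in> cj_dom g"
    then obtain p where p: "x = snd c p" "p \<in> fst c" "g \<otimes> p \<otimes> inv g \<in> fst c"
      by (auto simp: cj_dom_def)
    have pK: "p \<in> carrier K" using chart_carrier[OF c p(2)] .
    have "Ad K c (chart_inv c (cj g x)) (Ad K c g V) = Ad K c (g \<otimes> p \<otimes> inv g) (Ad K c g V)"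
      by (simp add: p(1) cj_eq[OF p(2)] chart_inv_chart[OF c p(3)])
    also have "\<dots> = Ad K c (g \<otimes> p \<otimes> inv g \<otimes> g) V"
      using g pK by (simp add: Ad_mult)
    also have "g \<otimes> p \<otimes> inv g \<otimes> g = g \<otimes> p" using g pK by (simp add: m_assoc)
    also have "Ad K c (g \<otimes> p) V = Ad K c g (Ad K c (chart_inv c x) V)"
      using g pK by (simp add: Ad_mult p(1) chart_inv_chart[OF c p(2)])
    finally show "Ad K c (chart_inv c (cj g x)) (Ad K c g V) = Ad K c g (Ad K c (chart_inv c x) V)" .
  qed
  ultimately have "(\<lambda>U. Ad K c g (br U V)) = (\<lambda>U. br (Ad K c g U) (Ad K c g V))"
    by (rule has_derivative_unique)
  then show ?thesis by metis
qed

text \<open>Differentiate Ad p [U, V] = [Ad p U, Ad p V] in p at the identity; the product rule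
  gives the two terms.\<close>

lemma bracket_jacobi: "br W (br U V) = br (br W U) V + br U (br W V)"
proof -
  have bb: "bounded_bilinear br" using bilinear_bracket by (simp add: bilinear_conv_bounded_bilinear)
  have "((\<lambda>y. br (Ad K c (chart_inv c y) U) (Ad K c (chart_inv c y) V)) has_derivative
      (\<lambda>W. br (Ad K c (chart_inv c e0) U) (br W V) + br (br W U) (Ad K c (chart_inv c e0) V))) (at e0)"
    by (rule bounded_bilinear.FDERIV[OF bb Ad_chart_has_derivative Ad_chart_has_derivative])
  then have "((\<lambda>y. Ad K c (chart_inv c y) (br U V)) has_derivative (\<lambda>W. br U (br W V) + br (br W U) V)) (at e0)"
    unfolding chart_inv_e0 Ad_one
    by (rule has_derivative_transform_within_open[OF _ open_D e0_D])
      (simp add: Ad_bracket chart_carrier[OF c chart_inv_D(1)])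
  from has_derivative_unique[OF this Ad_chart_has_derivative]
  have "br U (br W V) + br (br W U) V = br W (br U V)" by metis
  then show ?thesis by (simp add: add.commute)
qed

text \<open>Antisymmetry comes from differentiating \<open>(y x y\<^sup>-\<^sup>1) y = y x\<close> in \<open>x\<close> and then in \<open>y\<close>, with the
  symmetry of the second derivative of the multiplication \<open>M\<close>.\<close>

lemma bracket_antisym: "br U V = - br V U"
proof -
  define cc where "cc = (fst c \<times> fst c, map_prod (snd c) (snd c))"
  have cc: "cc \<in> prod_atlas A A" unfolding cc_def prod_atlas_def using c by blast
  define M where "M = local_rep cc c (\<lambda>(x, y). x \<otimes> y)"
  define \<Omega> where "\<Omega> = snd cc ` {p \<in> fst cc. (\<lambda>(x, y). x \<otimes> y) p \<in> fst c}"
  have \<Omega>: "open \<Omega>" "smooth_on \<Omega> M"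
    using smooth_mapD[OF smooth_mult cc c] by (simp_all add: \<Omega>_def M_def)
  have M_eq: "M (snd c p, snd c q) = snd c (p \<otimes> q)" if "p \<in> fst c" "q \<in> fst c" for p q
    using local_rep_eq[OF charts_inj_prod[OF charts(1) charts(1)] cc, of "(p, q)" c "\<lambda>(x, y). x \<otimes> y"] that
    by (simp add: M_def cc_def)
  have in_\<Omega>: "(snd c p, snd c q) \<in> \<Omega>" if "p \<in> fst c" "q \<in> fst c" "p \<otimes> q \<in> fst c" for p q
  proof -
    have "(p, q) \<in> {p \<in> fst cc. (\<lambda>(x, y). x \<otimes> y) p \<in> fst c}" using that by (simp add: cc_def)
    then have "snd cc (p, q) \<in> \<Omega>" unfolding \<Omega>_def by (rule imageI)
    then show ?thesis by (simp add: cc_def)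
  qed
  have y_\<Omega>: "(e0, y) \<in> \<Omega>" "(y, e0) \<in> \<Omega>" if y: "y \<in> D" for y
  proof -
    obtain p where p: "y = snd c p" "p \<in> fst c" using y by (auto simp: D_def)
    then show "(e0, y) \<in> \<Omega>" "(y, e0) \<in> \<Omega>"
      using in_\<Omega>[OF one_c p(2)] in_\<Omega>[OF p(2) one_c] chart_carrier[OF c p(2)] by (simp_all add: e0_def)
  qed
  define z0 where "z0 = (e0, e0)"
  have z0: "z0 \<in> \<Omega>" unfolding z0_def by (rule y_\<Omega>[OF e0_D])
  \<comment> \<open>\<open>Q\<close> and \<open>P\<close> are the partial derivatives of the
    multiplication in its second and first variable.\<close>
  define Q where "Q v z = frechet_derivative M (at z) (0, v)" for v z
  define P where "P v z = frechet_derivative M (at z) (v, 0)" for v z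
  have smQ: "smooth_on \<Omega> (Q v)" and smP: "smooth_on \<Omega> (P v)" for v
    unfolding Q_def P_def by (intro smooth_on_frechet_derivative \<Omega>(2))+
  have dM: "(M has_derivative frechet_derivative M (at z)) (at z)" if "z \<in> \<Omega>" for z
    by (rule smooth_on_has_derivative[OF \<Omega>(2) that])
  have linM: "linear (frechet_derivative M (at z))" if "z \<in> \<Omega>" for z
    using has_derivative_linear[OF dM[OF that]] .
  \<comment> \<open>The identity (y x y^-1) y = y x differentiated in x at the identity.\<close>
  have key: "P (Ad K c (chart_inv c y) V) (e0, y) = Q V (y, e0)" if y: "y \<in> D" for y V
  proof -
    define p where "p = chart_inv c y"
    have p: "p \<in> fst c" "y = snd c p" using chart_inv_D[OF y] by (simp_all add: p_def)
    have pK: "p \<in> carrier K" using chart_carrier[OF c p(1)] .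
    have d1: "((\<lambda>x. M (y, x)) has_derivative (\<lambda>v. frechet_derivative M (at (y, e0)) (0, v))) (at e0)"
      by (rule has_derivative_compose[OF has_derivative_Pair[OF has_derivative_const has_derivative_ident]
            dM[OF y_\<Omega>(2)[OF y]]])
    have "((\<lambda>x. (cj p x, y)) has_derivative (\<lambda>v. (Ad K c p v, 0))) (at e0)"
      by (rule has_derivative_Pair[OF Ad_has_derivative[OF pK] has_derivative_const])
    moreover have "(M has_derivative frechet_derivative M (at (e0, y))) (at (cj p e0, y))"
      using dM[OF y_\<Omega>(1)[OF y]] cj_e0[OF pK] by simp
    ultimately have "((\<lambda>x. M (cj p x, y)) has_derivative (\<lambda>v. frechet_derivative M (at (e0, y)) (Ad K c p v, 0))) (at e0)"
      by (rule has_derivative_compose)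
    then have "((\<lambda>x. M (y, x)) has_derivative (\<lambda>v. frechet_derivative M (at (e0, y)) (Ad K c p v, 0))) (at e0)"
    proof (rule has_derivative_transform_within_open[OF _ cj_dom(1,3)[OF pK]])
      fix x assume "x \<in> cj_dom p"
      then obtain q where q: "x = snd c q" "q \<in> fst c" "p \<otimes> q \<otimes> inv p \<in> fst c"
        by (auto simp: cj_dom_def)
      have "p \<otimes> q \<otimes> inv p \<otimes> p = p \<otimes> q" using pK chart_carrier[OF c q(2)] by (simp add: m_assoc)
      then show "M (cj p x, y) = M (y, x)"
        by (simp add: q(1) p(2) cj_eq[OF q(2)] M_eq[OF q(3) p(1)] M_eq[OF p(1) q(2)])
    qed
    from has_derivative_unique[OF this d1] show ?thesis unfolding P_def Q_def p_def by metis
  qed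
  have P_z0: "P v z0 = v" for v
  proof -
    have "((\<lambda>x. M (x, e0)) has_derivative (\<lambda>v. frechet_derivative M (at z0) (v, 0))) (at e0)"
      unfolding z0_def
      by (rule has_derivative_compose[OF has_derivative_Pair[OF has_derivative_ident has_derivative_const]
            dM[OF y_\<Omega>(2)[OF e0_D]]])
    moreover have "((\<lambda>x. M (x, e0)) has_derivative (\<lambda>v. v)) (at e0)"
    proof (rule has_derivative_transform_within_open[OF has_derivative_ident open_D e0_D])
      fix x assume "x \<in> D"
      then obtain p where p: "x = snd c p" "p \<in> fst c" by (auto simp: D_def)
      then show "x = M (x, e0)" using M_eq[OF p(2) one_c] chart_carrier[OF c p(2)] by (simp add: e0_def)
    qed
    ultimately have "(\<lambda>v. frechet_derivative M (at z0) (v, 0)) = (\<lambda>v. v)" by (rule has_derivative_unique)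
    then show ?thesis unfolding P_def by metis
  qed
  \<comment> \<open>Separates the two occurrences of y in P (Ad y V) (e0, y): coefficients depending
    on y times P in fixed directions, ready for the product rule.\<close>
  have P_sum: "P V z = (\<Sum>b\<in>Basis. (V \<bullet> b) *\<^sub>R P b z)" if "z \<in> \<Omega>" for V z
  proof -
    have lin: "linear (\<lambda>v. P v z)"
      using linear_compose[OF _ linM[OF that], of "\<lambda>v. (v, 0)"]
      by (simp add: P_def o_def linear_iff)
    have "P (\<Sum>b\<in>Basis. (V \<bullet> b) *\<^sub>R b) z = (\<Sum>b\<in>Basis. (V \<bullet> b) *\<^sub>R P b z)"
      by (simp add: linear_sum[OF lin] linear_scale[OF lin])
    then show ?thesis by (simp add: euclidean_representation)
  qed
  \<comment> \<open>Differentiating \<open>key\<close> in y expresses the bracket by second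
    derivatives of M at the identity. The right-hand side visibly changes sign when U and V are
    exchanged.\<close>
  have main: "br U V = frechet_derivative (Q V) (at z0) (U, 0) - frechet_derivative (Q U) (at z0) (V, 0)" for U V
  proof -
    have rhs: "((\<lambda>y. Q V (y, e0)) has_derivative (\<lambda>u. frechet_derivative (Q V) (at z0) (u, 0))) (at e0)"
      unfolding z0_def
      by (rule has_derivative_compose[OF has_derivative_Pair[OF has_derivative_ident has_derivative_const]
            smooth_on_has_derivative[OF smQ y_\<Omega>(2)[OF e0_D]]])
    have dP: "((\<lambda>y. P b (e0, y)) has_derivative (\<lambda>u. frechet_derivative (P b) (at z0) (0, u))) (at e0)" for b
      unfolding z0_def
      by (rule has_derivative_compose[OF has_derivative_Pair[OF has_derivative_const has_derivative_ident]
            smooth_on_has_derivative[OF smP y_\<Omega>(1)[OF e0_D]]])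
    have dA: "((\<lambda>y. Ad K c (chart_inv c y) V \<bullet> b) has_derivative (\<lambda>u. br u V \<bullet> b)) (at e0)" for b
      by (rule bounded_linear.has_derivative[OF bounded_linear_inner_left Ad_chart_has_derivative])
    have "((\<lambda>y. \<Sum>b\<in>Basis. (Ad K c (chart_inv c y) V \<bullet> b) *\<^sub>R P b (e0, y)) has_derivative
        (\<lambda>u. \<Sum>b\<in>Basis. (Ad K c (chart_inv c e0) V \<bullet> b) *\<^sub>R frechet_derivative (P b) (at z0) (0, u)
          + (br u V \<bullet> b) *\<^sub>R P b (e0, e0))) (at e0)"
      by (rule has_derivative_sum, rule has_derivative_scaleR[OF dA dP])
    then have "((\<lambda>y. Q V (y, e0)) has_derivative
        (\<lambda>u. \<Sum>b\<in>Basis. (Ad K c (chart_inv c e0) V \<bullet> b) *\<^sub>R frechet_derivative (P b) (at z0) (0, u)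
          + (br u V \<bullet> b) *\<^sub>R P b (e0, e0))) (at e0)"
    proof (rule has_derivative_transform_within_open[OF _ open_D e0_D])
      fix y assume y: "y \<in> D"
      show "(\<Sum>b\<in>Basis. (Ad K c (chart_inv c y) V \<bullet> b) *\<^sub>R P b (e0, y)) = Q V (y, e0)"
        using key[OF y, of V] P_sum[OF y_\<Omega>(1)[OF y]] by metis
    qed
    from has_derivative_unique[OF rhs this]
    have "frechet_derivative (Q V) (at z0) (U, 0) =
        (\<Sum>b\<in>Basis. (V \<bullet> b) *\<^sub>R frechet_derivative (P b) (at z0) (0, U) + (br U V \<bullet> b) *\<^sub>R P b z0)"
      unfolding chart_inv_e0 Ad_one z0_def by metis
    also have "\<dots> = (\<Sum>b\<in>Basis. (V \<bullet> b) *\<^sub>R frechet_derivative (P b) (at z0) (0, U)) + br U V"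
      using P_sum[OF z0, of "br U V"] by (simp add: sum.distrib P_z0)
    \<comment> \<open>Symmetry of second derivatives exchanges the directions (b, 0) and (0,
      U).\<close>
    also have "(\<Sum>b\<in>Basis. (V \<bullet> b) *\<^sub>R frechet_derivative (P b) (at z0) (0, U)) =
        (\<Sum>b\<in>Basis. (V \<bullet> b) *\<^sub>R frechet_derivative (Q U) (at z0) (b, 0))"
      using mixed_derivatives_commute[OF \<Omega>(2,1) z0] unfolding P_def Q_def by metis
    also have "\<dots> = frechet_derivative (Q U) (at z0) (V, 0)"
    proof -
      have lin: "linear (\<lambda>v. frechet_derivative (Q U) (at z0) (v, 0))"
        using linear_compose[OF _ has_derivative_linear[OF smooth_on_has_derivative[OF smQ z0]], of "\<lambda>v. (v, 0)"]
        by (simp add: o_def linear_iff)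
      have "frechet_derivative (Q U) (at z0) (\<Sum>b\<in>Basis. (V \<bullet> b) *\<^sub>R b, 0) =
          (\<Sum>b\<in>Basis. (V \<bullet> b) *\<^sub>R frechet_derivative (Q U) (at z0) (b, 0))"
        by (simp add: linear_sum[OF lin] linear_scale[OF lin])
      then show ?thesis by (simp add: euclidean_representation)
    qed
    finally show ?thesis by simp
  qed
  show ?thesis using main[of U V] main[of V U] by simp
qed

section \<open>Curves in a subgroup and its Lie algebra\<close>

lemma curve_near_one:
  assumes "curve_at_one K A c H U \<gamma>"
  shows "open {s. \<gamma> s \<in> fst c}" "0 \<in> {s. \<gamma> s \<in> fst c}" "snd c (\<gamma> 0) = e0"
proof -
  have \<gamma>: "smooth_map real_line_atlas A \<gamma>" "\<gamma> 0 = \<one>" using assms by (simp_all add: curve_at_one_def)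
  show "open {s. \<gamma> s \<in> fst c}"
    using smooth_mapD(1)[OF \<gamma>(1) real_line_atlas_charts(3) c] by simp
  show "0 \<in> {s. \<gamma> s \<in> fst c}" "snd c (\<gamma> 0) = e0" using \<gamma>(2) one_c by (simp_all add: e0_def)
qed

lemma Ad_curve_has_vector_derivative:
  assumes "curve_at_one K A c H U \<gamma>"
  shows "((\<lambda>s. Ad K c (\<gamma> s) V) has_vector_derivative br U V) (at 0)"
proof -
  have d: "((\<lambda>s. snd c (\<gamma> s)) has_vector_derivative U) (at 0)"
    using assms by (simp add: curve_at_one_def o_def)
  have "((\<lambda>s. Ad K c (chart_inv c (snd c (\<gamma> s))) V) has_vector_derivative br U V) (at 0)"
    by (rule has_vector_derivative_chain[OF d]) (simp only: curve_near_one(3)[OF assms] Ad_chart_has_derivative)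
  then show ?thesis
    by (rule has_vector_derivative_transform_open[OF _ curve_near_one(1,2)[OF assms]])
      (simp add: chart_inv_chart[OF c])
qed

text \<open>Sums of velocities come from pointwise products of curves, multiples from rescaling the
  parameter; both operations stay inside \<open>H\<close>.\<close>

lemma subspace_subgroup_lie_algebra:
  assumes H: "subgroup H K"
  shows "subspace (subgroup_lie_algebra K A c H)"
proof -
  have HK: "H \<subseteq> carrier K" using H by (rule subgroup.subset)
  have carr: "\<gamma> s \<in> carrier K" if "curve_at_one K A c H U \<gamma>" for U \<gamma> s
    using that HK by (auto simp: curve_at_one_def)
  show ?thesis
    unfolding subspace_def
  proof (intro conjI ballI allI)
    have "curve_at_one K A c H 0 (\<lambda>s. \<one>)"
      using subgroup.one_closed[OF H] smooth_map_const[OF real_line_atlas_charts(2)]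
      by (auto simp: curve_at_one_def o_def)
    then show "0 \<in> subgroup_lie_algebra K A c H" by (auto simp: subgroup_lie_algebra_def)
  next
    fix U V assume "U \<in> subgroup_lie_algebra K A c H" "V \<in> subgroup_lie_algebra K A c H"
    then obtain \<gamma> \<delta> where \<gamma>: "curve_at_one K A c H U \<gamma>" and \<delta>: "curve_at_one K A c H V \<delta>"
      by (auto simp: subgroup_lie_algebra_def)
    define cc where "cc = (fst c \<times> fst c, map_prod (snd c) (snd c))"
    have cc: "cc \<in> prod_atlas A A" unfolding cc_def prod_atlas_def using c by blast
    define M where "M = local_rep cc c (\<lambda>(x, y). x \<otimes> y)"
    have M_eq: "M (snd c p, snd c q) = snd c (p \<otimes> q)" if "p \<in> fst c" "q \<in> fst c" for p q
      using local_rep_eq[OF charts_inj_prod[OF charts(1) charts(1)] cc, of "(p, q)" c "\<lambda>(x, y). x \<otimes> y"] that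
      by (simp add: M_def cc_def)
    have "snd cc (\<one>, \<one>) \<in> snd cc ` {p \<in> fst cc. (\<lambda>(x, y). x \<otimes> y) p \<in> fst c}"
      by (rule imageI) (simp add: cc_def one_c)
    then have "(M has_derivative frechet_derivative M (at (e0, e0))) (at (e0, e0))"
      using smooth_on_has_derivative[OF smooth_mapD(2)[OF smooth_mult cc c]]
      by (simp add: M_def cc_def e0_def)
    then have dM: "(M has_derivative frechet_derivative M (at (e0, e0))) (at (snd c (\<gamma> 0), snd c (\<delta> 0)))"
      by (simp add: curve_near_one(3)[OF \<gamma>] curve_near_one(3)[OF \<delta>])
    have lin: "linear (frechet_derivative M (at (e0, e0)))" using has_derivative_linear[OF dM] .
    have d0: "((\<lambda>s. (snd c (\<gamma> s), snd c (\<delta> s))) has_vector_derivative (U, V)) (at 0)"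
      using \<gamma> \<delta> by (intro has_vector_derivative_Pair) (simp_all add: curve_at_one_def o_def)
    have "((\<lambda>s. M (snd c (\<gamma> s), snd c (\<delta> s))) has_vector_derivative frechet_derivative M (at (e0, e0)) (U, V)) (at 0)"
      by (rule has_vector_derivative_chain[OF d0 dM])
    \<comment> \<open>M is the identity in each variable when the other is \<open>e0\<close>, so its
      derivative there is addition.\<close>
    moreover have "frechet_derivative M (at (e0, e0)) (U, V) = U + V"
    proof -
      have L: "((\<lambda>x. M (x, e0)) has_derivative (\<lambda>v. frechet_derivative M (at (e0, e0)) (v, 0))) (at e0)"
        "((\<lambda>x. M (e0, x)) has_derivative (\<lambda>v. frechet_derivative M (at (e0, e0)) (0, v))) (at e0)"
        using dM unfolding curve_near_one(3)[OF \<gamma>] curve_near_one(3)[OF \<delta>]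
        by (rule has_derivative_compose[OF has_derivative_Pair[OF has_derivative_ident has_derivative_const]]
            has_derivative_compose[OF has_derivative_Pair[OF has_derivative_const has_derivative_ident]])+
      have id: "x = M (x, e0)" "x = M (e0, x)" if x: "x \<in> D" for x
      proof -
        obtain p where p: "x = snd c p" "p \<in> fst c" using x by (auto simp: D_def)
        then show "x = M (x, e0)" "x = M (e0, x)"
          using M_eq[OF p(2) one_c] M_eq[OF one_c p(2)] chart_carrier[OF c p(2)] by (simp_all add: e0_def)
      qed
      have "((\<lambda>x. M (x, e0)) has_derivative (\<lambda>v. v)) (at e0)" "((\<lambda>x. M (e0, x)) has_derivative (\<lambda>v. v)) (at e0)"
        by (rule has_derivative_transform_within_open[OF has_derivative_ident open_D e0_D], erule id)+
      then have "frechet_derivative M (at (e0, e0)) (U, 0) = U" "frechet_derivative M (at (e0, e0)) (0, V) = V"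
        using has_derivative_unique[OF L(1)] has_derivative_unique[OF L(2)] by metis+
      then show ?thesis using linear_add[OF lin, of "(U, 0)" "(0, V)"] by simp
    qed
    ultimately have "((\<lambda>s. M (snd c (\<gamma> s), snd c (\<delta> s))) has_vector_derivative U + V) (at 0)" by simp
    then have d: "((\<lambda>s. snd c (\<gamma> s \<otimes> \<delta> s)) has_vector_derivative U + V) (at 0)"
      by (rule has_vector_derivative_transform_open[OF _ open_Int[OF curve_near_one(1)[OF \<gamma>] curve_near_one(1)[OF \<delta>]]])
        (use curve_near_one(2)[OF \<gamma>] curve_near_one(2)[OF \<delta>] M_eq in auto)
    have "smooth_map real_line_atlas A (\<lambda>s. \<gamma> s \<otimes> \<delta> s)"
      using \<gamma> \<delta> carr[OF \<gamma>] carr[OF \<delta>] real_line_atlas_charts(1)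
      by (intro smooth_map_mult) (simp_all add: curve_at_one_def)
    then have "curve_at_one K A c H (U + V) (\<lambda>s. \<gamma> s \<otimes> \<delta> s)"
    proof -
      have "\<gamma> s \<otimes> \<delta> s \<in> H" for s
        using \<gamma> \<delta> by (intro subgroup.m_closed[OF H]) (auto simp: curve_at_one_def)
      moreover have "\<gamma> 0 \<otimes> \<delta> 0 = \<one>" using \<gamma> \<delta> by (simp add: curve_at_one_def)
      ultimately show ?thesis using d \<open>smooth_map real_line_atlas A (\<lambda>s. \<gamma> s \<otimes> \<delta> s)\<close>
        by (auto simp: curve_at_one_def o_def)
    qed
    then show "U + V \<in> subgroup_lie_algebra K A c H" by (auto simp: subgroup_lie_algebra_def)
  next
    fix r U assume "U \<in> subgroup_lie_algebra K A c H"
    then obtain \<gamma> where \<gamma>: "curve_at_one K A c H U \<gamma>" by (auto simp: subgroup_lie_algebra_def)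
    have "smooth_map real_line_atlas A (\<lambda>s. \<gamma> (r * s))"
    proof (rule smooth_map_compose[OF smooth_map_real_line_scale _ real_line_atlas_charts(1,1)])
      show "smooth_map real_line_atlas A \<gamma>" using \<gamma> by (simp add: curve_at_one_def)
      show "\<exists>e\<in>real_line_atlas. r * s \<in> fst e" for s
        by (rule bexI[OF _ real_line_atlas_charts(3)]) simp
    qed
    moreover have "((\<lambda>s. snd c (\<gamma> (r * s))) has_vector_derivative r *\<^sub>R U) (at 0)"
    proof -
      have "((\<lambda>s. r * s) has_vector_derivative r) (at 0)"
        by (auto intro!: derivative_eq_intros simp: has_vector_derivative_def)
      moreover have "((\<lambda>s. snd c (\<gamma> s)) has_derivative (\<lambda>s. s *\<^sub>R U)) (at (r * 0))"
        using \<gamma> by (simp add: curve_at_one_def o_def has_vector_derivative_def)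
      ultimately show ?thesis by (rule has_vector_derivative_chain)
    qed
    ultimately have "curve_at_one K A c H (r *\<^sub>R U) (\<lambda>s. \<gamma> (r * s))"
      using \<gamma> by (auto simp: curve_at_one_def o_def)
    then show "r *\<^sub>R U \<in> subgroup_lie_algebra K A c H" by (auto simp: subgroup_lie_algebra_def)
  qed
qed

lemma Ad_subgroup_lie_algebra:
  assumes H: "subgroup H K" and g: "g \<in> H" and U: "U \<in> subgroup_lie_algebra K A c H"
  shows "Ad K c g U \<in> subgroup_lie_algebra K A c H"
proof -
  obtain \<gamma> where \<gamma>: "curve_at_one K A c H U \<gamma>" using U by (auto simp: subgroup_lie_algebra_def)
  have HK: "H \<subseteq> carrier K" using H by (rule subgroup.subset)
  then have gK: "g \<in> carrier K" using g by blast
  have range: "\<gamma> s \<in> H" for s using \<gamma> by (auto simp: curve_at_one_def)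
  have "smooth_map real_line_atlas A (\<lambda>s. g \<otimes> \<gamma> s \<otimes> inv g)"
    by (rule smooth_map_into_group[OF _ smooth_map_conj[OF gK] real_line_atlas_charts(1)])
      (use \<gamma> range HK in \<open>auto simp: curve_at_one_def\<close>)
  moreover have "((\<lambda>s. snd c (g \<otimes> \<gamma> s \<otimes> inv g)) has_vector_derivative Ad K c g U) (at 0)"
  proof -
    have "((\<lambda>s. snd c (\<gamma> s)) has_vector_derivative U) (at 0)" using \<gamma> by (simp add: curve_at_one_def o_def)
    moreover have "(cj g has_derivative Ad K c g) (at (snd c (\<gamma> 0)))"
      using Ad_has_derivative[OF gK] by (simp add: curve_near_one(3)[OF \<gamma>])
    ultimately have "((\<lambda>s. cj g (snd c (\<gamma> s))) has_vector_derivative Ad K c g U) (at 0)"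
      by (rule has_vector_derivative_chain)
    then show ?thesis
      by (rule has_vector_derivative_transform_open[OF _ curve_near_one(1,2)[OF \<gamma>]]) (simp add: cj_eq)
  qed
  moreover have "g \<otimes> \<gamma> s \<otimes> inv g \<in> H" for s
    using g range by (intro subgroup.m_closed[OF H] subgroup.m_inv_closed[OF H])
  moreover have "g \<otimes> \<gamma> 0 \<otimes> inv g = \<one>" using \<gamma> gK by (simp add: curve_at_one_def)
  ultimately have "curve_at_one K A c H (Ad K c g U) (\<lambda>s. g \<otimes> \<gamma> s \<otimes> inv g)"
    by (auto simp: curve_at_one_def o_def)
  then show ?thesis by (auto simp: subgroup_lie_algebra_def)
qed

text \<open>In finite dimension continuity into the space of operators may be checked on basis
  vectors, and on the group chart by chart, where it follows from smoothness of Ad. The image of a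
  compact set is then compact.\<close>

lemma compact_Ad_image:
  assumes H: "subgroup H K" and cpt: "compactin X H"
  shows "compact ((\<lambda>g. Blinfun (Ad K c g)) ` H)"
proof -
  have app: "blinfun_apply (Blinfun (Ad K c g)) = Ad K c g" if "g \<in> carrier K" for g
    by (rule bounded_linear_Blinfun_apply[OF bounded_linear_Ad[OF that]])
  have cont: "continuous_map (subtopology X (fst d)) euclidean (\<lambda>g. Blinfun (Ad K c g))" if d: "d \<in> A" for d
  proof -
    have top: "topspace (subtopology X (fst d)) = fst d"
      using charts(5)[OF d] openin_subset by (auto simp: topspace_subtopology)
    have "continuous_on (snd d ` fst d) (\<lambda>y. Blinfun (Ad K c (chart_inv d y)))"
    proof (rule continuous_on_blinfun_componentwise)
      fix i :: 'e
      have "continuous_on (snd d ` fst d) (\<lambda>y. Ad K c (chart_inv d y) i)"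
        by (rule smooth_on_continuous[OF smooth_on_Ad[OF d]])
      then show "continuous_on (snd d ` fst d) (\<lambda>y. blinfun_apply (Blinfun (Ad K c (chart_inv d y))) i)"
        by (rule continuous_on_eq) (auto simp: chart_inv_chart[OF d] app[OF chart_carrier[OF d]])
    qed
    then have "continuous_map (top_of_set (snd d ` fst d)) euclidean (\<lambda>y. Blinfun (Ad K c (chart_inv d y)))"
      by simp
    with homeomorphic_imp_continuous_map[OF charts(6)[OF d]]
    have "continuous_map (subtopology X (fst d)) euclidean ((\<lambda>y. Blinfun (Ad K c (chart_inv d y))) \<circ> snd d)"
      by (rule continuous_map_compose)
    then show ?thesis
      by (rule continuous_map_eq) (simp add: top chart_inv_chart[OF d])
  qed
  have "continuous_map X euclidean (\<lambda>g. Blinfun (Ad K c g))"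
    unfolding continuous_map
  proof (intro conjI allI impI)
    fix U :: "('e \<Rightarrow>\<^sub>L 'e) set" assume "openin euclidean U"
    have "{g \<in> topspace X. Blinfun (Ad K c g) \<in> U} = (\<Union>d\<in>A. {g \<in> fst d. Blinfun (Ad K c g) \<in> U})"
      using charts(4) by auto
    moreover have "openin X {g \<in> fst d. Blinfun (Ad K c g) \<in> U}" if d: "d \<in> A" for d
    proof -
      have top: "topspace (subtopology X (fst d)) = fst d"
        using charts(5)[OF d] openin_subset by (auto simp: topspace_subtopology)
      have "openin (subtopology X (fst d)) {g \<in> topspace (subtopology X (fst d)). Blinfun (Ad K c g) \<in> U}"
        using cont[OF d] \<open>openin euclidean U\<close> by (rule openin_continuous_map_preimage)
      then show ?thesis unfolding top using charts(5)[OF d] openin_trans_full by blast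
    qed
    ultimately show "openin X {g \<in> topspace X. Blinfun (Ad K c g) \<in> U}" by auto
  qed auto
  from image_compactin[OF cpt this] show ?thesis by simp
qed

end

section \<open>Fatness of the canonical connection\<close>

theorem corollary1:
  fixes K :: "'k monoid" and X :: "'k topology" and A :: "('k, 'e::euclidean_space) chart set"
    and c :: "('k, 'e) chart" and H :: "'k set" and h m t :: "'e set"
    and G :: "(real^'n^'n) set" and Y :: "(real^'n^'n) topology"
    and AG :: "(real^'n^'n, 'g::euclidean_space) chart set"
    and P :: "('k set \<times> ('k set, 'n) frame) set" and u\<^sub>o :: "('k set, 'n) frame"
    and v :: "real^'n^'n \<Rightarrow> real" and X\<^sub>v :: 'e
  defines "br \<equiv> lie_bracket K c"
    and "lam \<equiv> isotropy_lie_rep K X A c H u\<^sub>o"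
  assumes "lie_group K X A" and "connected_space X"
    and "c \<in> A" and "\<one>\<^bsub>K\<^esub> \<in> fst c"
    and "semisimple br"
    and "subgroup H K" and "compactin X H"
    and "h = subgroup_lie_algebra K A c H"
    and "lie_rank br UNIV = lie_rank br h"
    and "reductive_decomposition K c H h m"
    and "linear_lie_group G Y AG"
    and "invariant_G_structure K X A H G P"
    and "(H, u\<^sub>o) \<in> P"
    and "inj_on (isotropy_rep K X A H u\<^sub>o) H"
    and "lam ` h \<subseteq> linear_lie_algebra AG"
    and "nondegenerate_on h (killing br)"
    and "maximal_abelian br h t"
    and "linear_on_subspace (linear_lie_algebra AG) v"
    and "X\<^sub>v \<in> h" and "\<forall>U\<in>h. killing br X\<^sub>v U = v (lam U)"
    and "X\<^sub>v \<notin> (\<Union>g\<in>H. Ad K c g ` (\<Union>\<alpha>\<in>roots br t UNIV - roots br t h. root_hyperplane t \<alpha>))"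
  shows "fat m (curvature br h m lam canonical_connection) v"
proof -
  note LG = assms(3) and c = assms(5) and one_c = assms(6) and ss = assms(7) and H = assms(8) and cpt = assms(9)
    and h_eq = assms(10) and rank = assms(11) and red = assms(12) and lam = assms(17) and t_max = assms(19)
    and v = assms(20) and Xv = assms(21,22) and reg = assms(23)
  interpret LG: lie_group_chart K X A c
    using LG c one_c by (simp add: lie_group_chart_def lie_group_chart_axioms_def)
  interpret L: lie_algebra br
    unfolding br_def
    by unfold_locales (fact LG.bilinear_bracket LG.bracket_antisym LG.bracket_jacobi)+
  define S where "S = (\<lambda>g. Blinfun (Ad K c g)) ` H"
  have HK: "g \<in> carrier K" if "g \<in> H" for g using that subgroup.subset[OF H] by blast
  have app: "blinfun_apply (Blinfun (Ad K c g)) = Ad K c g" if "g \<in> H" for g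
    by (rule bounded_linear_Blinfun_apply[OF LG.bounded_linear_Ad[OF HK[OF that]]])
  have S_cases: "\<exists>g'\<in>H. blinfun_apply g = Ad K c g' \<and> g = Blinfun (Ad K c g')" if "g \<in> S" for g
    using that app unfolding S_def by blast
  have "compact S" unfolding S_def by (rule LG.compact_Ad_image[OF H cpt])
  have "Blinfun (Ad K c \<one>\<^bsub>K\<^esub>) = id_blinfun"
    by (rule blinfun_eqI) (simp add: app[OF subgroup.one_closed[OF H]] LG.Ad_one)
  then have id_S: "id_blinfun \<in> S"
    unfolding S_def using subgroup.one_closed[OF H] by (metis imageI)
  have comp_eq: "Blinfun (Ad K c g) o\<^sub>L Blinfun (Ad K c g') = Blinfun (Ad K c (g \<otimes>\<^bsub>K\<^esub> g'))"
    if "g \<in> H" "g' \<in> H" for g g'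
    by (rule blinfun_eqI) (simp add: that app subgroup.m_closed[OF H] LG.Ad_mult HK)
  have comp_S: "g o\<^sub>L g' \<in> S" if gg': "g \<in> S" "g' \<in> S" for g g'
  proof -
    obtain a b where "a \<in> H" "b \<in> H" "g = Blinfun (Ad K c a)" "g' = Blinfun (Ad K c b)"
      using S_cases[OF gg'(1)] S_cases[OF gg'(2)] by blast
    then show ?thesis using comp_eq subgroup.m_closed[OF H] by (simp add: S_def)
  qed
  have inv_S: "\<exists>g'\<in>S. g' o\<^sub>L g = id_blinfun" if g: "g \<in> S" for g
  proof -
    obtain a where a: "a \<in> H" "g = Blinfun (Ad K c a)" using S_cases[OF g] by blast
    have "Blinfun (Ad K c (inv\<^bsub>K\<^esub> a)) o\<^sub>L g = id_blinfun"
      using comp_eq[OF subgroup.m_inv_closed[OF H a(1)] a(1)] a HK[OF a(1)]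
        \<open>Blinfun (Ad K c \<one>\<^bsub>K\<^esub>) = id_blinfun\<close> by simp
    moreover have "Blinfun (Ad K c (inv\<^bsub>K\<^esub> a)) \<in> S"
      unfolding S_def using subgroup.m_inv_closed[OF H a(1)] by (rule imageI)
    ultimately show ?thesis by blast
  qed
  have sub_h: "subspace h" unfolding h_eq by (rule LG.subspace_subgroup_lie_algebra[OF H])
  have Ad_h: "Ad K c g x \<in> h" if "g \<in> H" "x \<in> h" for g x
    using LG.Ad_subgroup_lie_algebra[OF H] that unfolding h_eq by blast
  have tangent: "\<exists>\<phi>. (\<forall>s::real. \<phi> s \<in> S) \<and> \<phi> 0 = id_blinfun \<and>
      (\<forall>x. ((\<lambda>s. blinfun_apply (\<phi> s) x) has_vector_derivative br U x) (at 0))" if U: "U \<in> h" for U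
  proof -
    obtain \<gamma> where \<gamma>: "curve_at_one K A c H U \<gamma>"
      using U unfolding h_eq subgroup_lie_algebra_def by blast
    have \<gamma>H: "\<gamma> s \<in> H" for s using \<gamma> by (auto simp: curve_at_one_def)
    show ?thesis
    proof (intro exI[of _ "\<lambda>s. Blinfun (Ad K c (\<gamma> s))"] conjI allI)
      show "Blinfun (Ad K c (\<gamma> s)) \<in> S" for s unfolding S_def using \<gamma>H by (rule imageI)
      show "Blinfun (Ad K c (\<gamma> 0)) = id_blinfun"
        using \<gamma> \<open>Blinfun (Ad K c \<one>\<^bsub>K\<^esub>) = id_blinfun\<close> by (simp add: curve_at_one_def)
      show "((\<lambda>s. blinfun_apply (Blinfun (Ad K c (\<gamma> s))) x) has_vector_derivative br U x) (at 0)" for x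
        using LG.Ad_curve_has_vector_derivative[OF \<gamma>, of x] by (simp add: app[OF \<gamma>H] br_def)
    qed
  qed
  have h_alg: "lie_subalgebra br h"
    unfolding lie_subalgebra_def
  proof (intro conjI ballI)
    fix U V assume UV: "U \<in> h" "V \<in> h"
    obtain \<phi> where \<phi>: "\<And>s::real. \<phi> s \<in> S" "((\<lambda>s. blinfun_apply (\<phi> s) V) has_vector_derivative br U V) (at 0)"
      using tangent[OF UV(1)] by blast
    have "blinfun_apply (\<phi> s) V \<in> h" for s using S_cases[OF \<phi>(1)] Ad_h UV(2) by metis
    then show "br U V \<in> h" by (rule has_vector_derivative_in_subspace[OF \<phi>(2) sub_h])
  qed (rule sub_h)
  have "\<exists>q :: 'e \<Rightarrow> 'e \<Rightarrow> real. bilinear q \<and> (\<forall>x y. q x y = q y x) \<and> (\<forall>x. x \<noteq> 0 \<longrightarrow> 0 < q x x) \<and>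
      (\<forall>g\<in>S. \<forall>x y. q (blinfun_apply g x) (blinfun_apply g y) = q x y)"
    by (rule compact_group_invariant_inner) (fact \<open>compact S\<close> id_S comp_S inv_S)+
  then obtain q :: "'e \<Rightarrow> 'e \<Rightarrow> real" where q: "bilinear q" "\<And>x y. q x y = q y x" "\<And>x. x \<noteq> 0 \<Longrightarrow> 0 < q x x"
    "\<And>g x y. g \<in> S \<Longrightarrow> q (blinfun_apply g x) (blinfun_apply g y) = q x y"
    by blast
  have m: "subspace m" "h \<inter> m = {0}" "{U + V |U V. U \<in> h \<and> V \<in> m} = UNIV"
    using red by (simp_all add: reductive_decomposition_def)
  have Ad_m: "Ad K c g x \<in> m" if "g \<in> H" "x \<in> m" for g x
    using red that unfolding reductive_decomposition_def by blast
  interpret E: equal_rank_pair br q S h t m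
  proof unfold_locales
    show "blinfun_apply g (br x y) = br (blinfun_apply g x) (blinfun_apply g y)" if "g \<in> S" for g x y
      using S_cases[OF that] LG.Ad_bracket HK by (auto simp: br_def)
    show "blinfun_apply g x \<in> h" if "g \<in> S" "x \<in> h" for g x
      using S_cases[OF that(1)] Ad_h that(2) by metis
    show "blinfun_apply g x \<in> m" if "g \<in> S" "x \<in> m" for g x
      using S_cases[OF that(1)] Ad_m that(2) by metis
  qed (fact q \<open>compact S\<close> id_S comp_S inv_S tangent h_alg t_max m ss rank)+
  show ?thesis
    unfolding fat_def nondegenerate_on_def
  proof (intro ballI impI)
    fix U assume U: "U \<in> m" and deg: "\<forall>V\<in>m. v (curvature br h m lam canonical_connection U V) = 0"
    show "U = 0"
    proof (rule E.nondegenerate_curvature[OF Xv(1) _ U])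
      fix V assume "V \<in> m"
      define Z where "Z = proj_along h m (br U V)"
      have "Z \<in> h" unfolding Z_def by (rule E.proj_along_h_m)
      then have "lam Z \<in> linear_lie_algebra AG" using lam by blast
      \<comment> \<open>\<open>v\<close> is linear only on the Lie algebra of \<open>G\<close>, so
        the sign of the curvature is moved out as a scalar multiple of \<open>lam Z\<close>, which
        lies in that algebra.\<close>
      then have "v ((-1) *\<^sub>R lam Z) = (-1) *\<^sub>R v (lam Z)"
        using v unfolding linear_on_subspace_def by blast
      moreover have "v (- lam Z) = 0"
        using deg \<open>V \<in> m\<close> by (simp add: curvature_canonical Z_def)
      ultimately show "killing br X\<^sub>v Z = 0" using Xv(2) \<open>Z \<in> h\<close> by simp
    next
      fix g \<alpha> assume g: "g \<in> S" and \<alpha>: "\<alpha> \<in> roots br t UNIV - roots br t h"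
      obtain a where a: "a \<in> H" "blinfun_apply g = Ad K c a" using S_cases[OF g] by blast
      have aK: "a \<in> carrier K" "inv\<^bsub>K\<^esub> a \<in> H" using HK[OF a(1)] subgroup.m_inv_closed[OF H a(1)] by auto
      \<comment> \<open>If Ad a sent \<open>X\<^sub>v\<close> into a root hyperplane,
        \<open>X\<^sub>v\<close> would lie in the image of that hyperplane under the inverse of a,
        against the hypothesis.\<close>
      have "X\<^sub>v = Ad K c (inv\<^bsub>K\<^esub> a \<otimes>\<^bsub>K\<^esub> a) X\<^sub>v" using aK(1) by (simp add: LG.Ad_one)
      also have "\<dots> = Ad K c (inv\<^bsub>K\<^esub> a) (g X\<^sub>v)" by (simp only: LG.Ad_mult[OF HK[OF aK(2)] aK(1)] a(2))
      finally have "X\<^sub>v = Ad K c (inv\<^bsub>K\<^esub> a) (g X\<^sub>v)" .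
      then show "g X\<^sub>v \<notin> root_hyperplane t \<alpha>" using reg aK(2) \<alpha> by blast
    qed
  qed
qed

end
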